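(* Let $[M_1,\dots,M_m]$ and $[E_1,\dots,E_m]$ be admissible data of $2\times2$ matrices, and let $\varkappa_1\ge\varkappa_2$ be the indices of the systems of standard form with these data and with singularities $a_1,\dots,a_m$. (i) If $[M_1,\dots,M_m]$ is diagonalizable, or if $[M_1,\dots,M_m]$ possesses exactly one non-trivial invariant subspace and $n_1\ge n_2$ holds, then the indices are $\varkappa_1=n_1$ and $\varkappa_2=n_2$. (ii) If $[M_1,\dots,M_m]$ is irreducible, or if $[M_1,\dots,M_m]$ possesses exactly one non-trivial invariant subspace and $n_1<n_2$ holds, then the indices fulfill the conditions $$\varkappa_1-\varkappa_2\le m-2\quad\text{and}\quad\varkappa_1+\varkappa_2=\varkappa.$$
   Context: $\dot{\mathbb C}=\mathbb C\cup\{\infty\}$; $G\mathbb C^{n\times n}$ is the group of invertible complex $n\times n$ matrices; for single matrices $M\sim M'$ means similarity. The distinct points $a_1,\dots,a_m\in\mathbb C$ lie in this order on a fixed smooth (simple) closed positively oriented curve $\Gamma\subset\mathbb C$ (indices cyclic). Let $S=\dot{\mathbb C}\setminus\{a_1,\dots,a_m\}$, $\rho:\tilde S\to S$ its universal covering, write $z=\rho(\tilde z)$ for $\tilde z\in\tilde S$, and $\tilde S^*=\tilde S\setminus\rho^{-1}(\infty)$. For small $\delta>0$, $D_a=\{0<|z-a|<\delta\}$ ($a\in\mathbb C$), $D_\infty=\{|z|>1/\delta\}$, $\tilde D_a$ is the universal covering of $D_a$, and $(\tilde z-a)^E=\exp(E\ln(\tilde z-a))$ on $\tilde D_a$. Fix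 $\tilde z_0\in\tilde S$ with $\rho(\tilde z_0)$ inside $\Gamma$; for each $k$ let $\tilde z_k$ be the endpoint of a simple path in $\tilde S$ starting at $\tilde z_0$ whose projection is a closed curve based at $\rho(\tilde z_0)$ meeting $\Gamma$ exactly twice, first on the subarc joining $a_{k-1}$ and $a_k$, then on the subarc joining $a_k$ and $a_{k+1}$ (so it goes once around $a_k$ in the positive direction), and let $\sigma_k$ be the deck transformation of $\tilde S$ with $\sigma_k(\tilde z_0)=\tilde z_k$. For a solution $Y:\tilde S^*\to G\mathbb C^{n\times n}$ of a linear system $Y'(\tilde z)=A(z)Y(\tilde z)$, the matrices $\chi(\sigma)$ are defined by $Y(\tilde z)=Y(\sigma(\tilde z))\chi(\sigma)$. Two $m$-tuples of matrices are equivalent if they are simultaneously similar; $[\cdot]_\sim$ is the equivalence class. The monodromy of the system is $[\chi(\sigma_1),\dots,\chi(\sigma_m)]_\sim$. A matrix is non-resonant if no two of its eigenvalues differ by a nonzero integer. Tuples $[M_1,\dots,M_m]$, $[E_1,\dots,E_m]$ of $n\times n$ matrices are admissible data if $M_1\cdots M_m=I$, $M_k\sim\exp(-2\pi iE_k)$ for each $k$, and all $E_k$ are non-resonant. The system $Y'(\tilde z)=A(z)Y(\tilde z)$ is of standard form with respect to these admissible data, with singularities $a_1,\dots,a_m$ and indices $\varkappa_1\ge\dots\ge\varkappa_n$ (integers) if: (i) it has singularities only at $a_1,\dots,a_m$ and at infinity (i.e. $A$ is analytic on $\mathbb C\setminus\{a_1,\dots,a_m\}$), the singularity at infinity being apparent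 (solutions have no branching there); (ii) its monodromy is $[M_1,\dots,M_m]_\sim$; (iii) for each $k$ the solutions on $\tilde D_{a_k}$ can be written $Y(\tilde z)=Z_k(z)(\tilde z-a_k)^{E_k}C$ with $Z_k:D_{a_k}\cup\{a_k\}\to G\mathbb C^{n\times n}$ analytic and $C\in G\mathbb C^{n\times n}$; (iv) the solutions on $D_\infty$ can be written $Y(z)=\mathrm{diag}(z^{\varkappa_1},\dots,z^{\varkappa_n})Z_\infty(z)C$ with $Z_\infty:D_\infty\cup\{\infty\}\to G\mathbb C^{n\times n}$ analytic and $C\in G\mathbb C^{n\times n}$. For given admissible data and singularities such a system exists and its indices are uniquely determined by the data and the singularities. Reducibility of $2\times2$ data. Put $\varkappa=\mathrm{trace}\,E_1+\dots+\mathrm{trace}\,E_m$. Invariant subspaces of $[M_1,\dots,M_m]$ are common invariant subspaces of all $M_k$; non-trivial means different from $\{0\}$ and $\mathbb C^2$; irreducible means that there is no non-trivial one; diagonalizable means simultaneously diagonalizable (equivalently, at least two non-trivial invariant subspaces). If $[M_1,\dots,M_m]$ has exactly one non-trivial invariant subspace, it is equivalent to a tuple of upper triangular matrices $\begin{pmatrix}\mu_k^{(1)}&\alpha_k\\0&\mu_k^{(2)}\end{pmatrix}$, $k=1,\dots,m$; here $\mu_k^{(1)}$ is the eigenvalue of $M_k$ on the invariant subspace and $\mu_k^{(2)}$ the other one, so these are unique. Let $\varepsilon_k^{(1)},\varepsilon_k^{(2)}$ be the eigenvalues of $E_k$ numbered such that $\mu_k^{(j)}=\exp(-2\pi i\varepsilon_k^{(j)})$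 and define the integers $n_j=\varepsilon_1^{(j)}+\dots+\varepsilon_m^{(j)}$, $j=1,2$. In the diagonalizable case take $\alpha_k=0$ and define $n_1,n_2$ in the same way; they are then determined only up to order, and are numbered so that $n_1\ge n_2$. *)

theory Defs
  imports "HOL-Complex_Analysis.Complex_Analysis"
begin

subsection \<open>Matrices\<close>

definition scale_matrix :: "complex \<Rightarrow> complex^'n^'n \<Rightarrow> complex^'n^'n" where
  "scale_matrix c A = (\<chi> i j. c * A $ i $ j)"

primrec matrix_power :: "complex^'n^'n \<Rightarrow> nat \<Rightarrow> complex^'n^'n" where
  "matrix_power A 0 = mat 1"
| "matrix_power A (Suc k) = A ** matrix_power A k"

definition matrix_exp :: "complex^'n^'n \<Rightarrow> complex^'n^'n" where
  "matrix_exp A = (\<Sum>k. (1 / fact k) *\<^sub>R matrix_power A k)"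

definition is_eigenvalue :: "complex^'n^'n \<Rightarrow> complex \<Rightarrow> bool" where
  "is_eigenvalue A \<mu> \<longleftrightarrow> (\<exists>v. v \<noteq> 0 \<and> A *v v = \<mu> *s v)"

text \<open>The two eigenvalues of a \<open>2 \<times> 2\<close> matrix, listed with algebraic multiplicity.\<close>

definition has_eigenvalues :: "complex^2^2 \<Rightarrow> complex \<Rightarrow> complex \<Rightarrow> bool" where
  "has_eigenvalues A \<epsilon>1 \<epsilon>2 \<longleftrightarrow> (\<forall>x. det (mat x - A) = (x - \<epsilon>1) * (x - \<epsilon>2))"

definition non_resonant :: "complex^'n^'n \<Rightarrow> bool" where
  "non_resonant A \<longleftrightarrow>
     (\<forall>\<mu> \<nu>. is_eigenvalue A \<mu> \<and> is_eigenvalue A \<nu> \<and> \<mu> - \<nu> \<in> \<int> \<longrightarrow> \<mu> = \<nu>)"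

definition similar_matrices :: "complex^'n^'n \<Rightarrow> complex^'n^'n \<Rightarrow> bool" where
  "similar_matrices A B \<longleftrightarrow> (\<exists>P. invertible P \<and> B = matrix_inv P ** A ** P)"

definition analytic_matrix_on :: "(complex \<Rightarrow> complex^'n^'n) \<Rightarrow> complex set \<Rightarrow> bool" where
  "analytic_matrix_on F S \<longleftrightarrow> (\<forall>i j. (\<lambda>z. F z $ i $ j) analytic_on S)"

subsection \<open>Tuples of matrices\<close>

text \<open>An \<open>m\<close>-tuple is a function on \<open>nat\<close> of which only the values at \<open>1, \<dots>, m\<close> matter.\<close>

definition equivalent_tuples ::
    "nat \<Rightarrow> (nat \<Rightarrow> complex^'n^'n) \<Rightarrow> (nat \<Rightarrow> complex^'n^'n) \<Rightarrow> bool" where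
  "equivalent_tuples m M N \<longleftrightarrow>
     (\<exists>P. invertible P \<and> (\<forall>k\<in>{1..m}. N k = matrix_inv P ** M k ** P))"

definition ordered_product :: "nat \<Rightarrow> (nat \<Rightarrow> complex^'n^'n) \<Rightarrow> complex^'n^'n" where
  "ordered_product m M = foldr (\<lambda>k B. M k ** B) [1..<Suc m] (mat 1)"

definition admissible_data ::
    "nat \<Rightarrow> (nat \<Rightarrow> complex^'n^'n) \<Rightarrow> (nat \<Rightarrow> complex^'n^'n) \<Rightarrow> bool" where
  "admissible_data m M E \<longleftrightarrow>
     ordered_product m M = mat 1 \<and>
     (\<forall>k\<in>{1..m}. similar_matrices (M k) (matrix_exp (scale_matrix (- 2 * pi * \<i>) (E k)))
        \<and> non_resonant (E k))"

definition nontrivial_invariant_subspace ::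
    "nat \<Rightarrow> (nat \<Rightarrow> complex^'n^'n) \<Rightarrow> (complex^'n) set \<Rightarrow> bool" where
  "nontrivial_invariant_subspace m M V \<longleftrightarrow>
     vec.subspace V \<and> V \<noteq> {0} \<and> V \<noteq> UNIV \<and> (\<forall>k\<in>{1..m}. \<forall>v\<in>V. M k *v v \<in> V)"

definition irreducible_tuple :: "nat \<Rightarrow> (nat \<Rightarrow> complex^'n^'n) \<Rightarrow> bool" where
  "irreducible_tuple m M \<longleftrightarrow> \<not> (\<exists>V. nontrivial_invariant_subspace m M V)"

definition one_invariant_subspace :: "nat \<Rightarrow> (nat \<Rightarrow> complex^'n^'n) \<Rightarrow> bool" where
  "one_invariant_subspace m M \<longleftrightarrow> (\<exists>!V. nontrivial_invariant_subspace m M V)"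

definition diagonal_tuple :: "nat \<Rightarrow> (nat \<Rightarrow> complex^'n^'n) \<Rightarrow> bool" where
  "diagonal_tuple m T \<longleftrightarrow> (\<forall>k\<in>{1..m}. \<forall>i j. i \<noteq> j \<longrightarrow> T k $ i $ j = 0)"

definition upper_triangular_tuple :: "nat \<Rightarrow> (nat \<Rightarrow> complex^2^2) \<Rightarrow> bool" where
  "upper_triangular_tuple m T \<longleftrightarrow> (\<forall>k\<in>{1..m}. T k $ 2 $ 1 = 0)"

definition diagonalizable_tuple :: "nat \<Rightarrow> (nat \<Rightarrow> complex^'n^'n) \<Rightarrow> bool" where
  "diagonalizable_tuple m M \<longleftrightarrow> (\<exists>T. equivalent_tuples m M T \<and> diagonal_tuple m T)"

text \<open>
  The integers \<open>n\<^sub>1, n\<^sub>2\<close> belonging to an upper triangular tuple \<open>T\<close> with diagonal entries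
  \<open>\<mu>\<^sub>k\<^sup>1, \<mu>\<^sub>k\<^sup>2\<close>.  Because \<open>E k\<close> is non-resonant, the condition on the exponentials fixes the
  numbering of its eigenvalues (or they coincide); because the product of the tuple is \<open>I\<close>,
  the sums are integers.
\<close>

definition exponent_sums ::
    "nat \<Rightarrow> (nat \<Rightarrow> complex^2^2) \<Rightarrow> (nat \<Rightarrow> complex^2^2) \<Rightarrow> int \<Rightarrow> int \<Rightarrow> bool" where
  "exponent_sums m T E n1 n2 \<longleftrightarrow>
     (\<exists>\<epsilon>1 \<epsilon>2. (\<forall>k\<in>{1..m}. has_eigenvalues (E k) (\<epsilon>1 k) (\<epsilon>2 k)
                 \<and> T k $ 1 $ 1 = exp (- 2 * pi * \<i> * \<epsilon>1 k)
                 \<and> T k $ 2 $ 2 = exp (- 2 * pi * \<i> * \<epsilon>2 k))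
        \<and> of_int n1 = (\<Sum>k=1..m. \<epsilon>1 k) \<and> of_int n2 = (\<Sum>k=1..m. \<epsilon>2 k))"

definition triangular_exponent_sums ::
    "nat \<Rightarrow> (nat \<Rightarrow> complex^2^2) \<Rightarrow> (nat \<Rightarrow> complex^2^2) \<Rightarrow> int \<Rightarrow> int \<Rightarrow> bool" where
  "triangular_exponent_sums m M E n1 n2 \<longleftrightarrow>
     (\<exists>T. equivalent_tuples m M T \<and> upper_triangular_tuple m T \<and> exponent_sums m T E n1 n2)"

text \<open>For a diagonal form the two columns may be exchanged; they are numbered with \<open>n1 \<ge> n2\<close>.\<close>

definition diagonal_exponent_sums ::
    "nat \<Rightarrow> (nat \<Rightarrow> complex^2^2) \<Rightarrow> (nat \<Rightarrow> complex^2^2) \<Rightarrow> int \<Rightarrow> int \<Rightarrow> bool" where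
  "diagonal_exponent_sums m M E n1 n2 \<longleftrightarrow>
     (\<exists>T. equivalent_tuples m M T \<and> diagonal_tuple m T \<and> exponent_sums m T E n1 n2) \<and> n1 \<ge> n2"

subsection \<open>The Riemann sphere and the curve through the singularities\<close>

text \<open>
  The Riemann sphere is the unit sphere of \<open>complex \<times> real\<close>; \<open>to_sphere\<close> is inverse
  stereographic projection from the north pole, which represents \<open>\<infinity>\<close>, and \<open>affine_coord\<close>
  is the projection itself.
\<close>

definition to_sphere :: "complex \<Rightarrow> complex \<times> real" where
  "to_sphere z = ((2 / ((cmod z)\<^sup>2 + 1)) *\<^sub>R z, ((cmod z)\<^sup>2 - 1) / ((cmod z)\<^sup>2 + 1))"

definition sphere_infinity :: "complex \<times> real" where
  "sphere_infinity = (0, 1)"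

definition affine_coord :: "complex \<times> real \<Rightarrow> complex" where
  "affine_coord q = (1 / (1 - snd q)) *\<^sub>R fst q"

definition punctured_sphere :: "nat \<Rightarrow> (nat \<Rightarrow> complex) \<Rightarrow> (complex \<times> real) set" where
  "punctured_sphere m a = sphere 0 1 - to_sphere ` a ` {1..m}"

text \<open>
  A simple closed curve is a 1-periodic function, so that arcs may run across the parameter \<open>1\<close>.
  Smooth means continuously differentiable with non-vanishing velocity.
\<close>

definition smooth_simple_closed_curve :: "(real \<Rightarrow> complex) \<Rightarrow> bool" where
  "smooth_simple_closed_curve \<gamma> \<longleftrightarrow>
     \<gamma> C1_differentiable_on UNIV \<and> (\<forall>s. vector_derivative \<gamma> (at s) \<noteq> 0) \<and>
     (\<forall>s. \<gamma> (s + 1) = \<gamma> s) \<and> inj_on \<gamma> {0..<1}"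

definition positively_oriented :: "(real \<Rightarrow> complex) \<Rightarrow> bool" where
  "positively_oriented \<gamma> \<longleftrightarrow> (\<forall>z\<in>inside (path_image \<gamma>). winding_number \<gamma> z = 1)"

text \<open>\<open>a 1, \<dots>, a m\<close> are distinct and are passed in this order during one turn; \<open>t\<close> holds their
  parameters.\<close>

definition points_in_order ::
    "nat \<Rightarrow> (real \<Rightarrow> complex) \<Rightarrow> (nat \<Rightarrow> real) \<Rightarrow> (nat \<Rightarrow> complex) \<Rightarrow> bool" where
  "points_in_order m \<gamma> t a \<longleftrightarrow>
     (\<forall>k\<in>{1..m}. a k = \<gamma> (t k)) \<and>
     (\<forall>j\<in>{1..m}. \<forall>k\<in>{1..m}. j < k \<longrightarrow> t j < t k \<and> t k < t j + 1)"

text \<open>The open subarc joining \<open>a k\<close> to \<open>a (k + 1)\<close>, and cyclically \<open>a m\<close> to \<open>a 1\<close>.\<close>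

definition subarc :: "nat \<Rightarrow> (real \<Rightarrow> complex) \<Rightarrow> (nat \<Rightarrow> real) \<Rightarrow> nat \<Rightarrow> complex set" where
  "subarc m \<gamma> t k = \<gamma> ` {t k <..< (if k < m then t (k + 1) else t 1 + 1)}"

definition cyclic_pred :: "nat \<Rightarrow> nat \<Rightarrow> nat" where
  "cyclic_pred m k = (if k = 1 then m else k - 1)"

subsection \<open>The universal covering and its deck transformations\<close>

definition universal_covering ::
    "'a::topological_space set \<Rightarrow> ('a \<Rightarrow> 'b::topological_space) \<Rightarrow> 'b set \<Rightarrow> bool" where
  "universal_covering X \<rho> S \<longleftrightarrow> covering_space X \<rho> S \<and> simply_connected X"

definition deck_transformation ::
    "'a::topological_space set \<Rightarrow> ('a \<Rightarrow> 'b) \<Rightarrow> ('a \<Rightarrow> 'a) \<Rightarrow> bool" where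
  "deck_transformation X \<rho> \<sigma> \<longleftrightarrow>
     (\<exists>\<sigma>'. homeomorphism X X \<sigma> \<sigma>') \<and> (\<forall>x\<in>X. \<rho> (\<sigma> x) = \<rho> x)"

text \<open>
  The projected loop meets the curve only at the parameters \<open>r < s\<close>, where it leaves the interior
  and comes back to it; in between it runs in the exterior, which contains \<open>\<infinity>\<close>.
  Requiring the two meetings to be such crossings, rather than mere contacts, is what makes the
  loop surround \<open>a k\<close> once in the positive direction.
\<close>

definition encircling_path ::
    "nat \<Rightarrow> (real \<Rightarrow> complex) \<Rightarrow> (nat \<Rightarrow> real) \<Rightarrow> 'a::topological_space set \<Rightarrow>
       ('a \<Rightarrow> complex \<times> real) \<Rightarrow> nat \<Rightarrow> (real \<Rightarrow> 'a) \<Rightarrow> bool" where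
  "encircling_path m \<gamma> t X \<rho> k p \<longleftrightarrow>
     simple_path p \<and> path_image p \<subseteq> X \<and> \<rho> (pathfinish p) = \<rho> (pathstart p) \<and>
     (\<exists>r s. 0 < r \<and> r < s \<and> s < 1 \<and>
        \<rho> (p r) \<in> to_sphere ` subarc m \<gamma> t (cyclic_pred m k) \<and>
        \<rho> (p s) \<in> to_sphere ` subarc m \<gamma> t k \<and>
        (\<forall>u\<in>{0..<r} \<union> {s<..1}. \<rho> (p u) \<in> to_sphere ` inside (path_image \<gamma>)) \<and>
        (\<forall>u\<in>{r<..<s}. \<rho> (p u) \<notin> to_sphere ` (path_image \<gamma> \<union> inside (path_image \<gamma>))))"

definition standard_deck_transformations ::
    "nat \<Rightarrow> (real \<Rightarrow> complex) \<Rightarrow> (nat \<Rightarrow> real) \<Rightarrow> 'a::topological_space set \<Rightarrow>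
       ('a \<Rightarrow> complex \<times> real) \<Rightarrow> 'a \<Rightarrow> (nat \<Rightarrow> 'a \<Rightarrow> 'a) \<Rightarrow> bool" where
  "standard_deck_transformations m \<gamma> t X \<rho> z0 \<sigma> \<longleftrightarrow>
     (\<forall>k\<in>{1..m}. deck_transformation X \<rho> (\<sigma> k) \<and>
        (\<exists>p. encircling_path m \<gamma> t X \<rho> k p \<and> pathstart p = z0 \<and> pathfinish p = \<sigma> k z0))"

subsection \<open>Linear systems\<close>

text \<open>
  \<open>Y : X \<rightarrow> GL\<^sub>n(\<complex>)\<close> solves \<open>Y' = A(z) Y\<close> on a space \<open>X\<close> spread over the plane by the local
  homeomorphism \<open>p\<close>, where \<open>z = p x\<close>: the derivative is taken with respect to \<open>z\<close>, along a local
  section of \<open>p\<close>.  It is used for the covering of the punctured sphere, for the universal covering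
  \<open>w \<mapsto> c + exp w\<close> of a punctured disc about \<open>c\<close>, and for plane domains with \<open>p = id\<close>.
\<close>

definition solution_on ::
    "(complex \<Rightarrow> complex^'n^'n) \<Rightarrow> 'a::topological_space set \<Rightarrow> ('a \<Rightarrow> complex) \<Rightarrow>
       ('a \<Rightarrow> complex^'n^'n) \<Rightarrow> bool" where
  "solution_on A X p Y \<longleftrightarrow>
     (\<forall>x\<in>X. invertible (Y x) \<and>
        (\<exists>V s. open V \<and> p x \<in> V \<and> continuous_on V s \<and> s ` V \<subseteq> X \<and>
           (\<forall>z\<in>V. p (s z) = z) \<and> s (p x) = x \<and>
           (\<forall>i j. ((\<lambda>z. Y (s z) $ i $ j) has_field_derivative (A (p x) ** Y x) $ i $ j)
                    (at (p x)))))"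

definition finite_part :: "'a set \<Rightarrow> ('a \<Rightarrow> complex \<times> real) \<Rightarrow> 'a set" where
  "finite_part X \<rho> = {x \<in> X. \<rho> x \<noteq> sphere_infinity}"

definition has_monodromy ::
    "nat \<Rightarrow> 'a::topological_space set \<Rightarrow> ('a \<Rightarrow> complex \<times> real) \<Rightarrow> (nat \<Rightarrow> 'a \<Rightarrow> 'a) \<Rightarrow>
       (complex \<Rightarrow> complex^'n^'n) \<Rightarrow> (nat \<Rightarrow> complex^'n^'n) \<Rightarrow> bool" where
  "has_monodromy m X \<rho> \<sigma> A M \<longleftrightarrow>
     (\<exists>Y N. solution_on A (finite_part X \<rho>) (affine_coord \<circ> \<rho>) Y \<and>
        (\<forall>k\<in>{1..m}. \<forall>x\<in>finite_part X \<rho>. Y x = Y (\<sigma> k x) ** N k) \<and>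
        equivalent_tuples m N M)"

definition apparent_at_infinity :: "(complex \<Rightarrow> complex^'n^'n) \<Rightarrow> bool" where
  "apparent_at_infinity A \<longleftrightarrow> (\<exists>\<delta>>0. \<exists>Y. solution_on A {z. cmod z > 1 / \<delta>} (\<lambda>z. z) Y)"

text \<open>
  The universal covering of \<open>{0 < \<bar>z - a k\<bar> < \<delta>}\<close> is the half-plane \<open>Re w < ln \<delta>\<close> with
  \<open>z = a k + exp w\<close>, so that \<open>w = ln (z - a k)\<close> and \<open>(z - a k)\<^sup>E = exp (w E)\<close>.
\<close>

definition local_form_at ::
    "nat \<Rightarrow> (nat \<Rightarrow> complex) \<Rightarrow> nat \<Rightarrow> complex^'n^'n \<Rightarrow> (complex \<Rightarrow> complex^'n^'n) \<Rightarrow> bool" where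
  "local_form_at m a k E A \<longleftrightarrow>
     (\<exists>\<delta>>0. \<exists>Z. (\<forall>j\<in>{1..m}. j \<noteq> k \<longrightarrow> a j \<notin> ball (a k) \<delta>) \<and>
        analytic_matrix_on Z (ball (a k) \<delta>) \<and> (\<forall>z\<in>ball (a k) \<delta>. invertible (Z z)) \<and>
        (\<forall>Y. solution_on A {w. Re w < ln \<delta>} (\<lambda>w. a k + exp w) Y \<longleftrightarrow>
           (\<exists>C. invertible C \<and>
              (\<forall>w. Re w < ln \<delta> \<longrightarrow>
                 Y w = Z (a k + exp w) ** matrix_exp (scale_matrix w E) ** C))))"

definition diag_powers :: "('n \<Rightarrow> int) \<Rightarrow> complex \<Rightarrow> complex^'n^'n" where
  "diag_powers \<kappa> z = (\<chi> i j. if i = j then z powi \<kappa> i else 0)"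

text \<open>Here \<open>Z\<close> is the analytic factor at infinity expressed in the coordinate \<open>1 / z\<close>.\<close>

definition local_form_at_infinity ::
    "nat \<Rightarrow> (nat \<Rightarrow> complex) \<Rightarrow> ('n \<Rightarrow> int) \<Rightarrow> (complex \<Rightarrow> complex^'n^'n) \<Rightarrow> bool" where
  "local_form_at_infinity m a \<kappa> A \<longleftrightarrow>
     (\<exists>\<delta>>0. \<exists>Z. (\<forall>j\<in>{1..m}. cmod (a j) \<le> 1 / \<delta>) \<and>
        analytic_matrix_on Z (ball 0 \<delta>) \<and> (\<forall>u\<in>ball 0 \<delta>. invertible (Z u)) \<and>
        (\<forall>Y. solution_on A {z. cmod z > 1 / \<delta>} (\<lambda>z. z) Y \<longleftrightarrow>
           (\<exists>C. invertible C \<and>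
              (\<forall>z. cmod z > 1 / \<delta> \<longrightarrow> Y z = diag_powers \<kappa> z ** Z (1 / z) ** C))))"

text \<open>The ordering of the indices \<open>\<kappa>\<close> is not part of this predicate, since the index type \<open>'n\<close>
  need not be ordered.\<close>

definition standard_form ::
    "nat \<Rightarrow> (nat \<Rightarrow> complex) \<Rightarrow> 'a::topological_space set \<Rightarrow> ('a \<Rightarrow> complex \<times> real) \<Rightarrow>
       (nat \<Rightarrow> 'a \<Rightarrow> 'a) \<Rightarrow> (nat \<Rightarrow> complex^'n^'n) \<Rightarrow> (nat \<Rightarrow> complex^'n^'n) \<Rightarrow> ('n \<Rightarrow> int) \<Rightarrow>
       (complex \<Rightarrow> complex^'n^'n) \<Rightarrow> bool" where
  "standard_form m a X \<rho> \<sigma> M E \<kappa> A \<longleftrightarrow>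
     analytic_matrix_on A (UNIV - a ` {1..m}) \<and> apparent_at_infinity A \<and>
     has_monodromy m X \<rho> \<sigma> A M \<and>
     (\<forall>k\<in>{1..m}. local_form_at m a k (E k) A) \<and>
     local_form_at_infinity m a \<kappa> A"

end

theory Submission
  imports Defs
begin

text \<open>
  Cutting the sphere along the arc of \<open>\<Gamma>\<close> complementary to the \<open>k\<close>-th subarc leaves a simply
  connected domain, over which the universal covering has a section through the base point.  The
  fundamental solutions \<open>\<Phi>\<^sub>k\<close> pulled back along these sections agree inside \<open>\<Gamma>\<close>, and following the
  \<open>k\<close>-th encircling path shows that \<open>\<Phi>\<^sub>k = \<Phi>\<^sub>k\<^sub>-\<^sub>1 N\<^sub>k\<close> outside.  Partial winding numbers of \<open>\<Gamma>\<close> give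
  branches of \<open>\<Prod> (z - a\<^sub>k)\<^bsup>\<epsilon>\<^sub>k\<^esup>\<close> with the same transition rule, so a common eigenvector of the monodromy
  with eigenvalues \<open>exp (- 2\<pi>\<i>\<epsilon>\<^sub>k)\<close> yields a single-valued vector \<open>p\<close> with
  \<open>p' = (A - \<Sum> \<epsilon>\<^sub>k / (z - a\<^sub>k)) p\<close>.

  By non-resonance \<open>p\<close> extends to an entire vector function without zeros, and its growth at infinity
  is governed by the indices; Liouville's theorem then gives \<open>n\<^sub>1 \<le> \<kappa>\<^sub>1\<close>, with equality if the second
  component of \<open>p\<close> vanishes, as it must if \<open>\<kappa>\<^sub>2 < n\<^sub>1\<close>.  Applied to the trace of \<open>A\<close>, Liouville's
  theorem gives the sum of the indices; applied to \<open>A\<^sub>2\<^sub>1 \<Prod> (z - a\<^sub>k)\<close> it gives \<open>A\<^sub>2\<^sub>1 = 0\<close> if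
  \<open>\<kappa>\<^sub>1 - \<kappa>\<^sub>2 > m - 2\<close>, and then the monodromy has an invariant line consisting of solutions with
  vanishing second component.
\<close>

text \<open>The homotopy class of an encircling path is never computed: the path is followed only
  while its projection stays in one cut domain, and uniqueness of lifts over connected sets does the
  rest. The cuts are made in the sphere because the exterior part of the path may pass through
  \<infinity>. The exponents enter through the factorisation of \<Prod> (z - a_k)^\<epsilon>_k into
  (z - a_1)^n and powers of the quotients (z - a_k) / (z - a_1): the quotients have logarithms off
  the complementary arc, and the first factor is single-valued because n is an integer. In (i) the
  Liouville bound leaves \<kappa>_1 > n_1 to be excluded; there n_1 \<ge> n_2 and the sum of the
  indices give \<kappa>_2 < n_1, so the equality case applies and contradicts \<kappa>_1 > n_1. In
  (ii) the line found by triangularity must be the given invariant line, so that p carries the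
  exponents of that line and has second component zero; then \<kappa>_1 = n_1 is less than half of
  \<kappa>_1 + \<kappa>_2 = n_1 + n_2, against \<kappa>_1 \<ge> \<kappa>_2.\<close>

no_notation fps_nth (infixl "$" 75)

subsection \<open>Linear systems of rank two\<close>

text \<open>The scalar term \<theta> keeps the twisted equation of p and the original system
  (\<theta> = 0) under one notion: a scalar factor with logarithmic derivative \<eta> only turns
  \<theta> into \<theta> - \<eta>.\<close>

definition solves_on ::
    "(complex \<Rightarrow> complex^2^2) \<Rightarrow> (complex \<Rightarrow> complex) \<Rightarrow> complex set \<Rightarrow>
       (complex \<Rightarrow> complex^2) \<Rightarrow> bool" where
  "solves_on A \<theta> S y \<longleftrightarrow>
     (\<forall>z\<in>S. \<forall>i. ((\<lambda>z. y z $ i) has_field_derivative (A z *v y z) $ i - \<theta> z * y z $ i) (at z))"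

definition fundamental_on ::
    "(complex \<Rightarrow> complex^2^2) \<Rightarrow> complex set \<Rightarrow> (complex \<Rightarrow> complex^2^2) \<Rightarrow> bool" where
  "fundamental_on A S \<Phi> \<longleftrightarrow>
     (\<forall>z\<in>S. invertible (\<Phi> z) \<and>
        (\<forall>i j. ((\<lambda>z. \<Phi> z $ i $ j) has_field_derivative (A z ** \<Phi> z) $ i $ j) (at z)))"

lemma matrix_vector_mult_2:
  fixes A :: "complex^2^2"
  shows "(A *v x) $ i = A $ i $ 1 * x $ 1 + A $ i $ 2 * x $ 2"
  by (simp add: matrix_vector_mult_def sum_2)

lemma matrix_matrix_mult_2:
  fixes A :: "complex^2^2"
  shows "(A ** B) $ i $ j = A $ i $ 1 * B $ 1 $ j + A $ i $ 2 * B $ 2 $ j"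
  by (simp add: matrix_matrix_mult_def sum_2)

text \<open>The quotient f / g has derivative zero. With \<alpha> a trace, a diagonal entry or a
  constant, this scalar argument serves in place of a uniqueness theorem for linear systems.\<close>

lemma scalar_multiple_of_solution:
  fixes S :: "complex set"
  assumes "open S" "connected S"
    and f: "\<And>z. z \<in> S \<Longrightarrow> (f has_field_derivative \<alpha> z * f z) (at z)"
    and g: "\<And>z. z \<in> S \<Longrightarrow> (g has_field_derivative \<alpha> z * g z) (at z)"
    and nz: "\<And>z. z \<in> S \<Longrightarrow> g z \<noteq> 0"
  shows "\<exists>c. \<forall>z\<in>S. f z = c * g z"
proof -
  have "((\<lambda>z. f z / g z) has_field_derivative 0) (at z)" if "z \<in> S" for z
    by (rule DERIV_cong[OF DERIV_divide[OF f[OF that] g[OF that] nz[OF that]]]) simp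
  note D = this
  have "continuous_on S (\<lambda>z. f z / g z)"
    using D DERIV_isCont continuous_at_imp_continuous_on by blast
  then have "\<exists>c. \<forall>z\<in>S. f z / g z = c"
    using DERIV_zero_connected_constant[OF assms(2,1) finite.emptyI, of "\<lambda>z. f z / g z"] D
    by (metis Diff_iff)
  then obtain c where "\<forall>z\<in>S. f z / g z = c" by blast
  then have "\<forall>z\<in>S. f z = c * g z" using nz by (auto simp: field_simps)
  then show ?thesis by blast
qed

lemma fundamental_on_solves:
  assumes "fundamental_on A S \<Phi>"
  shows "solves_on A (\<lambda>_. 0) S (\<lambda>z. \<Phi> z *v c)"
  unfolding solves_on_def
proof (intro ballI allI)
  fix z and i :: 2 assume "z \<in> S"
  then have D: "((\<lambda>z. \<Phi> z $ i $ j) has_field_derivative (A z ** \<Phi> z) $ i $ j) (at z)" for j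
    using assms by (auto simp: fundamental_on_def)
  show "((\<lambda>z. (\<Phi> z *v c) $ i) has_field_derivative (A z *v (\<Phi> z *v c)) $ i - 0 * (\<Phi> z *v c) $ i) (at z)"
    unfolding matrix_vector_mult_2
    by (rule DERIV_cong[OF DERIV_add[OF DERIV_cmult_right[OF D[of 1]] DERIV_cmult_right[OF D[of 2]]]])
       (simp add: matrix_matrix_mult_2 matrix_vector_mult_2 algebra_simps)
qed

lemma solves_on_twist:
  assumes y: "solves_on A \<theta> S y"
    and h: "\<And>z. z \<in> S \<Longrightarrow> (h has_field_derivative \<eta> z * h z) (at z)"
  shows "solves_on A (\<lambda>z. \<theta> z - \<eta> z) S (\<lambda>z. h z *s y z)"
  unfolding solves_on_def
proof (intro ballI allI)
  fix z and i :: 2 assume z: "z \<in> S"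
  then have D: "((\<lambda>z. y z $ i) has_field_derivative (A z *v y z) $ i - \<theta> z * y z $ i) (at z)"
    using y by (auto simp: solves_on_def)
  show "((\<lambda>z. (h z *s y z) $ i) has_field_derivative
      (A z *v (h z *s y z)) $ i - (\<theta> z - \<eta> z) * (h z *s y z) $ i) (at z)"
    unfolding vector_smult_component
    by (rule DERIV_cong[OF DERIV_mult[OF h[OF z] D]])
       (simp add: matrix_vector_mult_2 algebra_simps)
qed

lemma solves_on_subset: "solves_on A \<theta> S y \<Longrightarrow> T \<subseteq> S \<Longrightarrow> solves_on A \<theta> T y"
  by (auto simp: solves_on_def)

lemma solves_on_cong:
  assumes "solves_on A \<theta> S y" "open S" "\<And>z. z \<in> S \<Longrightarrow> y z = x z" "\<And>z. z \<in> S \<Longrightarrow> \<theta> z = \<eta> z"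
  shows "solves_on A \<eta> S x"
  unfolding solves_on_def
proof (intro ballI allI)
  fix z and i :: 2 assume z: "z \<in> S"
  have "((\<lambda>z. y z $ i) has_field_derivative (A z *v x z) $ i - \<eta> z * x z $ i) (at z)"
    using assms z by (auto simp: solves_on_def)
  then show "((\<lambda>z. x z $ i) has_field_derivative (A z *v x z) $ i - \<eta> z * x z $ i) (at z)"
    by (rule has_field_derivative_transform_within_open[OF _ assms(2) z]) (simp add: assms(3))
qed

text \<open>Cramer's rule: both minors are Wronskians and satisfy the scalar equation \<open>w' = tr A w\<close>.\<close>

lemma solves_on_fundamental:
  assumes \<Phi>: "fundamental_on A S \<Phi>" and y: "solves_on A (\<lambda>_. 0) S y"
    and S: "open S" "connected S"
  shows "\<exists>c. \<forall>z\<in>S. y z = \<Phi> z *v c"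
proof -
  define \<Delta> where "\<Delta> z = \<Phi> z $ 1 $ 1 * \<Phi> z $ 2 $ 2 - \<Phi> z $ 1 $ 2 * \<Phi> z $ 2 $ 1" for z
  define w1 where "w1 z = y z $ 1 * \<Phi> z $ 2 $ 2 - \<Phi> z $ 1 $ 2 * y z $ 2" for z
  define w2 where "w2 z = \<Phi> z $ 1 $ 1 * y z $ 2 - y z $ 1 * \<Phi> z $ 2 $ 1" for z
  have D\<Phi>: "((\<lambda>z. \<Phi> z $ i $ j) has_field_derivative (A z ** \<Phi> z) $ i $ j) (at z)"
    if "z \<in> S" for z i j
    using \<Phi> that by (auto simp: fundamental_on_def)
  have Dy: "((\<lambda>z. y z $ i) has_field_derivative (A z *v y z) $ i) (at z)" if "z \<in> S" for z i
    using y that by (auto simp: solves_on_def)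
  have nz: "\<Delta> z \<noteq> 0" if "z \<in> S" for z
    using \<Phi> that by (auto simp: fundamental_on_def invertible_det_nz det_2 \<Delta>_def)
  have D\<Delta>: "(\<Delta> has_field_derivative trace (A z) * \<Delta> z) (at z)" if "z \<in> S" for z
    unfolding \<Delta>_def
    by (rule DERIV_cong[OF DERIV_diff[OF DERIV_mult[OF D\<Phi> D\<Phi>] DERIV_mult[OF D\<Phi> D\<Phi>]]])
       (use that in \<open>simp_all add: matrix_matrix_mult_2 trace_def sum_2 algebra_simps\<close>)
  have Dw1: "(w1 has_field_derivative trace (A z) * w1 z) (at z)" if "z \<in> S" for z
    unfolding w1_def
    by (rule DERIV_cong[OF DERIV_diff[OF DERIV_mult[OF Dy D\<Phi>] DERIV_mult[OF D\<Phi> Dy]]])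
       (use that in \<open>simp_all add: matrix_matrix_mult_2 matrix_vector_mult_2 trace_def sum_2 algebra_simps\<close>)
  have Dw2: "(w2 has_field_derivative trace (A z) * w2 z) (at z)" if "z \<in> S" for z
    unfolding w2_def
    by (rule DERIV_cong[OF DERIV_diff[OF DERIV_mult[OF D\<Phi> Dy] DERIV_mult[OF Dy D\<Phi>]]])
       (use that in \<open>simp_all add: matrix_matrix_mult_2 matrix_vector_mult_2 trace_def sum_2 algebra_simps\<close>)
  obtain c1 where c1: "\<forall>z\<in>S. w1 z = c1 * \<Delta> z"
    using scalar_multiple_of_solution[OF S Dw1 D\<Delta> nz] by blast
  obtain c2 where c2: "\<forall>z\<in>S. w2 z = c2 * \<Delta> z"
    using scalar_multiple_of_solution[OF S Dw2 D\<Delta> nz] by blast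
  have "y z = \<Phi> z *v vector [c1, c2]" if z: "z \<in> S" for z
  proof -
    have "\<Delta> z * y z $ 1 = \<Phi> z $ 1 $ 1 * w1 z + \<Phi> z $ 1 $ 2 * w2 z"
      and "\<Delta> z * y z $ 2 = \<Phi> z $ 2 $ 1 * w1 z + \<Phi> z $ 2 $ 2 * w2 z"
      by (simp_all add: \<Delta>_def w1_def w2_def algebra_simps)
    then have "\<Delta> z * y z $ 1 = \<Delta> z * (\<Phi> z $ 1 $ 1 * c1 + \<Phi> z $ 1 $ 2 * c2)"
      and "\<Delta> z * y z $ 2 = \<Delta> z * (\<Phi> z $ 2 $ 1 * c1 + \<Phi> z $ 2 $ 2 * c2)"
      using c1 c2 z by (simp_all add: algebra_simps)
    then show ?thesis
      using nz[OF z] by (simp add: vec_eq_iff forall_2 matrix_vector_mult_2)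
  qed
  then show ?thesis by blast
qed

text \<open>In the logarithmic coordinate \<open>z = a + exp w\<close> a single-valued function is periodic with
  period \<open>2\<pi>\<i>\<close>, which excludes the multivalued solutions \<open>(z - a)\<^sup>\<lambda>\<close> and \<open>ln (z - a)\<close>.\<close>

lemma half_plane_image:
  assumes "Re w < ln \<delta>" "\<delta> > 0"
  shows "a + exp w \<in> ball a \<delta> - {a}"
proof -
  have "exp (Re w) < \<delta>" using assms by (metis exp_less_mono exp_ln)
  then show ?thesis by (simp add: dist_norm norm_exp_eq_Re)
qed

lemma half_plane_surj:
  assumes "z \<in> ball a \<delta> - {a}" "\<delta> > 0"
  shows "\<exists>w. Re w < ln \<delta> \<and> z = a + exp w"
proof (intro exI conjI)
  have pos: "0 < cmod (z - a)" and "cmod (z - a) < \<delta>"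
    using assms(1) by (auto simp: dist_norm norm_minus_commute)
  then have "ln (cmod (z - a)) < ln \<delta>"
    using iffD2[OF ln_less_cancel_iff[OF pos assms(2)]] by blast
  moreover have "Re (Ln (z - a)) = ln (cmod (z - a))"
    using pos by (intro Re_Ln) auto
  ultimately show "Re (Ln (z - a)) < ln \<delta>" by (simp only:)
  have "exp (Ln (z - a)) = z - a" using assms(1) by (intro exp_Ln) auto
  then show "z = a + exp (Ln (z - a))" by (simp only: add_diff_eq diff_add_cancel add_diff_cancel_left')
qed

lemma half_plane_connected: "open {w. Re w < c}" "connected {w. Re w < c}"
  by (simp_all add: open_halfspace_Re_lt convex_halfspace_Re_lt convex_connected)

text \<open>In the logarithmic coordinate the solution is c * exp (l * w), and the period forces c =
  0 or l \<in> \<int>. The equation l * c = 0 covers both remaining cases: only the zero solution,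
  or l = 0 and an arbitrary constant.\<close>

lemma single_valued_power_solution:
  fixes a :: complex
  assumes "\<delta> > 0" "l \<notin> \<int> \<or> l = 0"
    and s: "\<And>z. z \<in> ball a \<delta> - {a} \<Longrightarrow> (s has_field_derivative l * s z / (z - a)) (at z)"
  shows "\<exists>c. (\<forall>z\<in>ball a \<delta> - {a}. s z = c) \<and> l * c = 0"
proof -
  have "((\<lambda>w. s (a + exp w)) has_field_derivative l * s (a + exp w)) (at w)"
    if "w \<in> {w. Re w < ln \<delta>}" for w
  proof -
    have e: "((\<lambda>w. a + exp w) has_field_derivative exp w) (at w)"
      by (auto intro!: derivative_eq_intros)
    show ?thesis
      by (rule DERIV_cong[OF DERIV_chain2[OF s e]])
         (use that assms(1) half_plane_image[of w \<delta> a] in \<open>auto simp: divide_simps\<close>)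
  qed
  moreover have "((\<lambda>w. exp (l * w)) has_field_derivative l * exp (l * w)) (at w)" for w
    by (auto intro!: derivative_eq_intros)
  ultimately obtain c where c: "\<And>w. Re w < ln \<delta> \<Longrightarrow> s (a + exp w) = c * exp (l * w)"
    using scalar_multiple_of_solution[OF half_plane_connected(1,2)[of "ln \<delta>"],
        where f = "\<lambda>w. s (a + exp w)" and g = "\<lambda>w. exp (l * w)" and \<alpha> = "\<lambda>_. l"]
    by fastforce
  \<comment> \<open>Any point of the half-plane would do; adding the period keeps the real part, so
    the translate lies there too.\<close>
  define w0 where "w0 = complex_of_real (ln \<delta> - 1)"
  have "c * exp (l * w0) = c * exp (l * (w0 + 2 * pi * \<i>))"
    using c[of w0] c[of "w0 + 2 * pi * \<i>"] by (simp add: w0_def exp_add exp_Euler)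
  then have c0: "c = 0 \<or> exp (l * (2 * pi * \<i>)) = 1"
    by (simp add: distrib_left exp_add)
  have "c = 0 \<or> l = 0"
  proof (rule ccontr)
    assume *: "\<not> (c = 0 \<or> l = 0)"
    then have "exp (l * (2 * pi * \<i>)) = 1" using c0 by blast
    then obtain n :: int where "Im (l * (2 * pi * \<i>)) = of_int (2 * n) * pi" "Re (l * (2 * pi * \<i>)) = 0"
      unfolding exp_eq_1 by blast
    then have "l = of_int n" by (simp add: complex_eq_iff)
    then show False using assms(2) * by auto
  qed
  then have "s z = c" if "z \<in> ball a \<delta> - {a}" for z
    using half_plane_surj[OF that assms(1)] c by auto
  then show ?thesis using \<open>c = 0 \<or> l = 0\<close> by auto
qed

text \<open>The function s (a + exp w) - \<beta> * w is constant, while the period changes it by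
  -2\<pi>\<i>\<beta>.\<close>

lemma single_valued_log_solution:
  fixes a :: complex
  assumes "\<delta> > 0"
    and s: "\<And>z. z \<in> ball a \<delta> - {a} \<Longrightarrow> (s has_field_derivative \<beta> / (z - a)) (at z)"
  shows "\<beta> = 0"
proof -
  have "((\<lambda>w. s (a + exp w) - \<beta> * w) has_field_derivative 0) (at w)"
    if "w \<in> {w. Re w < ln \<delta>}" for w
  proof -
    have e: "((\<lambda>w. a + exp w) has_field_derivative exp w) (at w)"
      by (auto intro!: derivative_eq_intros)
    have "((\<lambda>w. s (a + exp w)) has_field_derivative \<beta>) (at w)"
      by (rule DERIV_cong[OF DERIV_chain2[OF s e]])
         (use that assms(1) half_plane_image[of w \<delta> a] in \<open>auto simp: divide_simps\<close>)
    then show ?thesis by (auto intro!: derivative_eq_intros)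
  qed
  then obtain c where c: "\<And>w. Re w < ln \<delta> \<Longrightarrow> s (a + exp w) - \<beta> * w = c"
    using scalar_multiple_of_solution[OF half_plane_connected[of "ln \<delta>"],
        where f = "\<lambda>w. s (a + exp w) - \<beta> * w" and g = "\<lambda>_. 1" and \<alpha> = "\<lambda>_. 0"]
    by fastforce
  define w0 where "w0 = complex_of_real (ln \<delta> - 1)"
  have "exp (w0 + 2 * pi * \<i>) = exp w0" by (simp add: exp_add)
  moreover have "Re w0 < ln \<delta>" "Re (w0 + 2 * pi * \<i>) < ln \<delta>" by (simp_all add: w0_def)
  ultimately have "\<beta> * w0 = \<beta> * (w0 + 2 * pi * \<i>)"
    using c[of w0] c[of "w0 + 2 * pi * \<i>"] by (metis diff_left_imp_eq)
  then show ?thesis by (simp add: distrib_left)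
qed

subsection \<open>Charts of the sphere\<close>

lemma sphere_prod_iff: "q \<in> sphere (0::complex \<times> real) 1 \<longleftrightarrow> (cmod (fst q))\<^sup>2 + (snd q)\<^sup>2 = 1"
  by (simp add: norm_prod_def real_sqrt_eq_1_iff)

lemma to_sphere_in_sphere: "to_sphere z \<in> sphere 0 1"
proof -
  have "(cmod z)\<^sup>2 + 1 \<noteq> 0" by (smt (verit) zero_le_power2)
  then show ?thesis
    unfolding sphere_prod_iff to_sphere_def
    by (simp add: power_mult_distrib power_divide divide_simps) (simp add: power2_eq_square algebra_simps)
qed

lemma to_sphere_neq_infinity: "to_sphere z \<noteq> sphere_infinity"
  by (simp add: to_sphere_def sphere_infinity_def divide_simps)

lemma one_minus_snd_to_sphere: "1 - snd (to_sphere z) = 2 / ((cmod z)\<^sup>2 + 1)"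
proof -
  have "(cmod z)\<^sup>2 + 1 \<noteq> 0" by (smt (verit) zero_le_power2)
  then show ?thesis by (simp add: to_sphere_def divide_simps)
qed

lemma affine_coord_to_sphere [simp]: "affine_coord (to_sphere z) = z"
proof -
  have "(cmod z)\<^sup>2 + 1 \<noteq> 0" by (smt (verit) zero_le_power2)
  then show ?thesis unfolding affine_coord_def one_minus_snd_to_sphere
    by (simp add: to_sphere_def scaleR_conv_of_real del: of_real_add of_real_power)
qed

lemma inj_to_sphere: "inj to_sphere"
  by (metis affine_coord_to_sphere injI)

lemma snd_eq_1_imp_infinity: "q \<in> sphere 0 1 \<Longrightarrow> snd q = 1 \<Longrightarrow> q = sphere_infinity"
  unfolding sphere_prod_iff by (auto simp: sphere_infinity_def prod_eq_iff)

lemma to_sphere_affine_coord: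
  assumes "q \<in> sphere 0 1" "q \<noteq> sphere_infinity"
  shows "to_sphere (affine_coord q) = q"
proof -
  obtain \<zeta> h where q: "q = (\<zeta>, h)" by (cases q)
  have h: "1 - h \<noteq> 0" using assms snd_eq_1_imp_infinity q by auto
  have n: "(cmod \<zeta>)\<^sup>2 = (1 - h) * (1 + h)"
    using assms(1)[unfolded sphere_prod_iff] q by (simp add: power2_eq_square algebra_simps)
  have "(cmod (affine_coord q))\<^sup>2 = (1 + h) / (1 - h)"
    using h n by (simp add: q affine_coord_def power_mult_distrib power_divide divide_simps)
       (simp add: power2_eq_square)
  then have *: "(cmod (affine_coord q))\<^sup>2 + 1 = 2 / (1 - h)" "(cmod (affine_coord q))\<^sup>2 - 1 = 2 * h / (1 - h)"
    using h by (simp_all add: divide_simps algebra_simps)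
  show ?thesis
    unfolding to_sphere_def * using h by (simp add: q affine_coord_def)
qed

lemma continuous_on_to_sphere: "continuous_on S to_sphere"
proof -
  have "(cmod z)\<^sup>2 + 1 \<noteq> 0" for z by (smt (verit) zero_le_power2)
  then show ?thesis unfolding to_sphere_def by (intro continuous_intros) auto
qed

text \<open>The coordinate \<open>u = 1 / (z - a)\<close> on the sphere without the point \<open>a\<close>, and its inverse;
  both are written so that they remain defined at \<open>\<infinity>\<close>, that is, at \<open>u = 0\<close>.\<close>

definition sphere_chart :: "complex \<Rightarrow> complex \<Rightarrow> complex \<times> real" where
  "sphere_chart a u =
     ((2 / ((cmod (a * u + 1))\<^sup>2 + (cmod u)\<^sup>2)) *\<^sub>R ((a * u + 1) * cnj u),
      ((cmod (a * u + 1))\<^sup>2 - (cmod u)\<^sup>2) / ((cmod (a * u + 1))\<^sup>2 + (cmod u)\<^sup>2))"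

definition sphere_coord :: "complex \<Rightarrow> complex \<times> real \<Rightarrow> complex" where
  "sphere_coord a q = cnj (fst q - a * of_real (1 - snd q)) /
     of_real ((1 + snd q) - 2 * Re (cnj (fst q) * a) + (cmod a)\<^sup>2 * (1 - snd q))"

lemma sphere_chart_denominator: "(cmod (a * u + 1))\<^sup>2 + (cmod u)\<^sup>2 \<noteq> 0"
  by (cases "u = 0") (auto simp: sum_power2_eq_zero_iff)

lemma sphere_chart_0 [simp]: "sphere_chart a 0 = sphere_infinity"
  by (simp add: sphere_chart_def sphere_infinity_def)

lemma sphere_chart_eq: "u \<noteq> 0 \<Longrightarrow> sphere_chart a u = to_sphere (a + 1 / u)"
proof -
  assume u: "u \<noteq> 0"
  have "a + 1 / u = (a * u + 1) / u" using u by (simp add: field_simps)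
  moreover have "(a * u + 1) / u = (a * u + 1) * cnj u / of_real ((cmod u)\<^sup>2)"
    by (metis complex_div_cnj of_real_power)
  ultimately have *: "a + 1 / u = (1 / (cmod u)\<^sup>2) *\<^sub>R ((a * u + 1) * cnj u)"
    by (simp add: scaleR_conv_of_real)
  have n: "(cmod (a + 1 / u))\<^sup>2 = (cmod (a * u + 1))\<^sup>2 / (cmod u)\<^sup>2"
    using \<open>a + 1 / u = (a * u + 1) / u\<close> by (simp add: norm_divide power_divide)
  have nz: "(cmod u)\<^sup>2 \<noteq> 0" using u by simp
  have 1: "(cmod (a + 1 / u))\<^sup>2 + 1 = ((cmod (a * u + 1))\<^sup>2 + (cmod u)\<^sup>2) / (cmod u)\<^sup>2"
    and 2: "(cmod (a + 1 / u))\<^sup>2 - 1 = ((cmod (a * u + 1))\<^sup>2 - (cmod u)\<^sup>2) / (cmod u)\<^sup>2"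
    unfolding n using nz by (simp_all add: field_simps)
  show ?thesis
    unfolding to_sphere_def 1 2
    by (subst *) (use nz sphere_chart_denominator[of a u] in \<open>simp add: sphere_chart_def\<close>)
qed

lemma sphere_chart_in_sphere: "sphere_chart a u \<in> sphere 0 1"
proof (cases "u = 0")
  case True then show ?thesis by (simp add: sphere_infinity_def norm_prod_def)
next
  case False then show ?thesis using sphere_chart_eq to_sphere_in_sphere by metis
qed

lemma continuous_on_sphere_chart: "continuous_on S (sphere_chart a)"
  unfolding sphere_chart_def using sphere_chart_denominator[of a] by (intro continuous_intros) auto

lemma sphere_coord_infinity [simp]: "sphere_coord a sphere_infinity = 0"
  by (simp add: sphere_coord_def sphere_infinity_def)

text \<open>At \<open>to_sphere z\<close> with height h the denominator of
  \<open>sphere_coord\<close> is (1 - h) |z - a|^2; multiplied by 1 - h this becomes a polynomial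
  identity on the sphere. It yields both the value of the coordinate and the fact that the
  denominator vanishes only at \<open>to_sphere a\<close>.\<close>

lemma sphere_coord_denominator:
  assumes "q \<in> sphere 0 1"
  shows "(cmod (fst q - a * of_real (1 - snd q)))\<^sup>2 =
    (1 - snd q) * ((1 + snd q) - 2 * Re (cnj (fst q) * a) + (cmod a)\<^sup>2 * (1 - snd q))"
proof -
  obtain x y h where q: "q = (Complex x y, h)" by (metis complex_surj prod.exhaust)
  have 1: "x\<^sup>2 + y\<^sup>2 + h\<^sup>2 = 1" using assms[unfolded sphere_prod_iff] q by (simp add: cmod_power2)
  show ?thesis
    unfolding q cmod_power2 using 1 by (simp add: power2_eq_square) algebra
qed

lemma sphere_coord_to_sphere:
  assumes "z \<noteq> a"
  shows "sphere_coord a (to_sphere z) = 1 / (z - a)"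
proof -
  define \<zeta> h where "\<zeta> = fst (to_sphere z)" and "h = snd (to_sphere z)"
  define d where "d = (1 + h) - 2 * Re (cnj \<zeta> * a) + (cmod a)\<^sup>2 * (1 - h)"
  have h: "1 - h \<noteq> 0"
    using to_sphere_in_sphere to_sphere_neq_infinity snd_eq_1_imp_infinity h_def by fastforce
  have "affine_coord (to_sphere z) = z" by simp
  then have z: "\<zeta> = of_real (1 - h) * z"
    using h by (simp add: affine_coord_def \<zeta>_def[symmetric] h_def[symmetric] scaleR_conv_of_real field_simps)
  have w: "\<zeta> - a * of_real (1 - h) = of_real (1 - h) * (z - a)" using z by (simp add: algebra_simps)
  have "(1 - h) * d = (cmod (\<zeta> - a * of_real (1 - h)))\<^sup>2"
    using sphere_coord_denominator[OF to_sphere_in_sphere, of z a] by (simp add: d_def \<zeta>_def h_def)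
  also have "\<dots> = (1 - h) * ((1 - h) * (cmod (z - a))\<^sup>2)"
    unfolding w norm_mult norm_of_real power_mult_distrib by (simp add: power2_eq_square)
  finally have d: "d = (1 - h) * (cmod (z - a))\<^sup>2" using h by simp
  have "sphere_coord a (to_sphere z) = cnj (of_real (1 - h) * (z - a)) / of_real d"
    unfolding sphere_coord_def \<zeta>_def[symmetric] h_def[symmetric] d_def[symmetric] w ..
  also have "\<dots> = cnj (z - a) / of_real ((cmod (z - a))\<^sup>2)" unfolding d using h by simp
  also have "\<dots> = 1 / (z - a)"
    using complex_div_cnj[of 1 "z - a"] by simp
  finally show ?thesis .
qed

lemma sphere_chart_coord:
  assumes "q \<in> sphere 0 1" "q \<noteq> to_sphere a"
  shows "sphere_chart a (sphere_coord a q) = q"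
proof (cases "q = sphere_infinity")
  case False
  then have q: "q = to_sphere (affine_coord q)" using assms to_sphere_affine_coord by simp
  then have "affine_coord q \<noteq> a" using assms by auto
  then show ?thesis
    using sphere_coord_to_sphere[of "affine_coord q" a] sphere_chart_eq q by (simp add: sphere_chart_eq)
qed simp

lemma continuous_on_sphere_coord: "continuous_on (sphere 0 1 - {to_sphere a}) (sphere_coord a)"
proof -
  have "(1 + snd q) - 2 * Re (cnj (fst q) * a) + (cmod a)\<^sup>2 * (1 - snd q) \<noteq> 0"
    if "q \<in> sphere 0 1" "q \<noteq> to_sphere a" for q
  proof
    assume 0: "(1 + snd q) - 2 * Re (cnj (fst q) * a) + (cmod a)\<^sup>2 * (1 - snd q) = 0"
    then have e: "fst q - a * of_real (1 - snd q) = 0"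
      using sphere_coord_denominator[OF that(1), of a] by simp
    show False
    proof (cases "snd q = 1")
      case True then show False using 0 snd_eq_1_imp_infinity[OF that(1)] by (auto simp: sphere_infinity_def)
    next
      case False
      then have "affine_coord q = a" using e by (simp add: affine_coord_def scaleR_conv_of_real)
      moreover have "q \<noteq> sphere_infinity" using False by (auto simp: sphere_infinity_def)
      ultimately show False using that to_sphere_affine_coord by metis
    qed
  qed
  then have "\<forall>q\<in>sphere 0 1 - {to_sphere a}.
      complex_of_real ((1 + snd q) - 2 * Re (cnj (fst q) * a) + (cmod a)\<^sup>2 * (1 - snd q)) \<noteq> 0"
    by (metis DiffE insertI1 of_real_eq_0_iff)
  then show ?thesis
    unfolding sphere_coord_def by (intro continuous_intros)
qed

text \<open>The coordinate 1 / (z - g \<beta>) sends one end of the arc to \<infinity>. The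
  complement of U is then the image of the half-open arc: connected, and unbounded unless empty (the
  case \<alpha> = \<beta>). Hence U is simply connected once it is connected, and that holds because
  an arc does not separate the plane.\<close>

lemma simply_connected_inverted_arc_complement:
  fixes g :: "real \<Rightarrow> complex"
  assumes ab: "\<alpha> \<le> \<beta>" and g: "continuous_on {\<alpha>..\<beta>} g" "inj_on g {\<alpha>..\<beta>}"
  defines "U \<equiv> {u. sphere_chart (g \<beta>) u \<notin> to_sphere ` g ` {\<alpha>..\<beta>}}"
  shows "open U" "simply_connected U"
proof -
  let ?a = "g \<beta>" and ?K = "g ` {\<alpha>..\<beta>}"
  have K: "compact ?K" by (rule compact_continuous_image[OF g(1) compact_Icc])
  then have "closed (to_sphere ` ?K)"
    using compact_continuous_image[OF continuous_on_to_sphere] compact_imp_closed by blast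
  then have "open (sphere_chart ?a -` (- to_sphere ` ?K))"
    by (intro open_vimage continuous_on_sphere_chart) auto
  moreover have "U = sphere_chart ?a -` (- to_sphere ` ?K)" unfolding U_def by blast
  ultimately show oU: "open U" by simp
  have U: "u \<in> U \<longleftrightarrow> u = 0 \<or> ?a + 1 / u \<notin> ?K" for u
    proof (cases "u = 0")
    case True
    have "sphere_infinity \<notin> to_sphere ` ?K" by (metis imageE to_sphere_neq_infinity)
    then show ?thesis unfolding U_def by (simp add: True)
  qed (simp add: U_def sphere_chart_eq inj_image_mem_iff[OF inj_to_sphere])
  have "connected (- ?K)"
  proof (rule connected_complement_homeomorphic_convex_compact)
    show "?K homeomorphic {\<alpha>..\<beta>}"
      using homeomorphic_compact[OF compact_Icc g(1) refl g(2)] homeomorphic_sym by blast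
  qed auto
  moreover have "continuous_on (- ?K) (\<lambda>z. 1 / (z - ?a))"
    using ab by (intro continuous_intros) auto
  moreover have "(\<lambda>z. 1 / (z - ?a)) ` (- ?K) = U - {0}"
  proof (intro equalityI subsetI)
    fix u assume "u \<in> (\<lambda>z. 1 / (z - ?a)) ` (- ?K)"
    then obtain z where z: "z \<notin> ?K" "u = 1 / (z - ?a)" by auto
    then have "z \<noteq> ?a" using ab by auto
    then show "u \<in> U - {0}" using z by (auto simp: U)
  next
    fix u assume "u \<in> U - {0}"
    then have "?a + 1 / u \<in> - ?K" "u = 1 / ((?a + 1 / u) - ?a)" by (auto simp: U)
    then show "u \<in> (\<lambda>z. 1 / (z - ?a)) ` (- ?K)" by blast
  qed
  ultimately have c0: "connected (U - {0})" using connected_continuous_image by metis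
  \<comment> \<open>The point u = 0 stands for \<infinity>; being a limit point it can be added
    without losing connectedness.\<close>
  have "0 \<in> U" by (simp add: U)
  then have "0 \<in> closure (U - {0})"
    using oU by (metis interior_limit_point interior_open islimpt_in_closure)
  then have "U \<subseteq> closure (U - {0})" using closure_subset[of "U - {0}"] by blast
  then have cU: "connected U"
    using connected_intermediate_closure[OF c0, of U] by blast
  have V: "- U = (\<lambda>z. 1 / (z - ?a)) ` (?K - {?a})"
  proof (intro equalityI subsetI)
    fix u assume "u \<in> - U"
    then have "?a + 1 / u \<in> ?K - {?a}" "u = 1 / ((?a + 1 / u) - ?a)" by (auto simp: U)
    then show "u \<in> (\<lambda>z. 1 / (z - ?a)) ` (?K - {?a})" by blast
  next
    fix u assume "u \<in> (\<lambda>z. 1 / (z - ?a)) ` (?K - {?a})"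
    then obtain z where "z \<in> ?K" "z \<noteq> ?a" "u = 1 / (z - ?a)" by blast
    then show "u \<in> - U" by (auto simp: U)
  qed
  have K': "?K - {?a} = g ` {\<alpha>..<\<beta>}"
  proof -
    have "{\<alpha>..<\<beta>} = {\<alpha>..\<beta>} - {\<beta>}" by auto
    then show ?thesis using inj_on_image_set_diff[OF g(2), of "{\<alpha>..\<beta>}" "{\<beta>}"] ab by auto
  qed
  have "continuous_on {\<alpha>..<\<beta>} g" using g(1) by (rule continuous_on_subset) auto
  then have "connected (g ` {\<alpha>..<\<beta>})" by (rule connected_continuous_image) simp
  moreover have "continuous_on (g ` {\<alpha>..<\<beta>}) (\<lambda>z. 1 / (z - ?a))"
    using K' by (intro continuous_intros) auto
  ultimately have cV: "connected (- U)" unfolding V K' by (rule connected_continuous_image[rotated])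
  have uV: "\<not> bounded (- U)" if ne: "- U \<noteq> {}"
  proof
    have lt: "\<alpha> < \<beta>" using ne unfolding V K' by auto
    assume "bounded (- U)"
    then obtain B where B: "B > 0" "\<And>u. u \<in> - U \<Longrightarrow> cmod u \<le> B" by (metis bounded_pos)
    have "(g \<longlongrightarrow> g \<beta>) (at \<beta> within {\<alpha>..\<beta>})"
      using g(1) ab by (simp add: continuous_on_def)
    then obtain d where d: "d > 0"
      "\<And>s. s \<in> {\<alpha>..\<beta>} \<Longrightarrow> s \<noteq> \<beta> \<Longrightarrow> dist s \<beta> < d \<Longrightarrow> dist (g s) (g \<beta>) < 1 / B"
      unfolding tendsto_iff eventually_at using B(1) by (metis zero_less_divide_1_iff)
    \<comment> \<open>A parameter of the half-open arc so close to \<beta> that 1 / (g s - g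
      \<beta>) exceeds the bound B.\<close>
    define s where "s = max \<alpha> (\<beta> - d / 2)"
    have s: "s \<in> {\<alpha>..<\<beta>}" "dist s \<beta> < d" using lt d(1) by (auto simp: s_def dist_real_def)
    then have *: "dist (g s) (g \<beta>) < 1 / B" "g s \<in> ?K - {?a}" using d(2)[of s] K' by auto
    then have "cmod (1 / (g s - ?a)) \<le> B" using B(2) V by blast
    moreover have "cmod (g s - ?a) > 0" using * by auto
    ultimately have "1 \<le> B * cmod (g s - ?a)" by (simp add: norm_divide divide_simps)
    then show False using *(1) B(1) by (simp add: dist_norm field_simps)
  qed
  show "simply_connected U"
    unfolding simply_connected_eq_unbounded_complement_components[OF oU]
    using cU cV uV by (metis connected_eq_connected_components_eq components_empty components_eq_sing_iff empty_iff singletonD)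
qed

text \<open>The lifting theorem is applied over the plane domain U, which is locally path connected
  because it is open, and the lift is carried back by \<open>sphere_coord\<close>. Prescribing the
  value over \<rho> x0 makes the sections for different cuts comparable.\<close>

lemma section_over_arc_complement:
  fixes X :: "'a::real_normed_vector set" and g :: "real \<Rightarrow> complex"
  assumes cov: "covering_space X \<rho> S" and S: "S \<subseteq> sphere 0 1"
    and ab: "\<alpha> \<le> \<beta>" and g: "continuous_on {\<alpha>..\<beta>} g" "inj_on g {\<alpha>..\<beta>}"
    and sub: "sphere 0 1 - to_sphere ` g ` {\<alpha>..\<beta>} \<subseteq> S"
    and x0: "x0 \<in> X" "\<rho> x0 \<notin> to_sphere ` g ` {\<alpha>..\<beta>}"
  obtains s where "continuous_on (sphere 0 1 - to_sphere ` g ` {\<alpha>..\<beta>}) s"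
    "\<And>q. q \<in> sphere 0 1 - to_sphere ` g ` {\<alpha>..\<beta>} \<Longrightarrow> s q \<in> X \<and> \<rho> (s q) = q"
    "s (\<rho> x0) = x0"
proof -
  let ?W = "sphere 0 1 - to_sphere ` g ` {\<alpha>..\<beta>}" and ?a = "g \<beta>"
  define U where "U = {u. sphere_chart ?a u \<notin> to_sphere ` g ` {\<alpha>..\<beta>}}"
  have U: "open U" "simply_connected U"
    unfolding U_def using simply_connected_inverted_arc_complement[OF ab g] by auto
  have ne: "q \<noteq> to_sphere ?a" if "q \<in> ?W" for q using that ab by auto
  have chart: "sphere_chart ?a (sphere_coord ?a q) = q" if "q \<in> ?W" for q
    by (rule sphere_chart_coord) (use that ne[OF that] in auto)
  have coordU: "sphere_coord ?a q \<in> U" if "q \<in> ?W" for q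
    unfolding U_def mem_Collect_eq chart[OF that] using that by blast
  have "\<rho> x0 \<in> S" using cov x0(1) covering_space_imp_surjective by blast
  then have b: "\<rho> x0 \<in> ?W" using x0(2) S by blast
  have "sphere_chart ?a \<in> U \<rightarrow> S"
    using sub sphere_chart_in_sphere unfolding U_def by blast
  then obtain h where h: "continuous_on U h" "h \<in> U \<rightarrow> X" "h (sphere_coord ?a (\<rho> x0)) = x0"
      "\<And>u. u \<in> U \<Longrightarrow> \<rho> (h u) = sphere_chart ?a u"
    using covering_space_lift_strong[OF cov x0(1) coordU[OF b] U(2) open_imp_locally_path_connected[OF U(1)]
        continuous_on_sphere_chart _ chart[OF b]] by metis
  show thesis
  proof
    have "continuous_on ?W (sphere_coord ?a)"
      using continuous_on_sphere_coord by (rule continuous_on_subset) (use ne in blast)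
    then show "continuous_on ?W (h \<circ> sphere_coord ?a)"
      by (intro continuous_on_compose continuous_on_subset[OF h(1)]) (use coordU in blast)+
    show "(h \<circ> sphere_coord ?a) q \<in> X \<and> \<rho> ((h \<circ> sphere_coord ?a) q) = q" if "q \<in> ?W" for q
      using h(2,4) coordU[OF that] chart[OF that] by auto
    show "(h \<circ> sphere_coord ?a) (\<rho> x0) = x0" using h(3) by simp
  qed
qed

text \<open>The local section that \<open>solution_on\<close> supplies at s z need not be s itself,
  but both lift \<open>to_sphere\<close> and agree at z, so they coincide on a ball about z.\<close>

lemma fundamental_on_section:
  fixes X :: "'a::real_normed_vector set"
  assumes cov: "covering_space X \<rho> S" and S: "S \<subseteq> sphere 0 1"
    and W: "open W" and s: "continuous_on W s"
    and lift: "\<And>z. z \<in> W \<Longrightarrow> s z \<in> X \<and> \<rho> (s z) = to_sphere z"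
    and Y: "solution_on A (finite_part X \<rho>) (affine_coord \<circ> \<rho>) Y"
  shows "fundamental_on A W (\<lambda>z. Y (s z))"
  unfolding fundamental_on_def
proof (rule ballI)
  fix z assume z: "z \<in> W"
  have \<rho>S: "\<rho> x \<in> S" if "x \<in> X" for x using cov that covering_space_imp_surjective by blast
  have fin: "s z \<in> finite_part X \<rho>"
    using lift[OF z] to_sphere_neq_infinity by (auto simp: finite_part_def)
  have az: "(affine_coord \<circ> \<rho>) (s z) = z" using lift[OF z] by simp
  obtain V s' where V: "open V" "z \<in> V" "continuous_on V s'" "s' ` V \<subseteq> finite_part X \<rho>"
      "\<And>v. v \<in> V \<Longrightarrow> affine_coord (\<rho> (s' v)) = v" "s' z = s z"
    and D: "\<And>i j. ((\<lambda>z. Y (s' z) $ i $ j) has_field_derivative (A z ** Y (s z)) $ i $ j) (at z)"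
    and inv: "invertible (Y (s z))"
    using Y[unfolded solution_on_def, rule_format, OF fin] unfolding az by auto
  obtain e where e: "e > 0" "ball z e \<subseteq> V \<inter> W"
    using V(1,2) W z by (metis IntI open_Int openE)
  have \<rho>s': "\<rho> (s' v) = to_sphere v" if "v \<in> V" for v
  proof -
    have "s' v \<in> X" "\<rho> (s' v) \<noteq> sphere_infinity" using V(4) that by (auto simp: finite_part_def)
    then have "to_sphere (affine_coord (\<rho> (s' v))) = \<rho> (s' v)"
      using to_sphere_affine_coord \<rho>S S by blast
    then show ?thesis using V(5)[OF that] by simp
  qed
  have eq: "s' v = s v" if v: "v \<in> ball z e" for v
  proof (rule covering_space_lift_unique[OF cov, where f = to_sphere and T = "ball z e" and a = z])
    show "to_sphere \<in> ball z e \<rightarrow> S"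
    proof
      fix w assume "w \<in> ball z e"
      then show "to_sphere w \<in> S" using lift[of w] \<rho>S e(2) by (metis Int_iff subsetD)
    qed
    show "continuous_on (ball z e) s'" "continuous_on (ball z e) s"
      using V(3) s e(2) by (auto intro: continuous_on_subset)
    show "s' \<in> ball z e \<rightarrow> X" using V(4) e(2) by (auto simp: finite_part_def)
    show "s \<in> ball z e \<rightarrow> X" using lift e(2) by blast
    show "\<And>x. x \<in> ball z e \<Longrightarrow> to_sphere x = \<rho> (s' x)" using \<rho>s' e(2) by (metis Int_iff subsetD)
    show "\<And>x. x \<in> ball z e \<Longrightarrow> to_sphere x = \<rho> (s x)" using lift e(2) by (metis Int_iff subsetD)
  qed (use e(1) v V(6) continuous_on_to_sphere in auto)
  have "((\<lambda>z. Y (s z) $ i $ j) has_field_derivative (A z ** Y (s z)) $ i $ j) (at z)" for i j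
    by (rule has_field_derivative_transform_within_open[OF D open_ball[of z e]]) (use e(1) eq in auto)
  then show "invertible (Y (s z)) \<and>
      (\<forall>i j. ((\<lambda>z. Y (s z) $ i $ j) has_field_derivative (A z ** Y (s z)) $ i $ j) (at z))"
    using inv by blast
qed

subsection \<open>The marked curve and branches of powers\<close>

text \<open>Near z the difference L w - L z has imaginary part of absolute value below \<pi>, so L w
  = L z + Ln (g w / g z). In this way a logarithm known only to be continuous, such as a sum of
  winding numbers, becomes differentiable.\<close>

lemma has_field_derivative_exp_lift:
  fixes L g :: "complex \<Rightarrow> complex"
  assumes W: "open W" "z \<in> W" and L: "continuous_on W L"
    and g: "\<And>w. w \<in> W \<Longrightarrow> exp (L w) = g w" and D: "(g has_field_derivative g') (at z)"
  shows "(L has_field_derivative g' / g z) (at z)"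
proof -
  have nz: "g z \<noteq> 0" using g[OF W(2)] by (metis exp_not_eq_zero)
  have "isCont L z" using L W by (simp add: continuous_on_eq_continuous_at)
  then have "(L \<longlongrightarrow> L z) (nhds z)" unfolding isCont_def by (rule tendsto_at_iff_tendsto_nhds[THEN iffD1])
  then have "\<forall>\<^sub>F w in nhds z. dist (L w) (L z) < pi" using pi_gt_zero by (rule tendstoD)
  moreover have "\<forall>\<^sub>F w in nhds z. w \<in> W" using W by (rule eventually_nhds_in_open)
  ultimately have "\<forall>\<^sub>F w in nhds z. L w = L z + Ln (g w / g z)"
  proof eventually_elim
    case (elim w)
    have "\<bar>Im (L w - L z)\<bar> < pi"
      using elim(1) abs_Im_le_cmod[of "L w - L z"] by (simp add: dist_norm)
    then have "Ln (exp (L w - L z)) = L w - L z" by (intro Ln_exp) auto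
    then show ?case using g[OF elim(2)] g[OF W(2)] by (simp add: exp_diff)
  qed
  moreover have "((\<lambda>w. L z + Ln (g w / g z)) has_field_derivative g' / g z) (at z)"
    using nz by (auto intro!: derivative_eq_intros D)
  ultimately show ?thesis
    by (rule DERIV_cong_ev[THEN iffD2, OF refl _ refl])
qed

lemma periodic_injective_eq_iff:
  fixes \<gamma> :: "real \<Rightarrow> complex"
  assumes periodic: "\<And>s. \<gamma> (s + 1) = \<gamma> s" and inj: "inj_on \<gamma> {0..<1}"
  shows "\<gamma> x = \<gamma> y \<longleftrightarrow> x - y \<in> \<int>"
proof -
  have int: "\<gamma> (s + of_int n) = \<gamma> s" for s n
  proof (induction n rule: int_induct[where k = 0])
    case (step1 i)
    have "s + of_int (i + 1) = (s + of_int i) + 1" by simp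
    then show ?case using step1 periodic by metis
  next
    case (step2 i)
    have "s + of_int i = (s + of_int (i - 1)) + 1" by simp
    then show ?case using step2 periodic by metis
  qed simp
  have frac: "\<gamma> (frac s) = \<gamma> s" for s
    using int[of s "- \<lfloor>s\<rfloor>"] by (simp add: frac_def)
  show ?thesis
  proof
    assume "\<gamma> x = \<gamma> y"
    then have "frac x = frac y"
      using inj frac[of x] frac[of y] by (auto simp: inj_on_def frac_lt_1)
    then have "x - y = of_int (\<lfloor>x\<rfloor> - \<lfloor>y\<rfloor>)" by (simp add: frac_def)
    then show "x - y \<in> \<int>" by (metis Ints_of_int)
  next
    assume "x - y \<in> \<int>"
    then obtain n where "x - y = of_int n" by (auto elim: Ints_cases)
    then have "x = y + of_int n" by simp
    then show "\<gamma> x = \<gamma> y" using int by simp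
  qed
qed

text \<open>The parameter is normalised by t 1 = 0. All marked parameters then lie in {0..<1} and
  the subarcs come from subintervals of {0..1}, so that \<open>subpath\<close> and
  \<open>winding_number\<close> apply to them; \<open>shifted_marked_curve\<close> reduces the given
  curve to this situation.\<close>

locale marked_curve =
  fixes m :: nat and \<gamma> :: "real \<Rightarrow> complex" and t :: "nat \<Rightarrow> real"
  assumes m: "1 \<le> m"
    and cont: "continuous_on UNIV \<gamma>"
    and periodic: "\<gamma> (s + 1) = \<gamma> s"
    and inj: "inj_on \<gamma> {0..<1}"
    and wind: "z \<in> inside (path_image \<gamma>) \<Longrightarrow> winding_number \<gamma> z = 1"
    and t1: "t 1 = 0"
    and t_mono: "\<lbrakk>1 \<le> j; j < k; k \<le> m\<rbrakk> \<Longrightarrow> t j < t k"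
    and t_less: "\<lbrakk>1 \<le> k; k \<le> m\<rbrakk> \<Longrightarrow> t k < 1"
begin

text \<open>The value 1 at \<open>Suc m\<close> is the return to the first marked point, so that the
  k-th subarc is the image of {\<tau> k<..<\<tau> (Suc k)} for k = m as well.\<close>

definition \<tau> :: "nat \<Rightarrow> real" where "\<tau> k = (if k \<le> m then t k else 1)"

text \<open>The removed arc runs from the marked point after the k-th round the curve to the k-th,
  ends included. The k-th open subarc is left as the only passage between inside and
  outside.\<close>

definition arc_complement :: "nat \<Rightarrow> complex set" where
  "arc_complement k = - (\<gamma> ` {\<tau> (Suc k)..\<tau> k + 1})"

lemma \<tau>_mono: "1 \<le> j \<Longrightarrow> j < k \<Longrightarrow> k \<le> Suc m \<Longrightarrow> \<tau> j < \<tau> k"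
  using t_mono t_less by (auto simp: \<tau>_def)

lemma \<tau>_le: "1 \<le> j \<Longrightarrow> j \<le> k \<Longrightarrow> k \<le> Suc m \<Longrightarrow> \<tau> j \<le> \<tau> k"
  using \<tau>_mono by (metis le_neq_implies_less less_eq_real_def order_refl)

lemma \<tau>_1: "\<tau> 1 = 0" and \<tau>_last: "\<tau> (Suc m) = 1"
  using t1 m by (auto simp: \<tau>_def)

lemma \<tau>_bounds: "1 \<le> k \<Longrightarrow> k \<le> Suc m \<Longrightarrow> 0 \<le> \<tau> k \<and> \<tau> k \<le> 1"
  using \<tau>_le[of 1 k] \<tau>_le[of k "Suc m"] \<tau>_1 \<tau>_last by simp

lemma subarc_eq: "1 \<le> k \<Longrightarrow> k \<le> m \<Longrightarrow> subarc m \<gamma> t k = \<gamma> ` {\<tau> k<..<\<tau> (Suc k)}"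
  using t1 by (auto simp: subarc_def \<tau>_def)

lemma eq_iff: "\<gamma> x = \<gamma> y \<longleftrightarrow> x - y \<in> \<int>"
  using periodic_injective_eq_iff[OF periodic inj] .

lemma frac_eq: "\<gamma> (frac s) = \<gamma> s"
  using eq_iff[of "frac s" s] by (simp add: frac_def)

lemma eq_imp: "\<gamma> x = \<gamma> y \<Longrightarrow> \<bar>x - y\<bar> < 1 \<Longrightarrow> x = y"
  using eq_iff Ints_eq_abs_less1 by (metis Ints_0 diff_zero eq_iff_diff_eq_0)

lemma path_image_eq: "path_image \<gamma> = range \<gamma>"
proof -
  have "\<gamma> s \<in> \<gamma> ` {0..1}" for s
    using frac_eq[of s] frac_lt_1[of s] frac_ge_0[of s] by (metis atLeastAtMost_iff imageI less_eq_real_def)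
  then show ?thesis by (auto simp: path_image_def)
qed

lemma path_\<gamma>: "path \<gamma>"
  using cont by (auto simp: path_def intro: continuous_on_subset)

lemma closed_\<gamma>: "pathfinish \<gamma> = pathstart \<gamma>"
  using periodic[of 0] by (simp add: pathfinish_def pathstart_def)

lemma simple_path_\<gamma>: "simple_path \<gamma>"
proof -
  have "x = y \<or> x = 0 \<and> y = 1 \<or> x = 1 \<and> y = 0"
    if "x \<in> {0..1}" "y \<in> {0..1}" "\<gamma> x = \<gamma> y" for x y
    using eq_imp[OF that(3)] that(1,2) by (cases "\<bar>x - y\<bar> < 1") auto
  then show ?thesis using path_\<gamma> by (auto simp: simple_path_def loop_free_def)
qed

lemmas Jordan = Jordan_inside_outside[OF simple_path_\<gamma> closed_\<gamma>]

lemma arc_complement_eq: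
  assumes "1 \<le> k" "k \<le> m"
  shows "arc_complement k = - (path_image \<gamma> - subarc m \<gamma> t k)"
proof -
  have k: "\<tau> k < \<tau> (Suc k)" "\<tau> (Suc k) \<le> 1" "0 \<le> \<tau> k"
    using assms \<tau>_mono[of k "Suc k"] \<tau>_bounds[of k] \<tau>_bounds[of "Suc k"] by auto
  have "\<gamma> ` {\<tau> (Suc k)..\<tau> k + 1} = range \<gamma> - \<gamma> ` {\<tau> k<..<\<tau> (Suc k)}"
  proof (intro equalityI subsetI)
    fix z assume "z \<in> \<gamma> ` {\<tau> (Suc k)..\<tau> k + 1}"
    then obtain x where x: "z = \<gamma> x" "x \<in> {\<tau> (Suc k)..\<tau> k + 1}" by blast
    have "z \<noteq> \<gamma> y" if "y \<in> {\<tau> k<..<\<tau> (Suc k)}" for y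
      using eq_imp[of x y] x that by auto
    then show "z \<in> range \<gamma> - \<gamma> ` {\<tau> k<..<\<tau> (Suc k)}" using x by blast
  next
    fix z assume z: "z \<in> range \<gamma> - \<gamma> ` {\<tau> k<..<\<tau> (Suc k)}"
    then obtain x where x: "z = \<gamma> x" by blast
    \<comment> \<open>The representative of x modulo 1 between \<tau> k (excluded) and \<tau> k + 1
      (included).\<close>
    define y where "y = \<tau> k + 1 - frac (\<tau> k + 1 - x)"
    have "y - x \<in> \<int>"
      by (simp add: y_def frac_def)
    then have "z = \<gamma> y" using eq_iff[of y x] x by simp
    moreover have "\<tau> k < y" "y \<le> \<tau> k + 1"
      using frac_lt_1[of "\<tau> k + 1 - x"] frac_ge_0[of "\<tau> k + 1 - x"] unfolding y_def by linarith+
    ultimately show "z \<in> \<gamma> ` {\<tau> (Suc k)..\<tau> k + 1}"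
      using z by (metis DiffE atLeastAtMost_iff greaterThanLessThan_iff imageI not_le)
  qed
  then show ?thesis using assms by (simp add: arc_complement_def path_image_eq subarc_eq)
qed

lemma inj_arc: "1 \<le> k \<Longrightarrow> k \<le> m \<Longrightarrow> inj_on \<gamma> {\<tau> (Suc k)..\<tau> k + 1}"
proof (rule inj_onI)
  fix x y assume "1 \<le> k" "k \<le> m" "x \<in> {\<tau> (Suc k)..\<tau> k + 1}" "y \<in> {\<tau> (Suc k)..\<tau> k + 1}" "\<gamma> x = \<gamma> y"
  then show "x = y" using eq_imp[of x y] \<tau>_mono[of k "Suc k"] by (auto simp: abs_if)
qed

lemma arc_complement_open: "open (arc_complement k)"
proof -
  have "compact (\<gamma> ` {\<tau> (Suc k)..\<tau> k + 1})"
    by (rule compact_continuous_image[OF continuous_on_subset[OF cont]]) auto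
  then show ?thesis unfolding arc_complement_def using compact_imp_closed by blast
qed

lemma arc_complement_connected:
  assumes "1 \<le> k" "k \<le> m"
  shows "connected (arc_complement k)"
  unfolding arc_complement_def
proof (rule connected_complement_homeomorphic_convex_compact)
  have "continuous_on {\<tau> (Suc k)..\<tau> k + 1} \<gamma>" using cont by (rule continuous_on_subset) simp
  then show "\<gamma> ` {\<tau> (Suc k)..\<tau> k + 1} homeomorphic {\<tau> (Suc k)..\<tau> k + 1}"
    using homeomorphic_compact[OF compact_Icc _ refl inj_arc[OF assms]] homeomorphic_sym by blast
qed auto

lemma inside_outside_subset:
  assumes "1 \<le> k" "k \<le> m"
  shows "inside (path_image \<gamma>) \<union> outside (path_image \<gamma>) \<subseteq> arc_complement k"
  using inside_Un_outside[of "path_image \<gamma>"] by (auto simp: arc_complement_eq[OF assms])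

lemma subarcs_disjoint:
  assumes "1 \<le> j" "j \<le> m" "1 \<le> k" "k \<le> m" "j \<noteq> k"
  shows "\<gamma> ` {\<tau> j..\<tau> (Suc j)} \<inter> subarc m \<gamma> t k = {}"
proof -
  have "x = y" if "x \<in> {\<tau> j..\<tau> (Suc j)}" "y \<in> {\<tau> k<..<\<tau> (Suc k)}" "\<gamma> x = \<gamma> y" for x y
  proof -
    have "\<bar>x - y\<bar> < 1"
      using that(1,2) \<tau>_bounds[of j] \<tau>_bounds[of k] \<tau>_bounds[of "Suc j"] \<tau>_bounds[of "Suc k"] assms by auto
    then show ?thesis using eq_imp that(3) by blast
  qed
  moreover have "\<tau> (Suc j) \<le> \<tau> k \<or> \<tau> (Suc k) \<le> \<tau> j"
    using \<tau>_le[of "Suc j" k] \<tau>_le[of "Suc k" j] assms by linarith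
  ultimately show ?thesis by (fastforce simp: subarc_eq[OF assms(3,4)])
qed

text \<open>Two different cut domains share no point of the curve, so functions on them have to be
  compared only inside and outside.\<close>

lemma arc_complement_Int:
  assumes "1 \<le> j" "j \<le> m" "1 \<le> k" "k \<le> m" "j \<noteq> k"
  shows "arc_complement j \<inter> arc_complement k = inside (path_image \<gamma>) \<union> outside (path_image \<gamma>)"
proof -
  have "subarc m \<gamma> t j \<inter> subarc m \<gamma> t k = {}"
    using subarcs_disjoint[OF assms] subarc_eq[OF assms(1,2)] by fastforce
  then show ?thesis
    using inside_Un_outside[of "path_image \<gamma>"] assms by (auto simp: arc_complement_eq)
qed

lemma marked_point: "1 \<le> k \<Longrightarrow> k \<le> m \<Longrightarrow> \<gamma> (\<tau> k) = \<gamma> (t k)"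
  by (simp add: \<tau>_def)

lemma marked_point_notin:
  assumes "1 \<le> j" "j \<le> m" "1 \<le> k" "k \<le> m"
  shows "\<gamma> (t k) \<notin> arc_complement j"
proof (cases "k = j")
  case True
  have "\<gamma> (t k) = \<gamma> (\<tau> j + 1)" using True assms periodic by (simp add: \<tau>_def)
  moreover have "\<tau> (Suc j) \<le> \<tau> j + 1" using assms \<tau>_bounds[of j] \<tau>_bounds[of "Suc j"] by simp
  ultimately show ?thesis by (auto simp: arc_complement_def)
next
  case False
  have "\<tau> k \<le> \<tau> (Suc k)" using assms by (intro \<tau>_le) auto
  then have "\<gamma> (t k) \<in> \<gamma> ` {\<tau> k..\<tau> (Suc k)}" using marked_point assms by (metis atLeastAtMost_iff imageI order_refl)
  then have "\<gamma> (t k) \<notin> subarc m \<gamma> t j" using subarcs_disjoint[OF assms(3,4,1,2) False] by blast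
  then show ?thesis by (simp add: arc_complement_eq[OF assms(1,2)] path_image_eq)
qed

lemma arc_complement_cover: "(\<Union>k\<in>{1..m}. arc_complement k) = - (\<lambda>k. \<gamma> (t k)) ` {1..m}"
proof (intro equalityI subsetI)
  fix z assume z: "z \<in> - (\<lambda>k. \<gamma> (t k)) ` {1..m}"
  show "z \<in> (\<Union>k\<in>{1..m}. arc_complement k)"
  proof (cases "z \<in> path_image \<gamma>")
    case False
    then show ?thesis using m arc_complement_eq[of 1] by force
  next
    case True
    then obtain s where s: "z = \<gamma> s" "0 \<le> s" "s < 1"
      unfolding path_image_eq using frac_eq frac_lt_1 frac_ge_0 by (metis imageE)
    \<comment> \<open>The last marked parameter at or before s; the point then lies on the k-th
      subarc.\<close>
    define k where "k = Max {k \<in> {1..m}. \<tau> k \<le> s}"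
    have fin: "finite {k \<in> {1..m}. \<tau> k \<le> s}" "1 \<in> {k \<in> {1..m}. \<tau> k \<le> s}" using m s \<tau>_1 by auto
    then have k: "k \<in> {1..m}" "\<tau> k \<le> s" using Max_in[OF fin(1)] unfolding k_def by blast+
    have "s < \<tau> (Suc k)"
    proof (rule ccontr)
      assume "\<not> s < \<tau> (Suc k)"
      moreover have "k \<noteq> m" using calculation s \<tau>_last by auto
      ultimately have "Suc k \<in> {k \<in> {1..m}. \<tau> k \<le> s}" using k by auto
      then have "Suc k \<le> k" using Max_ge[OF fin(1)] unfolding k_def by blast
      then show False by simp
    qed
    moreover have "s \<noteq> \<tau> k" using z k s marked_point by auto
    ultimately have "z \<in> subarc m \<gamma> t k" using k s subarc_eq[of k] by auto
    then show ?thesis using k arc_complement_eq[of k] by auto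
  qed
qed (use marked_point_notin in auto)

section \<open>Branches of logarithms and powers from partial winding numbers\<close>

definition partial_winding :: "nat \<Rightarrow> complex \<Rightarrow> complex" where
  "partial_winding i z = winding_number (subpath (\<tau> i) (\<tau> (Suc i)) \<gamma>) z"

lemma partial_winding_avoid:
  assumes "1 \<le> i" "i \<le> m" "1 \<le> j" "j \<le> m" "i \<noteq> j" "z \<in> arc_complement j"
  shows "z \<notin> path_image (subpath (\<tau> i) (\<tau> (Suc i)) \<gamma>)"
proof -
  have "\<tau> i \<le> \<tau> (Suc i)" using assms \<tau>_le[of i "Suc i"] by simp
  then have "path_image (subpath (\<tau> i) (\<tau> (Suc i)) \<gamma>) = \<gamma> ` {\<tau> i..\<tau> (Suc i)}"
    by (simp add: path_image_subpath)
  moreover have "\<gamma> ` {\<tau> i..\<tau> (Suc i)} \<inter> arc_complement j = {}"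
    using subarcs_disjoint[OF assms(1-5)] assms(3,4) by (auto simp: arc_complement_eq path_image_eq)
  ultimately show ?thesis using assms(6) by blast
qed

lemma path_partial: "1 \<le> i \<Longrightarrow> i \<le> m \<Longrightarrow> path (subpath (\<tau> i) (\<tau> (Suc i)) \<gamma>)"
  using \<tau>_bounds[of i] \<tau>_bounds[of "Suc i"] path_\<gamma> by (intro path_subpath) auto

lemma continuous_on_partial_winding:
  assumes "1 \<le> i" "i \<le> m" "1 \<le> j" "j \<le> m" "i \<noteq> j"
  shows "continuous_on (arc_complement j) (partial_winding i)"
proof (rule continuous_at_imp_continuous_on, rule ballI)
  fix z assume "z \<in> arc_complement j"
  then show "isCont (partial_winding i) z"
    using continuous_at_winding_number[OF path_partial[OF assms(1,2)] partial_winding_avoid[OF assms]]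
    unfolding partial_winding_def by (metis (no_types, lifting) ext)
qed

text \<open>For an open path, 2\<pi>\<i> times the winding number about z is the increment of a
  logarithm of \<zeta> - z as \<zeta> runs along the path.\<close>

lemma exp_partial_winding:
  assumes "1 \<le> i" "i \<le> m" "1 \<le> j" "j \<le> m" "i \<noteq> j" "z \<in> arc_complement j"
  shows "\<gamma> (\<tau> (Suc i)) - z = exp (2 * pi * \<i> * partial_winding i z) * (\<gamma> (\<tau> i) - z)"
  using winding_number_exp_2pi[OF path_partial[OF assms(1,2)] partial_winding_avoid[OF assms]]
  by (simp add: partial_winding_def)

text \<open>The last hypothesis keeps j out of the summation range: z may lie on the j-th subarc,
  and \<open>exp_partial_winding\<close> says nothing there for i = j.\<close>

lemma exp_sum_partial_winding:
  assumes "1 \<le> p" "p \<le> q" "q \<le> Suc m" "1 \<le> j" "j \<le> m" "z \<in> arc_complement j"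
    and "q \<le> j \<or> j < p"
  shows "\<gamma> (\<tau> q) - z = exp (2 * pi * \<i> * (\<Sum>i=p..<q. partial_winding i z)) * (\<gamma> (\<tau> p) - z)"
  using assms(2,3,7)
proof (induction q rule: dec_induct)
  case (step q)
  then have "\<gamma> (\<tau> (Suc q)) - z = exp (2 * pi * \<i> * partial_winding q z) * (\<gamma> (\<tau> q) - z)"
    using assms(1,4-6) by (intro exp_partial_winding[of q j]) auto
  moreover have "\<gamma> (\<tau> q) - z = exp (2 * pi * \<i> * (\<Sum>i=p..<q. partial_winding i z)) * (\<gamma> (\<tau> p) - z)"
    using step by auto
  ultimately show ?case
    using step by (simp add: distrib_left exp_add)
qed simp

lemma sum_partial_winding:
  assumes z: "z \<notin> path_image \<gamma>"
  shows "(\<Sum>i=1..<Suc m. partial_winding i z) = winding_number \<gamma> z"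
proof -
  have "(\<Sum>i=1..<q. partial_winding i z) = winding_number (subpath 0 (\<tau> q) \<gamma>) z"
    if "1 \<le> q" "q \<le> Suc m" for q
    using that
  proof (induction q rule: dec_induct)
    case base
    have "z \<noteq> \<gamma> 0" using z path_image_eq by auto
    then show ?case using \<tau>_1 by simp
  next
    case (step q)
    have "winding_number (subpath 0 (\<tau> q) \<gamma>) z + winding_number (subpath (\<tau> q) (\<tau> (Suc q)) \<gamma>) z =
        winding_number (subpath 0 (\<tau> (Suc q)) \<gamma>) z"
      using step \<tau>_bounds[of q] \<tau>_bounds[of "Suc q"]
      by (intro winding_number_subpath_combine path_\<gamma> z) auto
    then show ?case using step by (simp add: partial_winding_def)
  qed
  from this[of "Suc m"] show ?thesis by (simp add: \<tau>_last subpath_refl)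
qed

text \<open>A branch of the logarithm of (z - a_k) / (z - a_1), divided by 2\<pi>\<i>, on the j-th
  cut domain. The route along the curve from a_1 to a_k must avoid the j-th subarc: forwards if k
  \<le> j, otherwise backwards, beginning with the last subarc. The summand 1 is the winding number
  inside, so both routes give the same value there; outside they differ by 1, and this difference is
  the whole jump between cut domains.\<close>

definition log_branch :: "nat \<Rightarrow> nat \<Rightarrow> complex \<Rightarrow> complex" where
  "log_branch k j z =
     (if k \<le> j then \<Sum>i=1..<k. partial_winding i z else 1 - (\<Sum>i=k..<Suc m. partial_winding i z))"

lemma log_branch_inside:
  assumes "1 \<le> k" "k \<le> m" "z \<in> inside (path_image \<gamma>)"
  shows "log_branch k j z = (\<Sum>i=1..<k. partial_winding i z)"
proof -
  have "z \<notin> path_image \<gamma>" using assms(3) inside_no_overlap by blast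
  then have "(\<Sum>i=1..<Suc m. partial_winding i z) = 1" using sum_partial_winding wind assms(3) by simp
  moreover have "(\<Sum>i=1..<Suc m. partial_winding i z) =
      (\<Sum>i=1..<k. partial_winding i z) + (\<Sum>i=k..<Suc m. partial_winding i z)"
    using assms by (intro sum.atLeastLessThan_concat[symmetric]) auto
  ultimately show ?thesis by (simp add: log_branch_def algebra_simps)
qed

lemma log_branch_outside:
  assumes "1 \<le> k" "k \<le> m" "z \<in> outside (path_image \<gamma>)"
  shows "log_branch k j z = (\<Sum>i=1..<k. partial_winding i z) + (if k \<le> j then 0 else 1)"
proof -
  have "z \<notin> path_image \<gamma>" using assms(3) outside_no_overlap by blast
  then have "(\<Sum>i=1..<Suc m. partial_winding i z) = 0"
    using sum_partial_winding winding_number_zero_in_outside[OF path_\<gamma> closed_\<gamma> assms(3)] by simp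
  moreover have "(\<Sum>i=1..<Suc m. partial_winding i z) =
      (\<Sum>i=1..<k. partial_winding i z) + (\<Sum>i=k..<Suc m. partial_winding i z)"
    using assms by (intro sum.atLeastLessThan_concat[symmetric]) auto
  ultimately show ?thesis by (auto simp: log_branch_def algebra_simps add_eq_0_iff)
qed

lemma exp_log_branch:
  assumes "1 \<le> k" "k \<le> m" "1 \<le> j" "j \<le> m" "z \<in> arc_complement j"
  shows "exp (2 * pi * \<i> * log_branch k j z) = (z - \<gamma> (t k)) / (z - \<gamma> (t 1))"
proof -
  have nz: "z \<noteq> \<gamma> (t 1)" "z \<noteq> \<gamma> (t k)" using assms marked_point_notin[of j] m by auto
  show ?thesis
  proof (cases "k \<le> j")
    case True
    then show ?thesis
      using exp_sum_partial_winding[of 1 k j z] assms nz marked_point[of k] marked_point[of 1] m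
      by (simp add: log_branch_def divide_simps) (simp add: algebra_simps)
  next
    case False
    have "\<gamma> (\<tau> (Suc m)) = \<gamma> (t 1)" using periodic[of 0] \<tau>_last t1 by simp
    moreover define E where "E = exp (2 * pi * \<i> * (\<Sum>i=k..<Suc m. partial_winding i z))"
    ultimately have "\<gamma> (t 1) - z = E * (\<gamma> (t k) - z)"
      using exp_sum_partial_winding[of k "Suc m" j z] assms marked_point[of k] False by simp
    then have "z - \<gamma> (t 1) = E * (z - \<gamma> (t k))" by (simp add: algebra_simps)
    moreover have "exp (2 * pi * \<i> * log_branch k j z) = 1 / E"
      using False unfolding log_branch_def E_def
      by (simp add: right_diff_distrib exp_diff del: sum.op_ivl_Suc)
    moreover have "E \<noteq> 0" by (simp add: E_def)
    ultimately show ?thesis using nz by simp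
  qed
qed

lemma log_branch_derivative:
  assumes "1 \<le> k" "k \<le> m" "1 \<le> j" "j \<le> m" "z \<in> arc_complement j"
  shows "((\<lambda>z. 2 * pi * \<i> * log_branch k j z) has_field_derivative
    1 / (z - \<gamma> (t k)) - 1 / (z - \<gamma> (t 1))) (at z)"
proof -
  have nz: "z \<noteq> \<gamma> (t 1)" "z \<noteq> \<gamma> (t k)" using assms marked_point_notin[of j] m by auto
  have "continuous_on (arc_complement j) (\<lambda>z. 2 * pi * \<i> * log_branch k j z)"
    unfolding log_branch_def using assms
    by (cases "k \<le> j") (auto intro!: continuous_intros continuous_on_partial_winding simp del: sum.op_ivl_Suc)
  moreover have "((\<lambda>z. (z - \<gamma> (t k)) / (z - \<gamma> (t 1))) has_field_derivative
      (\<gamma> (t k) - \<gamma> (t 1)) / (z - \<gamma> (t 1))\<^sup>2) (at z)"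
    using nz by (auto intro!: derivative_eq_intros simp: power2_eq_square divide_simps)
  ultimately have "((\<lambda>z. 2 * pi * \<i> * log_branch k j z) has_field_derivative
      (\<gamma> (t k) - \<gamma> (t 1)) / (z - \<gamma> (t 1))\<^sup>2 / ((z - \<gamma> (t k)) / (z - \<gamma> (t 1)))) (at z)"
    using has_field_derivative_exp_lift[where g = "\<lambda>z. (z - \<gamma> (t k)) / (z - \<gamma> (t 1))",
        OF arc_complement_open assms(5) _ exp_log_branch[OF assms(1-4)]] by blast
  moreover have "(\<gamma> (t k) - \<gamma> (t 1)) / (z - \<gamma> (t 1))\<^sup>2 / ((z - \<gamma> (t k)) / (z - \<gamma> (t 1)))
      = 1 / (z - \<gamma> (t k)) - 1 / (z - \<gamma> (t 1))"
    using nz by (simp add: divide_simps power2_eq_square)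
  ultimately show ?thesis by simp
qed

text \<open>This is the product of ((z - a_k) / (z - a_1))^\<epsilon>_k, in which k = 1 would
  contribute the factor 1. The integral power of z - a_1 that completes it is added in
  \<open>twisted_single_valued_solution\<close>.\<close>

definition power_branch :: "(nat \<Rightarrow> complex) \<Rightarrow> nat \<Rightarrow> complex \<Rightarrow> complex" where
  "power_branch \<epsilon> j z = exp (\<Sum>k=2..m. \<epsilon> k * (2 * pi * \<i> * log_branch k j z))"

lemma power_branch_nonzero: "power_branch \<epsilon> j z \<noteq> 0"
  by (simp add: power_branch_def)

lemma power_branch_derivative:
  assumes "1 \<le> j" "j \<le> m" "z \<in> arc_complement j"
  shows "(power_branch \<epsilon> j has_field_derivative
    (\<Sum>k=2..m. \<epsilon> k * (1 / (z - \<gamma> (t k)) - 1 / (z - \<gamma> (t 1)))) * power_branch \<epsilon> j z) (at z)"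
proof -
  have "((\<lambda>z. \<Sum>k=2..m. \<epsilon> k * (2 * pi * \<i> * log_branch k j z)) has_field_derivative
      (\<Sum>k=2..m. \<epsilon> k * (1 / (z - \<gamma> (t k)) - 1 / (z - \<gamma> (t 1))))) (at z)"
    using assms by (intro DERIV_sum DERIV_cmult log_branch_derivative) auto
  from DERIV_fun_exp[OF this] show ?thesis
    unfolding power_branch_def[abs_def] by (simp only: mult.commute)
qed

lemma power_branch_inside:
  assumes "z \<in> inside (path_image \<gamma>)"
  shows "power_branch \<epsilon> i z = power_branch \<epsilon> j z"
  unfolding power_branch_def using log_branch_inside[OF _ _ assms] by simp

text \<open>Passing from j - 1 to j changes the route only for the logarithm with k = j, and there
  \<open>log_branch\<close> drops by 1.\<close>

lemma power_branch_outside: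
  assumes "z \<in> outside (path_image \<gamma>)" "2 \<le> j" "j \<le> m"
  shows "power_branch \<epsilon> j z = exp (- 2 * pi * \<i> * \<epsilon> j) * power_branch \<epsilon> (j - 1) z"
proof -
  have "\<epsilon> k * (2 * pi * \<i> * log_branch k j z) =
      \<epsilon> k * (2 * pi * \<i> * log_branch k (j - 1) z) + (if k = j then - 2 * pi * \<i> * \<epsilon> j else 0)"
    if "k \<in> {2..m}" for k
  proof -
    have "1 \<le> k" "k \<le> m" using that by auto
    then show ?thesis
      using log_branch_outside[OF _ _ assms(1), of k] assms(2) by (auto simp: algebra_simps)
  qed
  then have "(\<Sum>k=2..m. \<epsilon> k * (2 * pi * \<i> * log_branch k j z)) =
      (\<Sum>k=2..m. \<epsilon> k * (2 * pi * \<i> * log_branch k (j - 1) z)) + (- 2 * pi * \<i> * \<epsilon> j)"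
    using assms by (simp add: sum.distrib sum.delta)
  then show ?thesis unfolding power_branch_def by (simp only: exp_add mult.commute)
qed

end

subsection \<open>Monodromy along the encircling paths\<close>

text \<open>The chordal distance from z to \<infinity> is 2 / sqrt (|z|^2 + 1). This is what keeps
  \<open>exterior\<close> connected although \<infinity> is added to it.\<close>

lemma infinity_in_closure:
  assumes "\<not> bounded S"
  shows "sphere_infinity \<in> closure (to_sphere ` S)"
  unfolding closure_approachable
proof (intro allI impI)
  fix e :: real assume e: "e > 0"
  obtain z where z: "z \<in> S" "cmod z > 2 / e"
    using assms unfolding bounded_iff by (meson not_le)
  have n: "(cmod z)\<^sup>2 + 1 > 0" by (smt (verit) zero_le_power2)
  have "(dist (to_sphere z) sphere_infinity)\<^sup>2 = 4 / ((cmod z)\<^sup>2 + 1)"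
    using n unfolding dist_norm to_sphere_def sphere_infinity_def
    by (simp add: norm_prod_def power_mult_distrib power_divide divide_simps)
       (simp add: power2_eq_square algebra_simps)
  also have "\<dots> < e\<^sup>2"
  proof -
    have "2 < e * cmod z" using z e by (simp add: field_simps)
    then have "2\<^sup>2 < (e * cmod z)\<^sup>2" by (intro power_strict_mono) auto
    then have "4 < e\<^sup>2 * (cmod z)\<^sup>2" by (simp add: power_mult_distrib)
    also have "\<dots> \<le> e\<^sup>2 * ((cmod z)\<^sup>2 + 1)" by (simp add: algebra_simps)
    finally show ?thesis using n by (simp add: divide_simps)
  qed
  finally have "dist (to_sphere z) sphere_infinity < e" using e by (simp add: power2_less_imp_less)
  then show "\<exists>y\<in>to_sphere ` S. dist y sphere_infinity < e" using z by blast
qed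

text \<open>The second row of an invertible matrix is a nonzero functional, and its kernel in a
  plane is a line.\<close>

lemma vanishing_component_parallel:
  fixes M :: "complex^2^2"
  assumes M: "invertible M" and x: "(M *v x) $ 2 = 0" and d: "(M *v d) $ 2 = 0" "d \<noteq> 0"
  shows "\<exists>c. x = c *s d"
proof -
  have inj: "w = 0" if "M *v w = 0" for w
    using M that by (metis matrix_left_invertible_ker invertible_def)
  have b: "(M *v d) $ 1 \<noteq> 0"
    using inj[of d] d by (auto simp: vec_eq_iff forall_2)
  define c where "c = (M *v x) $ 1 / (M *v d) $ 1"
  have lin: "(M *v (x - c *s d)) $ i = (M *v x) $ i - c * (M *v d) $ i" for i
    by (simp add: matrix_vector_mult_2 algebra_simps)
  have "M *v (x - c *s d) = 0"
    unfolding vec_eq_iff forall_2 lin using x d b by (simp add: c_def)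
  then have "x - c *s d = 0" by (rule inj)
  then show ?thesis by (auto intro: exI[of _ c])
qed

context marked_curve
begin

lemma Jordan_facts:
  "connected (inside (path_image \<gamma>))" "connected (outside (path_image \<gamma>))"
  "inside (path_image \<gamma>) \<noteq> {}" "outside (path_image \<gamma>) \<noteq> {}"
  "\<not> bounded (outside (path_image \<gamma>))"
  using Jordan by simp_all

lemma inside_subset: "1 \<le> k \<Longrightarrow> k \<le> m \<Longrightarrow> inside (path_image \<gamma>) \<subseteq> arc_complement k"
  and outside_subset: "1 \<le> k \<Longrightarrow> k \<le> m \<Longrightarrow> outside (path_image \<gamma>) \<subseteq> arc_complement k"
  using inside_outside_subset[of k] unfolding le_sup_iff by blast+

lemma cyclic_pred_range: "1 \<le> k \<Longrightarrow> k \<le> m \<Longrightarrow> 1 \<le> cyclic_pred m k \<and> cyclic_pred m k \<le> m"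
  using m by (auto simp: cyclic_pred_def)

text \<open>The middle part of an encircling path runs here, and it may pass through \<infinity>,
  which belongs to this set.\<close>

definition exterior :: "(complex \<times> real) set" where
  "exterior = sphere 0 1 - to_sphere ` (path_image \<gamma> \<union> inside (path_image \<gamma>))"

lemma exterior_eq: "exterior = insert sphere_infinity (to_sphere ` outside (path_image \<gamma>))"
proof -
  have "outside (path_image \<gamma>) = - (path_image \<gamma> \<union> inside (path_image \<gamma>))"
    by (metis Un_commute outside_inside)
  then have out: "z \<in> outside (path_image \<gamma>) \<longleftrightarrow> z \<notin> path_image \<gamma> \<union> inside (path_image \<gamma>)" for z
    by blast
  have inf: "sphere_infinity \<in> sphere 0 1" by (simp add: sphere_infinity_def norm_prod_def)
  have "q \<in> exterior \<longleftrightarrow> q \<in> insert sphere_infinity (to_sphere ` outside (path_image \<gamma>))" for q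
  proof -
    consider "q = sphere_infinity" | z where "q = to_sphere z" | "q \<notin> sphere 0 1"
      using to_sphere_affine_coord by metis
    then show ?thesis
    proof cases
      case 1
      then show ?thesis unfolding exterior_def using inf to_sphere_neq_infinity by (metis Diff_iff imageE insertI1)
    next
      case 2
      then show ?thesis
        unfolding exterior_def 2 insert_iff Diff_iff inj_image_mem_iff[OF inj_to_sphere] out
        using to_sphere_in_sphere[of z] to_sphere_neq_infinity[of z] by blast
    next
      case 3
      then show ?thesis unfolding exterior_def using inf to_sphere_in_sphere by (metis Diff_iff imageE insertE)
    qed
  qed
  then show ?thesis by blast
qed

lemma connected_exterior: "connected exterior"
proof (rule connected_intermediate_closure)
  show "connected (to_sphere ` outside (path_image \<gamma>))"
    by (rule connected_continuous_image[OF continuous_on_to_sphere Jordan_facts(2)])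
  show "to_sphere ` outside (path_image \<gamma>) \<subseteq> exterior" unfolding exterior_eq by blast
  show "exterior \<subseteq> closure (to_sphere ` outside (path_image \<gamma>))"
    unfolding exterior_eq insert_subset
    by (rule conjI[OF infinity_in_closure[OF Jordan_facts(5)] closure_subset])
qed

definition cut_sphere :: "nat \<Rightarrow> (complex \<times> real) set" where
  "cut_sphere k = sphere 0 1 - to_sphere ` \<gamma> ` {\<tau> (Suc k)..\<tau> k + 1}"

lemma to_sphere_in_cut_sphere: "to_sphere z \<in> cut_sphere k \<longleftrightarrow> z \<in> arc_complement k"
  using to_sphere_in_sphere[of z]
  by (simp add: cut_sphere_def arc_complement_def inj_image_mem_iff[OF inj_to_sphere] del: mem_sphere_0)

lemma exterior_subset:
  assumes "1 \<le> k" "k \<le> m"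
  shows "exterior \<subseteq> cut_sphere k"
proof -
  have "\<gamma> ` {\<tau> (Suc k)..\<tau> k + 1} \<subseteq> path_image \<gamma>" by (auto simp: path_image_eq)
  then show ?thesis unfolding exterior_def cut_sphere_def by blast
qed

text \<open>Before the second crossing the projected path stays in the cut sphere of l, so p equals
  the lift by s l starting at x0. After the first crossing it stays in the cut sphere of k, and p
  equals the lift by s k moved by \<sigma>, since both end at \<sigma> x0. Between the crossings
  both descriptions hold, so s l and \<sigma> \<circ> s k agree at one exterior point and hence on
  the connected exterior.\<close>

lemma monodromy_of_sections:
  fixes X :: "'a::real_normed_vector set"
  assumes cov: "covering_space X \<rho> S" and S: "S \<subseteq> sphere 0 1"
    and k: "1 \<le> k" "k \<le> m" and l: "l = cyclic_pred m k"
    and s: "\<And>j. j \<in> {k, l} \<Longrightarrow> continuous_on (cut_sphere j) (s j)"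
      "\<And>j q. j \<in> {k, l} \<Longrightarrow> q \<in> cut_sphere j \<Longrightarrow> s j q \<in> X \<and> \<rho> (s j q) = q"
      "\<And>j. j \<in> {k, l} \<Longrightarrow> s j (\<rho> x0) = x0"
    and \<sigma>: "deck_transformation X \<rho> \<sigma>"
    and p: "encircling_path m \<gamma> t X \<rho> k p" "pathstart p = x0" "pathfinish p = \<sigma> x0"
    and q: "q \<in> exterior"
  shows "s l q = \<sigma> (s k q)"
proof -
  have lr: "1 \<le> l" "l \<le> m" using cyclic_pred_range k l by auto
  have \<rho>S: "\<rho> x \<in> S" if "x \<in> X" for x using cov that covering_space_imp_surjective by blast
  have c\<rho>: "continuous_on X \<rho>" using cov covering_space_imp_continuous by blast
  have c\<sigma>: "continuous_on X \<sigma>" "\<And>x. x \<in> X \<Longrightarrow> \<sigma> x \<in> X" "\<And>x. x \<in> X \<Longrightarrow> \<rho> (\<sigma> x) = \<rho> x"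
    using \<sigma> by (auto simp: deck_transformation_def homeomorphism_def)
  obtain r e where re: "0 < r" "r < e" "e < 1"
    and in_r: "\<rho> (p r) \<in> to_sphere ` subarc m \<gamma> t l"
    and in_e: "\<rho> (p e) \<in> to_sphere ` subarc m \<gamma> t k"
    and ins: "\<And>u. u \<in> {0..<r} \<union> {e<..1} \<Longrightarrow> \<rho> (p u) \<in> to_sphere ` inside (path_image \<gamma>)"
    and out: "\<And>u. u \<in> {r<..<e} \<Longrightarrow> \<rho> (p u) \<notin> to_sphere ` (path_image \<gamma> \<union> inside (path_image \<gamma>))"
    using p(1) unfolding encircling_path_def l by blast
  have pX: "p u \<in> X" if "u \<in> {0..1}" for u
    using p(1) that by (auto simp: encircling_path_def path_image_def)
  have cp: "continuous_on {0..1} p"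
    using p(1) simple_path_imp_path by (auto simp: encircling_path_def path_def)
  have ends: "\<rho> (p 1) = \<rho> x0" "p 0 = x0" "p 1 = \<sigma> x0"
    using p by (auto simp: encircling_path_def pathstart_def pathfinish_def)
  have insV: "to_sphere ` inside (path_image \<gamma>) \<subseteq> cut_sphere j" if "1 \<le> j" "j \<le> m" for j
    using inside_subset[OF that] to_sphere_in_cut_sphere by blast
  have arcV: "to_sphere ` subarc m \<gamma> t j \<subseteq> cut_sphere j" if "1 \<le> j" "j \<le> m" for j
    using arc_complement_eq[OF that] to_sphere_in_cut_sphere by blast
  have outV: "\<rho> (p u) \<in> exterior" if "u \<in> {r<..<e}" for u
    using out[OF that] \<rho>S[OF pX, of u] S that re by (auto simp: exterior_def)
  have Vl: "\<rho> (p u) \<in> cut_sphere l" if u: "u \<in> {0..<e}" for u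
  proof -
    consider "u < r" | "u = r" | "u \<in> {r<..<e}" using u by fastforce
    then show ?thesis
      using ins[of u] in_r outV[of u] insV[OF lr] arcV[OF lr] exterior_subset[OF lr] u
      by cases auto
  qed
  have Vk: "\<rho> (p u) \<in> cut_sphere k" if u: "u \<in> {r<..1}" for u
  proof -
    consider "u > e" | "u = e" | "u \<in> {r<..<e}" using u by fastforce
    then show ?thesis
      using ins[of u] in_e outV[of u] insV[OF k] arcV[OF k] exterior_subset[OF k] u
      by cases auto
  qed
  have sl: "s l (\<rho> (p u)) \<in> X \<and> \<rho> (s l (\<rho> (p u))) = \<rho> (p u)" if "u \<in> {0..<e}" for u
    using s(2)[of l] Vl[OF that] by blast
  have sk: "s k (\<rho> (p u)) \<in> X \<and> \<rho> (s k (\<rho> (p u))) = \<rho> (p u)" if "u \<in> {r<..1}" for u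
    using s(2)[of k] Vk[OF that] by blast
  have cpl: "continuous_on {0..<e} p" "continuous_on {r<..1} p"
    using re by (auto intro: continuous_on_subset[OF cp])
  have c\<rho>p: "continuous_on {0..<e} (\<lambda>u. \<rho> (p u))" "continuous_on {r<..1} (\<lambda>u. \<rho> (p u))"
    using re pX by (auto intro!: continuous_on_compose2[OF c\<rho>] cpl)
  have eq1: "p u = s l (\<rho> (p u))" if "u \<in> {0..<e}" for u
  proof (rule covering_space_lift_unique[OF cov, where f = "\<lambda>u. \<rho> (p u)" and T = "{0..<e}" and a = 0])
    show "p 0 = s l (\<rho> (p 0))" using s(3)[of l] ends by simp
    show "continuous_on {0..<e} (\<lambda>u. s l (\<rho> (p u)))"
      using Vl by (intro continuous_on_compose2[OF s(1)] c\<rho>p) auto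
    show "(\<lambda>u. \<rho> (p u)) \<in> {0..<e} \<rightarrow> S" "p \<in> {0..<e} \<rightarrow> X" using pX \<rho>S re by auto
    show "(\<lambda>u. s l (\<rho> (p u))) \<in> {0..<e} \<rightarrow> X" using sl by blast
    show "\<And>u. u \<in> {0..<e} \<Longrightarrow> \<rho> (p u) = \<rho> (s l (\<rho> (p u)))" using sl by simp
  qed (use cpl c\<rho>p that re in auto)
  have eq2: "p u = \<sigma> (s k (\<rho> (p u)))" if "u \<in> {r<..1}" for u
  proof (rule covering_space_lift_unique[OF cov, where f = "\<lambda>u. \<rho> (p u)" and T = "{r<..1}" and a = 1])
    show "p 1 = \<sigma> (s k (\<rho> (p 1)))" using s(3)[of k] ends by simp
    have "continuous_on {r<..1} (\<lambda>u. s k (\<rho> (p u)))"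
      using Vk by (intro continuous_on_compose2[OF s(1)] c\<rho>p) auto
    then show "continuous_on {r<..1} (\<lambda>u. \<sigma> (s k (\<rho> (p u))))"
      using sk by (intro continuous_on_compose2[OF c\<sigma>(1)]) auto
    show "(\<lambda>u. \<rho> (p u)) \<in> {r<..1} \<rightarrow> S" "p \<in> {r<..1} \<rightarrow> X" using pX \<rho>S re by auto
    show "(\<lambda>u. \<sigma> (s k (\<rho> (p u)))) \<in> {r<..1} \<rightarrow> X" using sk c\<sigma>(2) by blast
    show "\<And>u. u \<in> {r<..1} \<Longrightarrow> \<rho> (p u) = \<rho> (\<sigma> (s k (\<rho> (p u))))" using sk c\<sigma>(3) by simp
  qed (use cpl c\<rho>p that re in auto)
  define u where "u = (r + e) / 2"
  have u: "u \<in> {r<..<e}" using re by (auto simp: u_def)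
  have sX: "s k q \<in> X" "s l q \<in> X" "\<rho> (s k q) = q" "\<rho> (s l q) = q" if "q \<in> exterior" for q
    using s(2)[of k q] s(2)[of l q] exterior_subset[OF k] exterior_subset[OF lr] that by blast+
  show ?thesis
  proof (rule covering_space_lift_unique[OF cov, where f = "\<lambda>q. q" and T = exterior and a = "\<rho> (p u)"])
    show "s l (\<rho> (p u)) = \<sigma> (s k (\<rho> (p u)))" using eq1[of u] eq2[of u] u re by auto
    show "continuous_on exterior (s l)"
      using s(1)[of l] exterior_subset[OF lr] by (auto intro: continuous_on_subset)
    have "continuous_on exterior (s k)"
      using s(1)[of k] exterior_subset[OF k] by (auto intro: continuous_on_subset)
    then show "continuous_on exterior (\<lambda>q. \<sigma> (s k q))"
      using sX by (intro continuous_on_compose2[OF c\<sigma>(1)]) auto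
    show "(\<lambda>q. q) \<in> exterior \<rightarrow> S" using sX \<rho>S by (metis Pi_I)
  qed (use sX c\<sigma> connected_exterior outV[OF u] q in auto)
qed

text \<open>The \<Phi> k are Y composed with sections that all take the value x0 over the base
  point. They therefore agree on the connected inside; outside, \<open>monodromy_of_sections\<close>
  turns Y x = Y (\<sigma> k x) ** N k into the transition rule.\<close>

lemma single_valued_branches:
  fixes X :: "'a::real_normed_vector set"
  assumes cov: "covering_space X \<rho> S" and S: "S = punctured_sphere m a"
    and a: "\<And>k. k \<in> {1..m} \<Longrightarrow> a k = \<gamma> (t k)"
    and x0: "x0 \<in> X" "\<rho> x0 \<in> to_sphere ` inside (path_image \<gamma>)"
    and \<sigma>: "standard_deck_transformations m \<gamma> t X \<rho> x0 \<sigma>"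
    and Y: "solution_on A (finite_part X \<rho>) (affine_coord \<circ> \<rho>) Y"
    and N: "\<And>k x. k \<in> {1..m} \<Longrightarrow> x \<in> finite_part X \<rho> \<Longrightarrow> Y x = Y (\<sigma> k x) ** N k"
  obtains \<Phi> where
    "\<And>k. k \<in> {1..m} \<Longrightarrow> fundamental_on A (arc_complement k) (\<Phi> k)"
    "\<And>i j z. \<lbrakk>i \<in> {1..m}; j \<in> {1..m}; z \<in> inside (path_image \<gamma>)\<rbrakk> \<Longrightarrow> \<Phi> i z = \<Phi> j z"
    "\<And>k z. \<lbrakk>k \<in> {1..m}; z \<in> outside (path_image \<gamma>)\<rbrakk> \<Longrightarrow> \<Phi> k z = \<Phi> (cyclic_pred m k) z ** N k"
proof -
  have Ssub: "S \<subseteq> sphere 0 1" by (auto simp: S punctured_sphere_def)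
  obtain b where b: "b \<in> inside (path_image \<gamma>)" "\<rho> x0 = to_sphere b" using x0(2) by blast
  have insW: "inside (path_image \<gamma>) \<subseteq> arc_complement k" if "k \<in> {1..m}" for k
    using inside_subset that by simp
  have "\<exists>s. continuous_on (cut_sphere k) s \<and> (\<forall>q\<in>cut_sphere k. s q \<in> X \<and> \<rho> (s q) = q) \<and> s (\<rho> x0) = x0"
    if k: "k \<in> {1..m}" for k
  proof -
    have le: "\<tau> (Suc k) \<le> \<tau> k + 1" using k \<tau>_bounds[of k] \<tau>_bounds[of "Suc k"] by simp
    have "a ` {1..m} \<subseteq> \<gamma> ` {\<tau> (Suc k)..\<tau> k + 1}"
      using marked_point_notin[of k] k a unfolding arc_complement_def by fastforce
    then have sub: "cut_sphere k \<subseteq> S" unfolding S punctured_sphere_def cut_sphere_def by blast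
    have ck: "continuous_on {\<tau> (Suc k)..\<tau> k + 1} \<gamma>" using cont by (rule continuous_on_subset) simp
    have nin: "\<rho> x0 \<notin> to_sphere ` \<gamma> ` {\<tau> (Suc k)..\<tau> k + 1}"
      using to_sphere_in_cut_sphere[of b k] insW[OF k] b by (auto simp: cut_sphere_def)
    have ij: "inj_on \<gamma> {\<tau> (Suc k)..\<tau> k + 1}" using inj_arc k by simp
    obtain s where "continuous_on (cut_sphere k) s"
      "\<And>q. q \<in> cut_sphere k \<Longrightarrow> s q \<in> X \<and> \<rho> (s q) = q" "s (\<rho> x0) = x0"
      by (rule section_over_arc_complement[OF cov Ssub le ck ij sub[unfolded cut_sphere_def] x0(1) nin,
            folded cut_sphere_def]) (rule that)
    then show ?thesis by blast
  qed
  then obtain s where s: "\<And>k. k \<in> {1..m} \<Longrightarrow> continuous_on (cut_sphere k) (s k)"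
      "\<And>k q. k \<in> {1..m} \<Longrightarrow> q \<in> cut_sphere k \<Longrightarrow> s k q \<in> X \<and> \<rho> (s k q) = q"
      "\<And>k. k \<in> {1..m} \<Longrightarrow> s k (\<rho> x0) = x0"
    by metis
  have sW: "continuous_on (arc_complement k) (\<lambda>z. s k (to_sphere z))" if "k \<in> {1..m}" for k
    by (rule continuous_on_compose2[OF s(1)[OF that] continuous_on_to_sphere])
       (use to_sphere_in_cut_sphere in blast)
  have liftW: "s k (to_sphere z) \<in> X \<and> \<rho> (s k (to_sphere z)) = to_sphere z"
    if "k \<in> {1..m}" "z \<in> arc_complement k" for k z
    using s(2) that to_sphere_in_cut_sphere by blast
  show thesis
  proof
    show "fundamental_on A (arc_complement k) (\<lambda>z. Y (s k (to_sphere z)))" if "k \<in> {1..m}" for k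
      by (rule fundamental_on_section[OF cov Ssub arc_complement_open sW[OF that] liftW[OF that] Y])
    show "Y (s i (to_sphere z)) = Y (s j (to_sphere z))"
      if ij: "i \<in> {1..m}" "j \<in> {1..m}" and z: "z \<in> inside (path_image \<gamma>)" for i j z
    proof -
      have "s i (to_sphere z) = s j (to_sphere z)"
      proof (rule covering_space_lift_unique[OF cov, where f = to_sphere and a = b
            and T = "inside (path_image \<gamma>)"])
        show "s i (to_sphere b) = s j (to_sphere b)" using s(3) ij b by metis
        have "to_sphere z \<in> S" if "z \<in> inside (path_image \<gamma>)" for z
        proof -
          have "s i (to_sphere z) \<in> X" "\<rho> (s i (to_sphere z)) = to_sphere z"
            using liftW[OF ij(1), of z] insW[OF ij(1)] that by blast+
          then show ?thesis using covering_space_imp_surjective[OF cov] by (metis imageI)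
        qed
        then show "to_sphere \<in> inside (path_image \<gamma>) \<rightarrow> S" by blast
        show "continuous_on (inside (path_image \<gamma>)) (\<lambda>z. s i (to_sphere z))"
          "continuous_on (inside (path_image \<gamma>)) (\<lambda>z. s j (to_sphere z))"
          using sW insW ij continuous_on_subset by blast+
      qed (use Jordan_facts(1) b z liftW insW ij continuous_on_to_sphere in \<open>auto simp: subset_iff\<close>)
      then show ?thesis by simp
    qed
    show "Y (s k (to_sphere z)) = Y (s (cyclic_pred m k) (to_sphere z)) ** N k"
      if k: "k \<in> {1..m}" and z: "z \<in> outside (path_image \<gamma>)" for k z
    proof -
      obtain p where p: "encircling_path m \<gamma> t X \<rho> k p" "pathstart p = x0" "pathfinish p = \<sigma> k x0"
        and dk: "deck_transformation X \<rho> (\<sigma> k)"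
        using \<sigma> k unfolding standard_deck_transformations_def by blast
      have l: "cyclic_pred m k \<in> {1..m}" using cyclic_pred_range k by simp
      have "to_sphere z \<in> exterior" using z exterior_eq by blast
      then have "s (cyclic_pred m k) (to_sphere z) = \<sigma> k (s k (to_sphere z))"
        using k l by (intro monodromy_of_sections[OF cov Ssub _ _ refl _ _ _ dk p]) (auto simp: s)
      moreover have "s k (to_sphere z) \<in> finite_part X \<rho>"
      proof -
        have "z \<in> arc_complement k" using outside_subset[of k] k z by auto
        then show ?thesis
          using liftW[OF k, of z] to_sphere_neq_infinity[of z] by (simp add: finite_part_def)
      qed
      ultimately show ?thesis using N[OF k] by simp
    qed
  qed
qed

text \<open>Applied to the eigenvector v, the transition matrices N k act as the scalars by which
  \<open>power_branch\<close> changes, so dividing by it makes the branches fit together. Outside,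
  every branch is compared with the first one along the chain of indices.\<close>

lemma twisted_single_valued_solution:
  assumes a: "\<And>k. k \<in> {1..m} \<Longrightarrow> a k = \<gamma> (t k)"
    and \<Phi>: "\<And>k. k \<in> {1..m} \<Longrightarrow> fundamental_on A (arc_complement k) (\<Phi> k)"
      "\<And>i j z. \<lbrakk>i \<in> {1..m}; j \<in> {1..m}; z \<in> inside (path_image \<gamma>)\<rbrakk> \<Longrightarrow> \<Phi> i z = \<Phi> j z"
      "\<And>k z. \<lbrakk>k \<in> {1..m}; z \<in> outside (path_image \<gamma>)\<rbrakk> \<Longrightarrow> \<Phi> k z = \<Phi> (cyclic_pred m k) z ** N k"
    and v: "\<And>k. k \<in> {1..m} \<Longrightarrow> N k *v v = exp (- 2 * pi * \<i> * \<epsilon> k) *s v"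
    and n: "of_int n = (\<Sum>k=1..m. \<epsilon> k)"
  obtains p where "solves_on A (\<lambda>z. \<Sum>k=1..m. \<epsilon> k / (z - a k)) (- a ` {1..m}) p"
    "\<And>j z. j \<in> {1..m} \<Longrightarrow> z \<in> arc_complement j \<Longrightarrow> \<exists>c. c \<noteq> 0 \<and> p z = c *s (\<Phi> j z *v v)"
proof -
  \<comment> \<open>The reciprocal of a branch of \<Prod> (z - a_k)^\<epsilon>_k: the exponents add
    up to n, so the powers of z - a_1 hidden in \<open>power_branch\<close> are corrected by an
    integral power, which has no branches.\<close>
  define f where "f j z = ((z - \<gamma> (t 1)) powi (- n) / power_branch \<epsilon> j z)" for j z
  define y where "y j z = f j z *s (\<Phi> j z *v v)" for j z
  \<comment> \<open>The choice of j is immaterial by \<open>agree\<close> below.\<close>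
  define p where "p z = y (SOME j. j \<in> {1..m} \<and> z \<in> arc_complement j) z" for z
  have step': "y j z = y (j - 1) z" if "z \<in> outside (path_image \<gamma>)" "2 \<le> j" "j \<le> m" for j z
  proof -
    have "cyclic_pred m j = j - 1" using that by (simp add: cyclic_pred_def)
    then have "\<Phi> j z *v v = exp (- 2 * pi * \<i> * \<epsilon> j) *s (\<Phi> (j - 1) z *v v)"
      using \<Phi>(3)[of j z] v[of j] that
      by (simp add: matrix_vector_mul_assoc[symmetric] vector_scalar_commute)
    moreover have "f j z * exp (- 2 * pi * \<i> * \<epsilon> j) = f (j - 1) z"
      using power_branch_outside[OF that, of \<epsilon>] power_branch_nonzero[of \<epsilon> "j - 1" z] by (simp add: f_def)
    ultimately show ?thesis by (metis vector_smult_assoc y_def)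
  qed
  have out: "y j z = y 1 z" if "z \<in> outside (path_image \<gamma>)" "1 \<le> j" "j \<le> m" for j z
    using that(2,3)
  proof (induction j rule: dec_induct)
    case (step j) then show ?case using step'[OF that(1), of "Suc j"] by auto
  qed simp
  have ins: "y j z = y i z" if "z \<in> inside (path_image \<gamma>)" "i \<in> {1..m}" "j \<in> {1..m}" for i j z
    using \<Phi>(2)[OF that(2,3,1)] power_branch_inside[OF that(1), of \<epsilon> i j] by (simp add: y_def f_def)
  have agree: "y i z = y j z" if "i \<in> {1..m}" "j \<in> {1..m}" "z \<in> arc_complement i" "z \<in> arc_complement j" for i j z
  proof (cases "i = j")
    case False
    then have "z \<in> inside (path_image \<gamma>) \<or> z \<in> outside (path_image \<gamma>)"
      using arc_complement_Int[of i j] that unfolding atLeastAtMost_iff by blast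
    then show ?thesis using out[of z i] out[of z j] ins[of z i j] that by auto
  qed simp
  have p_eq: "p z = y j z" if "j \<in> {1..m}" "z \<in> arc_complement j" for j z
    unfolding p_def using someI[of "\<lambda>j. j \<in> {1..m} \<and> z \<in> arc_complement j" j] that
    by (intro agree) auto
  have solve: "solves_on A (\<lambda>z. \<Sum>k=1..m. \<epsilon> k / (z - a k)) (arc_complement j) p" if j: "j \<in> {1..m}" for j
  proof -
    define \<eta> where "\<eta> z = - (\<Sum>k=2..m. \<epsilon> k * (1 / (z - \<gamma> (t k)) - 1 / (z - \<gamma> (t 1)))) - of_int n / (z - \<gamma> (t 1))" for z
    have "(f j has_field_derivative \<eta> z * f j z) (at z)" if z: "z \<in> arc_complement j" for z
    proof -
      have "z \<noteq> \<gamma> (t 1)" using marked_point_notin[of j 1] j m z by auto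
      then have pw: "((\<lambda>z. (z - \<gamma> (t 1)) powi (- n)) has_field_derivative
          - of_int n / (z - \<gamma> (t 1)) * (z - \<gamma> (t 1)) powi (- n)) (at z)"
        by (auto intro!: derivative_eq_intros simp: power_int_diff field_simps)
      show ?thesis
        unfolding f_def[abs_def]
        by (rule DERIV_cong[OF DERIV_divide[OF pw power_branch_derivative[of j]]])
           (use j z power_branch_nonzero[of \<epsilon> j z] in \<open>auto simp: \<eta>_def field_simps\<close>)
    qed
    then have "solves_on A (\<lambda>z. 0 - \<eta> z) (arc_complement j) (y j)"
      unfolding y_def by (intro solves_on_twist fundamental_on_solves \<Phi>(1) j)
    then show ?thesis
    proof (rule solves_on_cong[OF _ arc_complement_open])
      fix z assume z: "z \<in> arc_complement j"
      show "y j z = p z" using p_eq[OF j z] by simp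
      have eps: "(\<Sum>k=1..m. F k) = F 1 + (\<Sum>k=2..m. F k)" for F :: "nat \<Rightarrow> complex"
        using m by (simp add: sum.atLeast_Suc_atMost numeral_2_eq_2)
      have "(\<Sum>k=1..m. \<epsilon> k / (z - a k)) = (\<Sum>k=1..m. \<epsilon> k / (z - \<gamma> (t k)))"
        using a by (intro sum.cong) auto
      also have "\<dots> = \<epsilon> 1 / (z - \<gamma> (t 1)) + (\<Sum>k=2..m. \<epsilon> k / (z - \<gamma> (t k)))" by (rule eps)
      also have "\<epsilon> 1 = of_int n - (\<Sum>k=2..m. \<epsilon> k)" using n eps[of \<epsilon>] by simp
      finally show "0 - \<eta> z = (\<Sum>k=1..m. \<epsilon> k / (z - a k))"
        by (simp add: \<eta>_def right_diff_distrib sum_subtractf diff_divide_distrib sum_divide_distrib)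
    qed
  qed
  have aimg: "a ` {1..m} = (\<lambda>k. \<gamma> (t k)) ` {1..m}" using a by (intro image_cong) auto
  show thesis
  proof
    show "solves_on A (\<lambda>z. \<Sum>k=1..m. \<epsilon> k / (z - a k)) (- a ` {1..m}) p"
      unfolding aimg arc_complement_cover[symmetric] using solve by (auto simp: solves_on_def)
    fix j z assume jz: "j \<in> {1..m}" "z \<in> arc_complement j"
    then have "z \<noteq> \<gamma> (t 1)" using marked_point_notin[of j 1] m by auto
    then have "f j z \<noteq> 0" using power_branch_nonzero by (simp add: f_def)
    then show "\<exists>c. c \<noteq> 0 \<and> p z = c *s (\<Phi> j z *v v)" using p_eq[OF jz] by (auto simp: y_def)
  qed
qed

text \<open>If A_21 vanishes, the second row of \<Phi> j solves the scalar equation with coefficient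
  A_22, and so does its product with d. The vector d is chosen to annihilate this row at one inside
  point, so it annihilates the row everywhere. By the transition rule both d and N k *v d lie in the
  kernel of the second row of the preceding \<Phi>, which is a line.\<close>

lemma invariant_line_of_triangular_system:
  assumes A: "\<And>z j. j \<in> {1..m} \<Longrightarrow> z \<in> arc_complement j \<Longrightarrow> A z $ 2 $ 1 = 0"
    and \<Phi>: "\<And>k. k \<in> {1..m} \<Longrightarrow> fundamental_on A (arc_complement k) (\<Phi> k)"
      "\<And>i j z. \<lbrakk>i \<in> {1..m}; j \<in> {1..m}; z \<in> inside (path_image \<gamma>)\<rbrakk> \<Longrightarrow> \<Phi> i z = \<Phi> j z"
      "\<And>k z. \<lbrakk>k \<in> {1..m}; z \<in> outside (path_image \<gamma>)\<rbrakk> \<Longrightarrow> \<Phi> k z = \<Phi> (cyclic_pred m k) z ** N k"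
  obtains d where "d \<noteq> 0" "\<And>k. k \<in> {1..m} \<Longrightarrow> \<exists>c. N k *v d = c *s d"
    "\<And>j z. j \<in> {1..m} \<Longrightarrow> z \<in> arc_complement j \<Longrightarrow> (\<Phi> j z *v d) $ 2 = 0"
proof -
  obtain b where b: "b \<in> inside (path_image \<gamma>)" using Jordan_facts by blast
  define d :: "complex^2" where "d = vector [\<Phi> 1 b $ 2 $ 2, - \<Phi> 1 b $ 2 $ 1]"
  have subW: "z \<in> arc_complement j"
    if "j \<in> {1..m}" "z \<in> inside (path_image \<gamma>) \<or> z \<in> outside (path_image \<gamma>)" for j z
    using inside_subset[of j] outside_subset[of j] that unfolding atLeastAtMost_iff by blast
  have rows: "\<Phi> j z $ 2 $ 1 \<noteq> 0 \<or> \<Phi> j z $ 2 $ 2 \<noteq> 0" if "j \<in> {1..m}" "z \<in> arc_complement j" for j z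
    using \<Phi>(1)[OF that(1)] that(2) by (auto simp: fundamental_on_def invertible_det_nz det_2)
  have one: "1 \<in> {1..m}" using m by simp
  have "d \<noteq> 0"
    using rows[OF one, of b] subW[OF one] b by (auto simp: d_def vec_eq_iff forall_2)
  moreover have zero: "(\<Phi> j z *v d) $ 2 = 0" if j: "j \<in> {1..m}" and z: "z \<in> arc_complement j" for j z
  proof -
    let ?W = "arc_complement j"
    define f where "f z = (\<Phi> j z *v d) $ 2" for z
    have Dr: "((\<lambda>z. \<Phi> j z $ 2 $ i) has_field_derivative A z $ 2 $ 2 * \<Phi> j z $ 2 $ i) (at z)"
      if "z \<in> ?W" for z i
    proof -
      have "((\<lambda>z. \<Phi> j z $ 2 $ i) has_field_derivative (A z ** \<Phi> j z) $ 2 $ i) (at z)"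
        using \<Phi>(1)[OF j] that unfolding fundamental_on_def by blast
      then show ?thesis by (simp add: matrix_matrix_mult_2 A[OF j that])
    qed
    have Df: "(f has_field_derivative A z $ 2 $ 2 * f z) (at z)" if "z \<in> ?W" for z
      using that unfolding f_def[abs_def] matrix_vector_mult_2
      by (auto intro!: derivative_eq_intros Dr simp: algebra_simps)
    have cf: "continuous_on ?W f" using Df DERIV_isCont continuous_at_imp_continuous_on by blast
    define E where "E = {z \<in> ?W. f z = 0}"
    have "open E"
    proof (rule openI)
      fix w assume "w \<in> E"
      then have w: "w \<in> ?W" "f w = 0" by (auto simp: E_def)
      \<comment> \<open>An entry of the row that is nonzero at w serves as the comparison solution
        near w; which entry it is may depend on w, hence the open-closed argument for E.\<close>
      obtain i where i: "\<Phi> j w $ 2 $ i \<noteq> 0" using rows[OF j w(1)] by blast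
      have "isCont (\<lambda>z. \<Phi> j z $ 2 $ i) w" using Dr[OF w(1)] DERIV_isCont by blast
      then obtain e1 where e1: "e1 > 0" "\<And>z. dist w z < e1 \<Longrightarrow> \<Phi> j z $ 2 $ i \<noteq> 0"
        using continuous_at_avoid[of w "\<lambda>z. \<Phi> j z $ 2 $ i" 0] i by auto
      obtain e2 where e2: "e2 > 0" "ball w e2 \<subseteq> ?W" using arc_complement_open w(1) openE by blast
      define e where "e = min e1 e2"
      have e: "e > 0" "ball w e \<subseteq> ?W" "\<And>z. z \<in> ball w e \<Longrightarrow> \<Phi> j z $ 2 $ i \<noteq> 0"
        using e1 e2 by (auto simp: e_def)
      obtain c where c: "\<forall>z\<in>ball w e. f z = c * \<Phi> j z $ 2 $ i"
        using scalar_multiple_of_solution[OF open_ball[of w e] connected_ball,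
            where f = f and g = "\<lambda>z. \<Phi> j z $ 2 $ i" and \<alpha> = "\<lambda>z. A z $ 2 $ 2"] Df Dr e by blast
      then have "c = 0" using w(2) i e(1) by (metis centre_in_ball mult_eq_0_iff)
      then have "ball w e \<subseteq> E" using c e(2) by (auto simp: E_def)
      then show "\<exists>e>0. ball w e \<subseteq> E" using e(1) by blast
    qed
    then have "openin (top_of_set ?W) E" by (metis E_def mem_Collect_eq openin_open_eq arc_complement_open subsetI)
    moreover have "closedin (top_of_set ?W) E"
      using continuous_closedin_preimage_constant[OF cf, of 0] by (simp add: E_def)
    moreover have "b \<in> E"
    proof -
      have "\<Phi> j b = \<Phi> 1 b" using \<Phi>(2) j one b by blast
      then have "f b = 0" by (simp add: f_def matrix_vector_mult_2 d_def)
      then show ?thesis using subW[OF j] b by (auto simp: E_def)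
    qed
    moreover have "connected ?W" using arc_complement_connected j by simp
    ultimately have "E = ?W" using connected_clopen by blast
    then show ?thesis using z by (auto simp: E_def f_def)
  qed
  moreover have "\<exists>c. N k *v d = c *s d" if k: "k \<in> {1..m}" for k
  proof -
    obtain z where z: "z \<in> outside (path_image \<gamma>)" using Jordan_facts by blast
    let ?l = "cyclic_pred m k"
    have l: "?l \<in> {1..m}" using cyclic_pred_range k by simp
    have zW: "z \<in> arc_complement k" "z \<in> arc_complement ?l" using subW[OF k] subW[OF l] z by auto
    have "invertible (\<Phi> ?l z)" using \<Phi>(1)[OF l] zW by (auto simp: fundamental_on_def)
    moreover have "(\<Phi> ?l z *v (N k *v d)) $ 2 = 0"
      using \<Phi>(3)[OF k z] zero[OF k zW(1)] by (simp add: matrix_vector_mul_assoc)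
    ultimately show ?thesis
      using vanishing_component_parallel zero[OF l zW(2)] \<open>d \<noteq> 0\<close> by blast
  qed
  ultimately show thesis using that by blast
qed

end

subsection \<open>Local solutions at the singularities\<close>

lemma matrix_power_scale:
  fixes E :: "complex^2^2"
  shows "matrix_power (scale_matrix w E) k = scale_matrix (w ^ k) (matrix_power E k)"
  by (induction k) (simp_all add: vec_eq_iff scale_matrix_def matrix_matrix_mult_2 algebra_simps)

text \<open>The factor 2 counts the summands in an entry of a product of matrices of size 2.\<close>

lemma matrix_power_bound:
  fixes E :: "complex^2^2"
  assumes "\<And>i j. cmod (E $ i $ j) \<le> B"
  shows "cmod (matrix_power E k $ i $ j) \<le> (2 * B) ^ k"
proof (induction k arbitrary: i j)
  case 0
  then show ?case by (simp add: mat_def)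
next
  case (Suc k)
  have B: "B \<ge> 0" using assms norm_ge_zero order_trans by blast
  have "cmod (matrix_power E (Suc k) $ i $ j) \<le>
      cmod (E $ i $ 1) * cmod (matrix_power E k $ 1 $ j) + cmod (E $ i $ 2) * cmod (matrix_power E k $ 2 $ j)"
    by (simp add: matrix_matrix_mult_2 norm_triangle_le norm_mult)
  also have "\<dots> \<le> B * (2 * B) ^ k + B * (2 * B) ^ k"
    using Suc assms B by (intro add_mono mult_mono) auto
  also have "\<dots> = (2 * B) ^ Suc k" by simp
  finally show ?case .
qed

text \<open>Componentwise the exponential is a scalar power series in w, which allows termwise
  differentiation.\<close>

lemma matrix_exp_sums:
  fixes E :: "complex^2^2"
  shows "(\<lambda>k. matrix_power E k $ i $ j / fact k * w ^ k) sums (matrix_exp (scale_matrix w E) $ i $ j)"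
proof -
  define B where "B = (\<Sum>i\<in>UNIV. \<Sum>j\<in>UNIV. cmod (E $ i $ j))"
  have B: "cmod (E $ i $ j) \<le> B" for i j
    using exhaust_2[of i] exhaust_2[of j] by (auto simp: B_def sum_2)
  define F where "F = (\<chi> i j. \<Sum>k. matrix_power E k $ i $ j / fact k * w ^ k)"
  have sm: "summable (\<lambda>k. matrix_power E k $ i $ j / fact k * w ^ k)" for i j
  proof (rule summable_comparison_test')
    show "summable (\<lambda>k. inverse (fact k) * (2 * B * cmod w) ^ k)" by (rule summable_exp)
    show "norm (matrix_power E k $ i $ j / fact k * w ^ k) \<le> inverse (fact k) * (2 * B * cmod w) ^ k"
      if "k \<ge> 0" for k
    proof -
      have "cmod (matrix_power E k $ i $ j) * cmod w ^ k / fact k \<le> (2 * B) ^ k * cmod w ^ k / fact k"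
        using matrix_power_bound[OF B, of k i j] by (intro divide_right_mono mult_right_mono) auto
      moreover have "norm (matrix_power E k $ i $ j / fact k * w ^ k) =
          cmod (matrix_power E k $ i $ j) * cmod w ^ k / fact k"
        by (simp add: norm_mult norm_divide norm_power)
      moreover have "(2 * B) ^ k * cmod w ^ k / fact k = inverse (fact k) * (2 * B * cmod w) ^ k"
        by (simp add: power_mult_distrib divide_inverse mult_ac)
      ultimately show ?thesis by simp
    qed
  qed
  then have S: "(\<lambda>k. matrix_power E k $ i $ j / fact k * w ^ k) sums (F $ i $ j)" for i j
    by (simp add: F_def summable_sums)
  have "(\<lambda>k. (1 / fact k) *\<^sub>R matrix_power (scale_matrix w E) k) sums F"
    unfolding sums_def
  proof (intro vec_tendstoI)
    fix i j
    have "(\<Sum>k<n. (1 / fact k) *\<^sub>R matrix_power (scale_matrix w E) k) $ i $ j =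
        (\<Sum>k<n. matrix_power E k $ i $ j / fact k * w ^ k)" for n
      by (simp add: matrix_power_scale, simp add: scale_matrix_def, simp add: scaleR_conv_of_real mult.commute)
    then show "(\<lambda>n. (\<Sum>k<n. (1 / fact k) *\<^sub>R matrix_power (scale_matrix w E) k) $ i $ j) \<longlonglongrightarrow> F $ i $ j"
      using S[of i j] by (simp add: sums_def)
  qed
  then have "matrix_exp (scale_matrix w E) = F" unfolding matrix_exp_def by (rule sums_unique[symmetric])
  then show ?thesis using S by simp
qed

lemma matrix_exp_derivative:
  fixes E :: "complex^2^2"
  shows "((\<lambda>w. matrix_exp (scale_matrix w E) $ i $ j) has_field_derivative
    (E ** matrix_exp (scale_matrix w E)) $ i $ j) (at w)"
proof -
  define c where "c k = matrix_power E k $ i $ j / fact k" for k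
  have f: "matrix_exp (scale_matrix w E) $ i $ j = (\<Sum>k. c k * w ^ k)" for w
    using matrix_exp_sums[of E i j w] by (simp add: c_def sums_iff)
  have "diffs c k * w ^ k = E $ i $ 1 * (matrix_power E k $ 1 $ j / fact k * w ^ k) +
      E $ i $ 2 * (matrix_power E k $ 2 $ j / fact k * w ^ k)" for k
  proof -
    have "(of_nat (Suc k) :: complex) \<noteq> 0" using of_nat_neq_0 by blast
    then have "diffs c k = matrix_power E (Suc k) $ i $ j / fact k"
      by (simp only: diffs_def c_def fact_Suc of_nat_mult of_nat_fact) (simp del: of_nat_Suc matrix_power.simps)
    then show ?thesis by (simp add: matrix_matrix_mult_2 add_divide_distrib distrib_right mult.assoc)
  qed
  moreover have "(\<lambda>k. E $ i $ 1 * (matrix_power E k $ 1 $ j / fact k * w ^ k) +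
      E $ i $ 2 * (matrix_power E k $ 2 $ j / fact k * w ^ k)) sums
      ((E ** matrix_exp (scale_matrix w E)) $ i $ j)"
    unfolding matrix_matrix_mult_2 by (intro sums_add sums_mult matrix_exp_sums)
  ultimately have "(\<Sum>k. diffs c k * w ^ k) = (E ** matrix_exp (scale_matrix w E)) $ i $ j"
    by (simp add: sums_iff)
  moreover have "((\<lambda>w. \<Sum>k. c k * w ^ k) has_field_derivative (\<Sum>k. diffs c k * w ^ k)) (at w)"
    using matrix_exp_sums[of E i j] by (intro termdiffs_strong_converges_everywhere) (simp add: c_def sums_iff)
  ultimately show ?thesis unfolding f by simp
qed

text \<open>Since exp (s (a + exp x)) = exp x, the two arguments differ by a multiple of 2\<pi>\<i>.
  The difference is continuous and vanishes at w, hence it is zero nearby.\<close>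

lemma exp_section_inverse:
  fixes a w :: complex
  assumes s: "open V" "continuous_on V s" "a + exp w \<in> V"
    and inv: "\<And>z. z \<in> V \<Longrightarrow> a + exp (s z) = z" "s (a + exp w) = w"
  shows "\<forall>\<^sub>F x in nhds w. s (a + exp x) = x"
proof -
  have "((\<lambda>w. a + exp w) has_field_derivative exp w) (at w)"
    by (auto intro!: derivative_eq_intros)
  then have c: "isCont (\<lambda>x. a + exp x) w" by (rule DERIV_isCont)
  have "isCont s (a + exp w)" using s by (simp add: continuous_on_eq_continuous_at)
  then have "isCont (\<lambda>x. s (a + exp x)) w" using isCont_o2[OF c] by blast
  moreover define g where "g = (\<lambda>x. s (a + exp x) - x)"
  ultimately have "isCont g w" using continuous_diff[OF _ continuous_ident] by blast
  then have "(g \<longlongrightarrow> g w) (nhds w)" unfolding isCont_def tendsto_at_iff_tendsto_nhds .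
  then have "\<forall>\<^sub>F x in nhds w. dist (g x) (g w) < pi" using pi_gt_zero by (rule tendstoD)
  then have "\<forall>\<^sub>F x in nhds w. dist (s (a + exp x) - x) 0 < pi"
    using inv(2) by (simp add: g_def)
  moreover have "\<forall>\<^sub>F x in nhds w. a + exp x \<in> V"
  proof -
    have "open ((\<lambda>x. a + exp x) -` V)" by (intro open_vimage s continuous_intros)
    then show ?thesis using s(3) eventually_nhds_in_open[of "(\<lambda>x. a + exp x) -` V" w] by simp
  qed
  ultimately show ?thesis
  proof eventually_elim
    case (elim x)
    have "\<bar>Im (s (a + exp x)) - Im x\<bar> < 2 * pi"
      using elim(1) abs_Im_le_cmod[of "s (a + exp x) - x"] pi_gt_zero by (simp add: dist_norm)
    moreover have "exp (s (a + exp x)) = exp x" using inv(1)[OF elim(2)] by (rule add_left_imp_eq)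
    ultimately show ?case by (rule exp_complex_eqI)
  qed
qed

text \<open>The solution Z (a + exp w) ** exp (w E) is differentiated once by the system and once by
  the product rule, and the exponential is cancelled. The resulting equation for Z lives on the
  punctured disc itself, and later arguments use the local form through it alone.\<close>

lemma local_form_equation:
  fixes E :: "complex^2^2"
  assumes "local_form_at m a k E A"
  obtains \<delta> Z where "\<delta> > 0" "\<And>j. j \<in> {1..m} \<Longrightarrow> j \<noteq> k \<Longrightarrow> a j \<notin> ball (a k) \<delta>"
    "\<And>i j. (\<lambda>z. Z z $ i $ j) holomorphic_on ball (a k) \<delta>"
    "\<And>z. z \<in> ball (a k) \<delta> \<Longrightarrow> invertible (Z z)"
    "\<And>z i j. z \<in> ball (a k) \<delta> - {a k} \<Longrightarrow>
       (z - a k) * (A z ** Z z) $ i $ j = (z - a k) * deriv (\<lambda>z. Z z $ i $ j) z + (Z z ** E) $ i $ j"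
proof -
  obtain \<delta> Z where \<delta>: "\<delta> > 0" "\<forall>j\<in>{1..m}. j \<noteq> k \<longrightarrow> a j \<notin> ball (a k) \<delta>"
    and Z: "analytic_matrix_on Z (ball (a k) \<delta>)" "\<forall>z\<in>ball (a k) \<delta>. invertible (Z z)"
    and sol: "\<And>Y. solution_on A {w. Re w < ln \<delta>} (\<lambda>w. a k + exp w) Y \<longleftrightarrow>
           (\<exists>C. invertible C \<and>
              (\<forall>w. Re w < ln \<delta> \<longrightarrow> Y w = Z (a k + exp w) ** matrix_exp (scale_matrix w E) ** C))"
    using assms unfolding local_form_at_def by blast
  let ?B = "ball (a k) \<delta>"
  define G where "G w = matrix_exp (scale_matrix w E)" for w
  define Y where "Y w = Z (a k + exp w) ** G w" for w
  have "invertible (mat 1 :: complex^2^2)" by (simp add: invertible_det_nz)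
  then have Y: "solution_on A {w. Re w < ln \<delta>} (\<lambda>w. a k + exp w) Y"
    unfolding sol by (intro exI[of _ "mat 1"]) (simp add: Y_def G_def)
  have Zh: "(\<lambda>z. Z z $ i $ j) holomorphic_on ?B" for i j
    using Z(1) by (auto simp: analytic_matrix_on_def analytic_imp_holomorphic)
  have DZ: "((\<lambda>z. Z z $ i $ j) has_field_derivative deriv (\<lambda>z. Z z $ i $ j) z) (at z)" if "z \<in> ?B" for z i j
    using holomorphic_derivI[OF Zh open_ball that] .
  show thesis
  proof
    fix z i j assume z: "z \<in> ?B - {a k}"
    obtain w where w: "Re w < ln \<delta>" "z = a k + exp w" using half_plane_surj[OF z \<delta>(1)] by blast
    have wm: "w \<in> {w. Re w < ln \<delta>}" using w by simp
    define Z' where "Z' = (\<chi> i j. deriv (\<lambda>z. Z z $ i $ j) z)"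
    obtain V s where inv: "invertible (Y w)"
      and V: "open V" "z \<in> V" "continuous_on V s" "\<And>z. z \<in> V \<Longrightarrow> a k + exp (s z) = z" "s z = w"
      and D: "\<And>i j. ((\<lambda>z. Y (s z) $ i $ j) has_field_derivative (A z ** Y w) $ i $ j) (at z)"
      using Y[unfolded solution_on_def, rule_format, OF wm] unfolding w(2)[symmetric] by auto
    have near: "\<forall>\<^sub>F x in nhds w. s (a k + exp x) = x"
      using exp_section_inverse[of V s "a k" w] V w(2) by auto
    have e: "((\<lambda>w. a k + exp w) has_field_derivative exp w) (at w)"
      by (auto intro!: derivative_eq_intros)
    have D1': "((\<lambda>x. Y (s (a k + exp x)) $ i $ j) has_field_derivative (A z ** Y w) $ i $ j * exp w) (at w)" for i j
      using DERIV_chain2[OF _ e, of "\<lambda>z. Y (s z) $ i $ j"] D w(2) by simp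
    have near': "\<forall>\<^sub>F x in nhds w. Y x $ i $ j = Y (s (a k + exp x)) $ i $ j" for i j
      using near by eventually_elim simp
    have D1: "((\<lambda>x. Y x $ i $ j) has_field_derivative (A z ** Y w) $ i $ j * exp w) (at w)" for i j
      by (rule DERIV_cong_ev[THEN iffD2, OF refl near' refl D1'])
    have dz: "((\<lambda>x. Z (a k + exp x) $ i $ j) has_field_derivative Z' $ i $ j * exp w) (at w)" for i j
      using DERIV_chain2[OF _ e, of "\<lambda>z. Z z $ i $ j"] DZ[of z i j] z w(2) by (simp add: Z'_def)
    have dG: "((\<lambda>x. G x $ i $ j) has_field_derivative (E ** G w) $ i $ j) (at w)" for i j
      using matrix_exp_derivative[of E i j w] by (simp add: G_def)
    have D2: "((\<lambda>x. Y x $ i $ j) has_field_derivative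
        exp w * (Z' ** G w) $ i $ j + (Z z ** (E ** G w)) $ i $ j) (at w)" for i j
      unfolding Y_def matrix_matrix_mult_2[of "Z _"]
      by (rule DERIV_cong[OF DERIV_add[OF DERIV_mult[OF dz dG] DERIV_mult[OF dz dG]]])
         (simp add: w(2) matrix_matrix_mult_2 algebra_simps)
    have eq: "(A z ** Y w) $ i $ j * exp w = exp w * (Z' ** G w) $ i $ j + (Z z ** (E ** G w)) $ i $ j" for i j
      by (rule DERIV_unique[OF D1 D2])
    \<comment> \<open>The two sides of the claim; \<open>eq\<close> says that they agree after
      multiplication by the invertible G w.\<close>
    define L where "L = (\<chi> i j. (z - a k) * (A z ** Z z) $ i $ j)"
    define R where "R = (\<chi> i j. (z - a k) * Z' $ i $ j + (Z z ** E) $ i $ j)"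
    have "L ** G w = R ** G w"
      using eq w(2) by (simp add: vec_eq_iff L_def R_def Y_def matrix_matrix_mult_2 algebra_simps)
    moreover obtain H where "G w ** H = mat 1"
      using inv unfolding Y_def by (metis det_mul invertible_def invertible_det_nz mult_eq_0_iff)
    ultimately have "L = R" by (metis matrix_mul_assoc matrix_mul_rid)
    then have "L $ i $ j = R $ i $ j" by simp
    then show "(z - a k) * (A z ** Z z) $ i $ j =
        (z - a k) * deriv (\<lambda>z. Z z $ i $ j) z + (Z z ** E) $ i $ j"
      by (simp add: L_def R_def Z'_def)
  qed (use \<delta> Z Zh in auto)
qed

section \<open>Extension of single-valued solutions across a singularity\<close>

lemma eigenvalues_trace_det:
  assumes "has_eigenvalues E e1 e2"
  shows "E $ 1 $ 1 + E $ 2 $ 2 = e1 + e2" "E $ 1 $ 1 * E $ 2 $ 2 - E $ 1 $ 2 * E $ 2 $ 1 = e1 * e2"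
proof -
  have "(x - E $ 1 $ 1) * (x - E $ 2 $ 2) - E $ 1 $ 2 * E $ 2 $ 1 = (x - e1) * (x - e2)" for x
    using assms by (simp add: has_eigenvalues_def det_2 mat_def)
  from this[of 0] this[of 1] show "E $ 1 $ 1 + E $ 2 $ 2 = e1 + e2"
    "E $ 1 $ 1 * E $ 2 $ 2 - E $ 1 $ 2 * E $ 2 $ 1 = e1 * e2"
    by (auto simp: algebra_simps)
qed

lemma has_eigenvalues_imp_is_eigenvalue:
  assumes "has_eigenvalues E e1 e2"
  shows "is_eigenvalue E e1" "is_eigenvalue E e2"
proof -
  have "is_eigenvalue E x" if "det (mat x - E) = 0" for x
  proof -
    have "\<not> invertible (mat x - E)" using that by (simp add: invertible_det_nz)
    then obtain v where v: "(mat x - E) *v v = 0" "v \<noteq> 0"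
      by (metis invertible_left_inverse matrix_left_invertible_ker)
    then have "E *v v = x *s v"
      by (simp add: vec_eq_iff forall_2 matrix_vector_mult_2 mat_def algebra_simps)
    then show ?thesis using v(2) by (auto simp: is_eigenvalue_def)
  qed
  then show "is_eigenvalue E e1" "is_eigenvalue E e2" using assms by (auto simp: has_eigenvalues_def)
qed

lemma invertible_vector_cancel:
  fixes A :: "complex^'n^'n"
  assumes "invertible A" "A *v x = A *v y"
  shows "x = y"
proof -
  obtain H where H: "H ** A = mat 1" using assms(1) unfolding invertible_def by blast
  have "H *v (A *v x) = H *v (A *v y)" using assms(2) by simp
  then show ?thesis unfolding matrix_vector_mul_assoc H by simp
qed

text \<open>The factor u removes the regular part of \<theta>, and the substitution u p = Z r leads
  to (z - a) r' = B r with B = E - \<epsilon>. By the Cayley-Hamilton identity B r solves a scalar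
  equation with exponent l = \<epsilon>' - \<epsilon>; single-valuedness and non-resonance make it a
  constant, and nonzero constants are excluded, for l = 0 because r would contain a logarithm. Thus
  B r = 0, so r is constant and p is a holomorphic invertible factor applied to a constant vector,
  nonzero because p is nonzero somewhere.\<close>

lemma regular_extension:
  assumes \<delta>: "\<delta> > 0"
    and Z: "\<And>i j. (\<lambda>z. Z z $ i $ j) holomorphic_on ball a \<delta>"
      "\<And>z. z \<in> ball a \<delta> \<Longrightarrow> invertible (Z z)"
      "\<And>z i j. z \<in> ball a \<delta> - {a} \<Longrightarrow>
        (z - a) * (A z ** Z z) $ i $ j = (z - a) * deriv (\<lambda>z. Z z $ i $ j) z + (Z z ** E) $ i $ j"
    and E: "has_eigenvalues E \<epsilon> \<epsilon>'" "non_resonant E"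
    and p: "solves_on A \<theta> (ball a \<delta> - {a}) p"
    and \<theta>: "\<And>z. z \<in> ball a \<delta> - {a} \<Longrightarrow> \<theta> z = \<epsilon> / (z - a) + \<phi> z" "\<phi> holomorphic_on ball a \<delta>"
    and nz: "z0 \<in> ball a \<delta> - {a}" "p z0 \<noteq> 0"
  obtains P where "\<And>i. (\<lambda>z. P z $ i) holomorphic_on ball a \<delta>"
    "\<And>z. z \<in> ball a \<delta> - {a} \<Longrightarrow> P z = p z"
    "P a \<noteq> 0"
proof -
  let ?B = "ball a \<delta>"
  obtain \<Phi> where \<Phi>: "\<And>z. z \<in> ?B \<Longrightarrow> (\<Phi> has_field_derivative \<phi> z) (at z)"
    using holomorphic_convex_primitive'[OF convex_ball open_ball \<theta>(2)]
    by (metis at_within_open open_ball)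
  define u where "u z = exp (\<Phi> z)" for z
  have u: "(u has_field_derivative \<phi> z * u z) (at z)" if "z \<in> ?B" for z
    unfolding u_def[abs_def] using \<Phi>[OF that] by (auto intro!: derivative_eq_intros)
  define q where "q z = u z *s p z" for z
  have "solves_on A (\<lambda>z. \<theta> z - \<phi> z) (?B - {a}) q"
    unfolding q_def using u by (intro solves_on_twist p) auto
  then have q: "((\<lambda>z. q z $ i) has_field_derivative (A z *v q z) $ i - \<epsilon> / (z - a) * q z $ i) (at z)"
    if "z \<in> ?B - {a}" for z i
  proof -
    have "\<theta> z - \<phi> z = \<epsilon> / (z - a)" using \<theta>(1)[OF that] by simp
    then show ?thesis using \<open>solves_on A (\<lambda>z. \<theta> z - \<phi> z) (?B - {a}) q\<close> that
      unfolding solves_on_def by metis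
  qed
  define D where "D z = Z z $ 1 $ 1 * Z z $ 2 $ 2 - Z z $ 1 $ 2 * Z z $ 2 $ 1" for z
  have D: "D z \<noteq> 0" if "z \<in> ?B" for z
    using Z(2)[OF that] by (simp add: D_def invertible_det_nz det_2)
  define r :: "complex \<Rightarrow> complex^2" where "r z = vector [(q z $ 1 * Z z $ 2 $ 2 - Z z $ 1 $ 2 * q z $ 2) / D z,
      (Z z $ 1 $ 1 * q z $ 2 - q z $ 1 * Z z $ 2 $ 1) / D z]" for z
  have Zr: "Z z *v r z = q z" if "z \<in> ?B" for z
  proof -
    have "D z * (Z z *v r z) $ i = D z * q z $ i" for i
      using D[OF that] exhaust_2[of i]
      by (auto simp: matrix_vector_mult_2 r_def distrib_left) (simp_all add: D_def algebra_simps)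
    then show ?thesis using D[OF that] by (simp add: vec_eq_iff)
  qed
  have DZ: "((\<lambda>z. Z z $ i $ j) has_field_derivative deriv (\<lambda>z. Z z $ i $ j) z) (at z)" if "z \<in> ?B" for z i j
    using holomorphic_derivI[OF Z(1) open_ball that] .
  have fd: "(\<lambda>z. Z z $ i $ j) field_differentiable (at z)" "(\<lambda>z. q z $ i) field_differentiable (at z)"
    if "z \<in> ?B - {a}" for z i j
    using DZ[of z i j] q[OF that, of i] that by (auto simp: field_differentiable_def)
  have r_fd: "(\<lambda>z. r z $ i) field_differentiable (at z)" if z: "z \<in> ?B - {a}" for z i
  proof -
    have "D z \<noteq> 0" using D z by blast
    then show ?thesis
      using exhaust_2[of i] unfolding r_def[abs_def] D_def[abs_def]
      by (auto simp: D_def intro!: derivative_intros fd z field_differentiable_diff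
          field_differentiable_mult field_differentiable_divide)
  qed
  define B where "B = E - mat \<epsilon>"
  have r: "((\<lambda>z. r z $ i) has_field_derivative (B *v r z) $ i / (z - a)) (at z)"
    if z: "z \<in> ?B - {a}" for z i
  proof -
    define r' :: "complex^2" where "r' = (\<chi> i. deriv (\<lambda>z. r z $ i) z)"
    have Dr: "((\<lambda>z. r z $ i) has_field_derivative r' $ i) (at z)" for i
      using r_fd[OF z] by (simp add: r'_def field_differentiable_derivI)
    have zB: "z \<in> ?B" "z \<noteq> a" using z by auto
    define Z' where "Z' = (\<chi> i j. deriv (\<lambda>z. Z z $ i $ j) z)"
    have DZ': "((\<lambda>z. Z z $ i $ j) has_field_derivative Z' $ i $ j) (at z)" for i j
      using DZ[OF zB(1)] by (simp add: Z'_def)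
    have "((\<lambda>z. (Z z *v r z) $ i) has_field_derivative (Z' *v r z) $ i + (Z z *v r') $ i) (at z)" for i
      unfolding matrix_vector_mult_2
      by (rule DERIV_cong[OF DERIV_add[OF DERIV_mult[OF DZ' Dr] DERIV_mult[OF DZ' Dr]]])
         (simp add: algebra_simps)
    moreover have "((\<lambda>z. (Z z *v r z) $ i) has_field_derivative (A z *v q z) $ i - \<epsilon> / (z - a) * q z $ i) (at z)" for i
      by (rule has_field_derivative_transform_within_open[OF q[OF z] open_ball zB(1)]) (simp add: Zr)
    ultimately have eq: "(Z' *v r z) $ i + (Z z *v r') $ i = (A z *v q z) $ i - \<epsilon> / (z - a) * q z $ i" for i
      using DERIV_unique by blast
    have "Z z *v ((z - a) *s r') = Z z *v (B *v r z)"
    proof -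
      have "(z - a) * (Z z *v r') $ i = (Z z *v (B *v r z)) $ i" for i
      proof -
        have "(z - a) * (Z z *v r') $ i = (z - a) * (A z *v q z) $ i - \<epsilon> * q z $ i - (z - a) * (Z' *v r z) $ i"
        proof -
          have "(Z z *v r') $ i = (A z *v q z) $ i - \<epsilon> / (z - a) * q z $ i - (Z' *v r z) $ i"
            using eq[of i] by (simp add: algebra_simps)
          moreover have "(z - a) * (\<epsilon> / (z - a) * q z $ i) = \<epsilon> * q z $ i" using zB(2) by simp
          ultimately show ?thesis by (simp only: right_diff_distrib)
        qed
        also have "(z - a) * (A z *v q z) $ i = (z - a) * (A z ** Z z) $ i $ 1 * r z $ 1 + (z - a) * (A z ** Z z) $ i $ 2 * r z $ 2"
          unfolding Zr[OF zB(1), symmetric] by (simp add: matrix_vector_mult_2 matrix_matrix_mult_2 algebra_simps)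
        also have "\<dots> = (z - a) * (Z' *v r z) $ i + (Z z *v (E *v r z)) $ i"
          unfolding Z(3)[OF z] by (simp add: matrix_vector_mult_2 matrix_matrix_mult_2 Z'_def algebra_simps)
        finally show ?thesis
          unfolding Zr[OF zB(1), symmetric] B_def
          using exhaust_2[of i] by (auto simp: matrix_vector_mult_2 mat_def algebra_simps)
      qed
      then show ?thesis by (simp add: vec_eq_iff matrix_vector_mult_2 algebra_simps)
    qed
    then have "(z - a) *s r' = B *v r z"
      by (rule invertible_vector_cancel[OF Z(2)[OF zB(1)]])
    then have "(z - a) * r' $ i = (B *v r z) $ i" by (metis vector_smult_component)
    then have "r' $ i = (B *v r z) $ i / (z - a)" using zB(2) by (simp add: eq_divide_eq mult.commute)
    then show ?thesis using Dr[of i] by simp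
  qed
  define l where "l = \<epsilon>' - \<epsilon>"
  have l: "l \<notin> \<int> \<or> l = 0"
    using E(2) has_eigenvalues_imp_is_eigenvalue[OF E(1)] by (auto simp: non_resonant_def l_def)
  \<comment> \<open>Cayley-Hamilton for B, whose eigenvalues are 0 and l.\<close>
  have BB: "(B *v (B *v x)) $ i = l * (B *v x) $ i" for x i
  proof -
    note e = eigenvalues_trace_det[OF E(1)]
    have e': "\<epsilon>' = E $ 1 $ 1 + E $ 2 $ 2 - \<epsilon>" using e(1) by simp
    have e2: "E $ 1 $ 2 * E $ 2 $ 1 = E $ 1 $ 1 * E $ 2 $ 2 - \<epsilon> * (E $ 1 $ 1 + E $ 2 $ 2 - \<epsilon>)"
      using e(2) e' by (simp add: algebra_simps)
    have b: "B $ 1 $ 2 * B $ 2 $ 1 = B $ 1 $ 1 * B $ 2 $ 2" "l = B $ 1 $ 1 + B $ 2 $ 2"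
      using e2 by (auto simp: B_def mat_def l_def e' algebra_simps)
    have "B $ 1 $ 1 * (B $ 1 $ 1 * x1 + B $ 1 $ 2 * x2) + B $ 1 $ 2 * (B $ 2 $ 1 * x1 + B $ 2 $ 2 * x2) =
        (B $ 1 $ 1 + B $ 2 $ 2) * (B $ 1 $ 1 * x1 + B $ 1 $ 2 * x2)"
      "B $ 2 $ 1 * (B $ 1 $ 1 * x1 + B $ 1 $ 2 * x2) + B $ 2 $ 2 * (B $ 2 $ 1 * x1 + B $ 2 $ 2 * x2) =
        (B $ 1 $ 1 + B $ 2 $ 2) * (B $ 2 $ 1 * x1 + B $ 2 $ 2 * x2)" for x1 x2
      using b(1) by algebra+
    then show ?thesis
      using exhaust_2[of i] unfolding matrix_vector_mult_2 b(2) by auto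
  qed
  have s0: "(B *v r z) $ i = 0" if z: "z \<in> ?B - {a}" for z i
  proof -
    have ds: "((\<lambda>z. (B *v r z) $ j) has_field_derivative l * (B *v r z) $ j / (z - a)) (at z)"
      if "z \<in> ?B - {a}" for z j
    proof -
      have "((\<lambda>z. B $ j $ 1 * r z $ 1 + B $ j $ 2 * r z $ 2) has_field_derivative
          B $ j $ 1 * ((B *v r z) $ 1 / (z - a)) + B $ j $ 2 * ((B *v r z) $ 2 / (z - a))) (at z)"
        by (intro DERIV_add DERIV_cmult r that)
      moreover have "B $ j $ 1 * ((B *v r z) $ 1 / (z - a)) + B $ j $ 2 * ((B *v r z) $ 2 / (z - a)) =
          l * (B *v r z) $ j / (z - a)"
        unfolding BB[symmetric] matrix_vector_mult_2[of B "B *v r z"] by (simp add: add_divide_distrib)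
      ultimately show ?thesis unfolding matrix_vector_mult_2[of B "r _" j] by simp
    qed
    obtain c where c: "\<forall>z\<in>?B - {a}. (B *v r z) $ i = c" "l * c = 0"
      using single_valued_power_solution[OF \<delta> l ds] by blast
    have "c = 0"
    \<comment> \<open>For l = 0 the equation l * c = 0 gives nothing; here r' = c / (z - a), and a
      nonzero c would produce a logarithm.\<close>
    proof (cases "l = 0")
      case True
      have "((\<lambda>z. r z $ i) has_field_derivative c / (z - a)) (at z)" if "z \<in> ?B - {a}" for z
      proof -
        have "(B *v r z) $ i = c" using c(1) that by blast
        then show ?thesis using r[OF that, of i] by simp
      qed
      then show ?thesis by (rule single_valued_log_solution[OF \<delta>])
    qed (use c in auto)
    then show ?thesis using c z by blast
  qed
  \<comment> \<open>The derivative zero is written with the factor 0 so that the power lemma applies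
    with exponent 0 and yields a constant on the punctured disc.\<close>
  have r0: "((\<lambda>z. r z $ i) has_field_derivative 0 * r z $ i / (z - a)) (at z)" if "z \<in> ?B - {a}" for z i
    using r[OF that, of i] s0[OF that, of i] by simp
  have "\<exists>c. \<forall>z\<in>?B - {a}. r z $ i = c" for i
    using single_valued_power_solution[OF \<delta> _ r0] by blast
  then obtain c where c: "\<And>i z. z \<in> ?B - {a} \<Longrightarrow> r z $ i = c i" by metis
  define C :: "complex^2" where "C = (\<chi> i. c i)"
  have rC: "r z = C" if "z \<in> ?B - {a}" for z using c[OF that] by (simp add: C_def vec_eq_iff)
  define P where "P z = inverse (u z) *s (Z z *v C)" for z
  have uh: "u holomorphic_on ?B" using u holomorphic_on_open open_ball by blast
  have unz: "u z \<noteq> 0" for z by (simp add: u_def)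
  show thesis
  proof
    show "(\<lambda>z. P z $ i) holomorphic_on ?B" for i
      unfolding P_def vector_smult_component matrix_vector_mult_2
      using unz by (intro holomorphic_intros uh Z(1)) auto
    show Pp: "P z = p z" if "z \<in> ?B - {a}" for z
      using Zr[of z] rC[OF that] that unz[of z] by (simp add: P_def q_def vector_smult_assoc)
    show "P a \<noteq> 0"
    proof
      assume "P a = 0"
      then have "Z a *v C = Z a *v 0" using unz[of a] by (simp add: P_def)
      moreover have "invertible (Z a)" using Z(2) \<delta> by simp
      ultimately have "C = 0" by (rule invertible_vector_cancel[rotated])
      then have "P z0 = 0" by (simp add: P_def)
      then show False using Pp[OF nz(1)] nz(2) by simp
    qed
  qed
qed

subsection \<open>Coefficients of the system\<close>

lemma tendsto_shifted_inverse_at_infinity: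
  fixes a c :: complex
  shows "((\<lambda>z. c / (z - a)) \<longlongrightarrow> 0) at_infinity"
proof -
  have "filterlim (\<lambda>z. - a + z) at_infinity at_infinity"
    by (intro tendsto_add_filterlim_at_infinity[of _ "- a"] tendsto_const filterlim_ident)
  then show ?thesis by (intro tendsto_divide_0[of _ c] tendsto_const) simp
qed

lemma eventually_at_infinity_gt: "\<forall>\<^sub>F z in at_infinity. R < cmod z"
  unfolding eventually_at_infinity by (rule exI[of _ "R + 1"]) auto

lemma tendsto_quotient_at_infinity:
  fixes a :: complex
  shows "((\<lambda>z. z / (z - a)) \<longlongrightarrow> 1) at_infinity"
proof (rule Lim_transform_eventually)
  show "((\<lambda>z. 1 + a / (z - a)) \<longlongrightarrow> 1) at_infinity"
    using tendsto_add[OF tendsto_const tendsto_shifted_inverse_at_infinity] by force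
  show "\<forall>\<^sub>F z in at_infinity. 1 + a / (z - a) = z / (z - a)"
    using eventually_at_infinity_gt[of "cmod a"]
  proof eventually_elim
    case (elim z)
    then have "z - a \<noteq> 0" by auto
    then show ?case by (simp add: field_simps)
  qed
qed

lemma tendsto_inverse_coordinate:
  fixes h :: "complex \<Rightarrow> complex"
  assumes "isCont h 0"
  shows "((\<lambda>z. h (1 / z)) \<longlongrightarrow> h 0) at_infinity"
  using isCont_tendsto_compose[OF assms tendsto_inverse_0] by (simp add: inverse_eq_divide)

lemma tendsto_negative_power_at_infinity:
  assumes "k < 0"
  shows "((\<lambda>z::complex. z powi k) \<longlongrightarrow> 0) at_infinity"
proof -
  have "((\<lambda>z::complex. inverse z ^ nat (- k)) \<longlongrightarrow> 0) at_infinity"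
    using assms by (intro tendsto_null_power tendsto_inverse_0) auto
  then show ?thesis using assms by (simp add: power_int_def)
qed

text \<open>Only the value g z z enters the extended function. It equals g z on a whole ball about
  z, because the radius is at most the distance to the other points of F.\<close>

lemma entire_extension:
  fixes f :: "complex \<Rightarrow> complex"
  assumes F: "finite F" and f: "f holomorphic_on - F"
    and g: "\<And>a. a \<in> F \<Longrightarrow> \<delta> a > 0" "\<And>a. a \<in> F \<Longrightarrow> g a holomorphic_on ball a (\<delta> a)"
      "\<And>a z. a \<in> F \<Longrightarrow> z \<in> ball a (\<delta> a) - {a} \<Longrightarrow> g a z = f z"
  shows "(\<lambda>z. if z \<in> F then g z z else f z) holomorphic_on UNIV"
proof -
  let ?G = "\<lambda>z. if z \<in> F then g z z else f z"
  have "?G field_differentiable (at z)" for z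
  proof (cases "z \<in> F")
    case False
    have o: "open (- F)" using F by (simp add: finite_imp_closed open_Compl)
    have "f field_differentiable (at z)" using f False o by (simp add: holomorphic_on_open field_differentiable_def)
    then obtain f' where "(f has_field_derivative f') (at z)" by (auto simp: field_differentiable_def)
    then have "(?G has_field_derivative f') (at z)"
      by (rule has_field_derivative_transform_within_open[OF _ o]) (use False in auto)
    then show ?thesis by (auto simp: field_differentiable_def)
  next
    case True
    obtain d where d: "d > 0" "\<forall>x\<in>F. x \<noteq> z \<longrightarrow> d \<le> dist z x" using finite_set_avoid[OF F] by blast
    define e where "e = min d (\<delta> z)"
    have e: "e > 0" using d g(1)[OF True] by (simp add: e_def)
    have "g z field_differentiable (at z)"
      using g(2)[OF True] g(1)[OF True] by (simp add: holomorphic_on_open field_differentiable_def)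
    moreover have "g z x = ?G x" if "x \<in> ball z e" for x
    proof (cases "x = z")
      case False
      then have "x \<notin> F" using d that by (auto simp: e_def)
      then show ?thesis using g(3)[OF True, of x] that False by (auto simp: e_def)
    qed (use True in simp)
    moreover obtain g' where "(g z has_field_derivative g') (at z)"
      using \<open>g z field_differentiable (at z)\<close> by (auto simp: field_differentiable_def)
    ultimately have "(?G has_field_derivative g') (at z)"
      using has_field_derivative_transform_within_open[of "g z" g' z "ball z e" ?G] e by simp
    then show ?thesis by (auto simp: field_differentiable_def)
  qed
  then show ?thesis by (simp add: holomorphic_on_def)
qed

lemma infinity_form:
  fixes A :: "complex \<Rightarrow> complex^2^2"
  assumes "local_form_at_infinity m a \<kappa> A"
  obtains R Z where "R > 0" "\<And>j. j \<in> {1..m} \<Longrightarrow> cmod (a j) \<le> R"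
    "\<And>i j. (\<lambda>u. Z u $ i $ j) holomorphic_on ball 0 (1 / R)"
    "\<And>u. u \<in> ball 0 (1 / R) \<Longrightarrow> invertible (Z u)"
    "fundamental_on A {z. R < cmod z} (\<lambda>z. diag_powers \<kappa> z ** Z (1 / z))"
proof -
  obtain \<delta> Z where \<delta>: "\<delta> > 0" "\<forall>j\<in>{1..m}. cmod (a j) \<le> 1 / \<delta>"
    and Z: "analytic_matrix_on Z (ball 0 \<delta>)" "\<forall>u\<in>ball 0 \<delta>. invertible (Z u)"
    and sol: "\<And>Y. solution_on A {z. cmod z > 1 / \<delta>} (\<lambda>z. z) Y \<longleftrightarrow>
       (\<exists>C. invertible C \<and> (\<forall>z. cmod z > 1 / \<delta> \<longrightarrow> Y z = diag_powers \<kappa> z ** Z (1 / z) ** C))"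
    using assms unfolding local_form_at_infinity_def by blast
  define \<Phi> where "\<Phi> z = diag_powers \<kappa> z ** Z (1 / z)" for z
  have "invertible (mat 1 :: complex^2^2)" by (simp add: invertible_det_nz)
  then have S: "solution_on A {z. cmod z > 1 / \<delta>} (\<lambda>z. z) \<Phi>"
    unfolding sol by (intro exI[of _ "mat 1"]) (simp add: \<Phi>_def)
  have "fundamental_on A {z. 1 / \<delta> < cmod z} \<Phi>"
    unfolding fundamental_on_def
  proof (intro ballI)
    fix z assume z: "z \<in> {z. 1 / \<delta> < cmod z}"
    obtain V s where V: "invertible (\<Phi> z)" "open V" "z \<in> V" "\<And>z. z \<in> V \<Longrightarrow> s z = z"
      and D: "\<And>i j. ((\<lambda>z. \<Phi> (s z) $ i $ j) has_field_derivative (A z ** \<Phi> z) $ i $ j) (at z)"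
      using S[unfolded solution_on_def, rule_format, OF z] by blast
    have "((\<lambda>z. \<Phi> z $ i $ j) has_field_derivative (A z ** \<Phi> z) $ i $ j) (at z)" for i j
      by (rule has_field_derivative_transform_within_open[OF D V(2,3)]) (simp add: V(4))
    then show "invertible (\<Phi> z) \<and>
        (\<forall>i j. ((\<lambda>z. \<Phi> z $ i $ j) has_field_derivative (A z ** \<Phi> z) $ i $ j) (at z))"
      using V(1) by blast
  qed
  then show thesis
    using that[of "1 / \<delta>" Z] \<delta> Z by (simp add: \<Phi>_def[abs_def] analytic_matrix_on_def analytic_imp_holomorphic)
qed

lemma diag_powers_mult:
  fixes M :: "complex^2^2"
  shows "(diag_powers \<kappa> z ** M) $ i $ j = z powi \<kappa> i * M $ i $ j"
  using exhaust_2[of i] by (auto simp: matrix_matrix_mult_2 diag_powers_def)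

text \<open>With D = diag (z^\<kappa>_i) and Z taken at 1 / z, A = \<Phi>' \<Phi>^{-1} equals diag
  (\<kappa>_i) / z - D Z' Z^{-1} D^{-1} / z^2. Thus h1 is the trace of Z' Z^{-1}, h2 is minus its
  entry (2,1), and the conjugation by D puts the power \<kappa>_2 - \<kappa>_1 into that entry of
  A.\<close>

lemma coefficients_at_infinity:
  fixes A :: "complex \<Rightarrow> complex^2^2"
  assumes R: "R > 0" and Z: "\<And>i j. (\<lambda>u. Z u $ i $ j) holomorphic_on ball 0 (1 / R)"
    "\<And>u. u \<in> ball 0 (1 / R) \<Longrightarrow> invertible (Z u)"
    and fund: "fundamental_on A {z. R < cmod z} (\<lambda>z. diag_powers \<kappa> z ** Z (1 / z))"
  obtains h1 h2 where "isCont h1 0" "isCont h2 0"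
    "\<And>z. R < cmod z \<Longrightarrow> trace (A z) = of_int (\<kappa> 1 + \<kappa> 2) / z - h1 (1 / z) / z\<^sup>2"
    "\<And>z. R < cmod z \<Longrightarrow> A z $ 2 $ 1 = z powi (\<kappa> 2 - \<kappa> 1 - 2) * h2 (1 / z)"
proof -
  let ?B = "ball (0::complex) (1 / R)"
  define Z' where "Z' u = (\<chi> i j. deriv (\<lambda>u. Z u $ i $ j) u)" for u
  define D where "D u = Z u $ 1 $ 1 * Z u $ 2 $ 2 - Z u $ 1 $ 2 * Z u $ 2 $ 1" for u
  have D: "D u \<noteq> 0" if "u \<in> ?B" for u
    using Z(2)[OF that] by (simp add: D_def invertible_det_nz det_2)
  have DZ: "((\<lambda>z. Z z $ i $ j) has_field_derivative Z' u $ i $ j) (at u)" if "u \<in> ?B" for u i j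
    using holomorphic_derivI[OF Z(1) open_ball that] by (simp add: Z'_def)
  have Z'h: "(\<lambda>u. Z' u $ i $ j) holomorphic_on ?B" for i j
    using holomorphic_deriv[OF Z(1) open_ball] by (simp add: Z'_def)
  define h1 where "h1 u = (Z' u $ 1 $ 1 * Z u $ 2 $ 2 - Z' u $ 1 $ 2 * Z u $ 2 $ 1 +
      Z u $ 1 $ 1 * Z' u $ 2 $ 2 - Z u $ 1 $ 2 * Z' u $ 2 $ 1) / D u" for u
  define h2 where "h2 u = (Z' u $ 2 $ 2 * Z u $ 2 $ 1 - Z' u $ 2 $ 1 * Z u $ 2 $ 2) / D u" for u
  have h: "h1 holomorphic_on ?B" "h2 holomorphic_on ?B"
    unfolding h1_def[abs_def] h2_def[abs_def] D_def[abs_def]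
    using D by (intro holomorphic_intros Z(1) Z'h; simp add: D_def)+
  have key: "A z $ i $ 1 * z powi \<kappa> 1 * Z (1 / z) $ 1 $ j + A z $ i $ 2 * z powi \<kappa> 2 * Z (1 / z) $ 2 $ j =
      z powi \<kappa> i * (of_int (\<kappa> i) / z * Z (1 / z) $ i $ j - Z' (1 / z) $ i $ j / z\<^sup>2)"
    if z: "R < cmod z" for z i j
  proof -
    have z0: "z \<noteq> 0" using z R by auto
    then have u: "1 / z \<in> ?B" using z R by (simp add: norm_divide field_simps)
    have pw: "((\<lambda>z. z powi \<kappa> i) has_field_derivative of_int (\<kappa> i) / z * z powi \<kappa> i) (at z)"
      using z0 by (auto intro!: derivative_eq_intros simp: power_int_diff)
    have dz: "((\<lambda>z. 1 / z) has_field_derivative - 1 / z\<^sup>2) (at z)"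
      using z0 by (auto intro!: derivative_eq_intros simp: power2_eq_square)
    have "((\<lambda>z. z powi \<kappa> i * Z (1 / z) $ i $ j) has_field_derivative
        of_int (\<kappa> i) / z * z powi \<kappa> i * Z (1 / z) $ i $ j + Z' (1 / z) $ i $ j * (- 1 / z\<^sup>2) * z powi \<kappa> i) (at z)"
      by (rule DERIV_mult[OF pw DERIV_chain2[OF DZ[OF u] dz]])
    moreover have "((\<lambda>z. z powi \<kappa> i * Z (1 / z) $ i $ j) has_field_derivative
        A z $ i $ 1 * (z powi \<kappa> 1 * Z (1 / z) $ 1 $ j) + A z $ i $ 2 * (z powi \<kappa> 2 * Z (1 / z) $ 2 $ j)) (at z)"
      using fund z unfolding fundamental_on_def matrix_matrix_mult_2[of "A _"] diag_powers_mult by blast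
    ultimately show ?thesis
      using DERIV_unique by (fastforce simp: algebra_simps)
  qed
  show thesis
  proof
    show "isCont h1 0" "isCont h2 0"
      using holomorphic_on_imp_continuous_on[OF h(1)] holomorphic_on_imp_continuous_on[OF h(2)] R
      by (simp_all add: continuous_on_eq_continuous_at)
    fix z assume z: "R < cmod z"
    define W W' where "W = Z (1 / z)" and "W' = Z' (1 / z)"
    define x y q where "x = z powi \<kappa> 1" and "y = z powi \<kappa> 2" and "q = 1 / z\<^sup>2"
    define c1 c2 :: complex where "c1 = of_int (\<kappa> 1) / z" and "c2 = of_int (\<kappa> 2) / z"
    have z0: "z \<noteq> 0" using z R by auto
    then have u: "1 / z \<in> ?B" using z R by (simp add: norm_divide field_simps)
    have xy: "x \<noteq> 0" "y \<noteq> 0" using z0 by (auto simp: x_def y_def)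
    define d where "d = W $ 1 $ 1 * W $ 2 $ 2 - W $ 1 $ 2 * W $ 2 $ 1"
    have d: "d \<noteq> 0" "D (1 / z) = d" using D[OF u] by (auto simp: d_def D_def W_def)
    have e: "A z $ 1 $ 1 * x * W $ 1 $ 1 + A z $ 1 $ 2 * y * W $ 2 $ 1 = x * (c1 * W $ 1 $ 1 - W' $ 1 $ 1 * q)"
      "A z $ 1 $ 1 * x * W $ 1 $ 2 + A z $ 1 $ 2 * y * W $ 2 $ 2 = x * (c1 * W $ 1 $ 2 - W' $ 1 $ 2 * q)"
      "A z $ 2 $ 1 * x * W $ 1 $ 1 + A z $ 2 $ 2 * y * W $ 2 $ 1 = y * (c2 * W $ 2 $ 1 - W' $ 2 $ 1 * q)"
      "A z $ 2 $ 1 * x * W $ 1 $ 2 + A z $ 2 $ 2 * y * W $ 2 $ 2 = y * (c2 * W $ 2 $ 2 - W' $ 2 $ 2 * q)"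
      using key[OF z] by (simp_all add: x_def y_def q_def c1_def c2_def W_def W'_def)
    have "x * (A z $ 1 $ 1 * d) = x * (c1 * d - q * (W' $ 1 $ 1 * W $ 2 $ 2 - W' $ 1 $ 2 * W $ 2 $ 1))"
      using e(1,2) unfolding d_def by algebra
    then have a11: "A z $ 1 $ 1 * d = c1 * d - q * (W' $ 1 $ 1 * W $ 2 $ 2 - W' $ 1 $ 2 * W $ 2 $ 1)"
      using xy by simp
    have "y * (A z $ 2 $ 2 * d) = y * (c2 * d - q * (W $ 1 $ 1 * W' $ 2 $ 2 - W $ 1 $ 2 * W' $ 2 $ 1))"
      using e(3,4) unfolding d_def by algebra
    then have a22: "A z $ 2 $ 2 * d = c2 * d - q * (W $ 1 $ 1 * W' $ 2 $ 2 - W $ 1 $ 2 * W' $ 2 $ 1)"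
      using xy by simp
    have h1: "h1 (1 / z) * d = W' $ 1 $ 1 * W $ 2 $ 2 - W' $ 1 $ 2 * W $ 2 $ 1 +
        W $ 1 $ 1 * W' $ 2 $ 2 - W $ 1 $ 2 * W' $ 2 $ 1"
      using d by (simp add: h1_def W_def W'_def)
    have "trace (A z) * d = (c1 + c2 - q * h1 (1 / z)) * d"
      using a11 a22 h1 unfolding trace_def sum_2 by algebra
    then have "trace (A z) = c1 + c2 - q * h1 (1 / z)" using d by simp
    then show "trace (A z) = of_int (\<kappa> 1 + \<kappa> 2) / z - h1 (1 / z) / z\<^sup>2"
      by (simp add: c1_def c2_def q_def add_divide_distrib)
    have h2: "h2 (1 / z) * d = W' $ 2 $ 2 * W $ 2 $ 1 - W' $ 2 $ 1 * W $ 2 $ 2"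
      using d by (simp add: h2_def W_def W'_def)
    have "(x * A z $ 2 $ 1) * d = (y * q * h2 (1 / z)) * d"
      using e(3,4) h2 unfolding d_def by algebra
    then have "x * A z $ 2 $ 1 = y * q * h2 (1 / z)" using d by simp
    then have "A z $ 2 $ 1 = y / x * q * h2 (1 / z)" using xy by (simp add: field_simps)
    moreover have "z powi (\<kappa> 2 - \<kappa> 1 - 2) = y / x * q"
      using z0 by (simp add: power_int_diff x_def y_def q_def)
    ultimately show "A z $ 2 $ 1 = z powi (\<kappa> 2 - \<kappa> 1 - 2) * h2 (1 / z)" by simp
  qed
qed

text \<open>Here A = Z' Z^{-1} + Z E Z^{-1} / (z - a_k): the pole is simple, and conjugation leaves
  the trace of E as residue of the trace. The matrix X is (z - a_k) A Z, continued analytically to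
  a_k.\<close>

lemma coefficients_at_singularity:
  fixes E :: "complex^2^2"
  assumes "local_form_at m a k E A"
  obtains \<delta> h1 h2 where "\<delta> > 0" "h1 holomorphic_on ball (a k) \<delta>" "h2 holomorphic_on ball (a k) \<delta>"
    "\<And>j. j \<in> {1..m} \<Longrightarrow> j \<noteq> k \<Longrightarrow> a j \<notin> ball (a k) \<delta>"
    "\<And>z. z \<in> ball (a k) \<delta> - {a k} \<Longrightarrow> trace (A z) = trace E / (z - a k) + h1 z"
    "\<And>z. z \<in> ball (a k) \<delta> - {a k} \<Longrightarrow> A z $ 2 $ 1 = h2 z / (z - a k)"
proof -
  obtain \<delta> Z where \<delta>: "\<delta> > 0" "\<And>j. j \<in> {1..m} \<Longrightarrow> j \<noteq> k \<Longrightarrow> a j \<notin> ball (a k) \<delta>"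
    and Z: "\<And>i j. (\<lambda>z. Z z $ i $ j) holomorphic_on ball (a k) \<delta>"
      "\<And>z. z \<in> ball (a k) \<delta> \<Longrightarrow> invertible (Z z)"
    and eq: "\<And>z i j. z \<in> ball (a k) \<delta> - {a k} \<Longrightarrow>
       (z - a k) * (A z ** Z z) $ i $ j = (z - a k) * deriv (\<lambda>z. Z z $ i $ j) z + (Z z ** E) $ i $ j"
    using local_form_equation[OF assms] by blast
  let ?B = "ball (a k) \<delta>"
  define Z' where "Z' u = (\<chi> i j. deriv (\<lambda>u. Z u $ i $ j) u)" for u
  define D where "D u = Z u $ 1 $ 1 * Z u $ 2 $ 2 - Z u $ 1 $ 2 * Z u $ 2 $ 1" for u
  have D: "D u \<noteq> 0" if "u \<in> ?B" for u
    using Z(2)[OF that] by (simp add: D_def invertible_det_nz det_2)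
  have Z'h: "(\<lambda>u. Z' u $ i $ j) holomorphic_on ?B" for i j
    using holomorphic_deriv[OF Z(1) open_ball] by (simp add: Z'_def)
  define h1 where "h1 u = (Z' u $ 1 $ 1 * Z u $ 2 $ 2 - Z' u $ 1 $ 2 * Z u $ 2 $ 1 +
      Z u $ 1 $ 1 * Z' u $ 2 $ 2 - Z u $ 1 $ 2 * Z' u $ 2 $ 1) / D u" for u
  define X where "X u = (\<chi> i j. (u - a k) * Z' u $ i $ j + (Z u $ i $ 1 * E $ 1 $ j + Z u $ i $ 2 * E $ 2 $ j))" for u
  define h2 where "h2 u = (X u $ 2 $ 1 * Z u $ 2 $ 2 - X u $ 2 $ 2 * Z u $ 2 $ 1) / D u" for u
  have Xh: "(\<lambda>u. X u $ i $ j) holomorphic_on ?B" for i j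
    unfolding X_def vec_lambda_beta by (intro holomorphic_intros Z(1) Z'h)
  have h: "h1 holomorphic_on ?B" "h2 holomorphic_on ?B"
    unfolding h1_def[abs_def] h2_def[abs_def] D_def[abs_def]
    using D by (intro holomorphic_intros Z(1) Z'h Xh; simp add: D_def)+
  have c: "trace (A z) = trace E / (z - a k) + h1 z" "A z $ 2 $ 1 = h2 z / (z - a k)"
    if z: "z \<in> ?B - {a k}" for z
  proof -
    define b where "b = z - a k"
    have b: "b \<noteq> 0" using z by (simp add: b_def)
    have d: "D z \<noteq> 0" using D z by blast
    have e: "b * (A z $ i $ 1 * Z z $ 1 $ j + A z $ i $ 2 * Z z $ 2 $ j) = X z $ i $ j" for i j
      using eq[OF z, of i j] by (simp add: b_def X_def Z'_def matrix_matrix_mult_2)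
    have X: "X z $ i $ j = b * Z' z $ i $ j + (Z z $ i $ 1 * E $ 1 $ j + Z z $ i $ 2 * E $ 2 $ j)" for i j
      by (simp add: X_def b_def)
    have h2: "h2 z * D z = X z $ 2 $ 1 * Z z $ 2 $ 2 - X z $ 2 $ 2 * Z z $ 2 $ 1"
      using d by (simp add: h2_def)
    have "b * A z $ 2 $ 1 * D z = h2 z * D z"
      unfolding h2 unfolding D_def e[symmetric] by (simp add: algebra_simps)
    then have "b * A z $ 2 $ 1 = h2 z" using d by simp
    then show "A z $ 2 $ 1 = h2 z / (z - a k)" using b by (simp add: b_def[symmetric] field_simps)
    have h1: "h1 z * D z = Z' z $ 1 $ 1 * Z z $ 2 $ 2 - Z' z $ 1 $ 2 * Z z $ 2 $ 1 +
        Z z $ 1 $ 1 * Z' z $ 2 $ 2 - Z z $ 1 $ 2 * Z' z $ 2 $ 1"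
      using d by (simp add: h1_def)
    have "(b * trace (A z)) * D z = (trace E + b * h1 z) * D z"
      using e[of 1 1] e[of 1 2] e[of 2 1] e[of 2 2] h1 unfolding X D_def trace_def sum_2 by algebra
    then have "b * trace (A z) = trace E + b * h1 z" using d by simp
    then show "trace (A z) = trace E / (z - a k) + h1 z"
      using b by (simp add: b_def[symmetric] field_simps)
  qed
  show thesis by (rule that[OF \<delta>(1) h \<delta>(2) c])
qed

section \<open>Liouville arguments for the indices\<close>

lemma sum_simple_poles_split:
  fixes a :: "nat \<Rightarrow> complex"
  assumes "k \<in> {1..m}"
  shows "(\<Sum>j=1..m. c j / (z - a j)) = c k / (z - a k) + (\<Sum>j\<in>{1..m} - {k}. c j / (z - a j))"
  using assms by (simp add: sum.remove)

lemma sum_simple_poles_regular: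
  fixes a :: "nat \<Rightarrow> complex"
  assumes "\<And>j. j \<in> {1..m} \<Longrightarrow> j \<noteq> k \<Longrightarrow> a j \<notin> ball (a k) \<delta>"
  shows "(\<lambda>z. \<Sum>j\<in>{1..m} - {k}. c j / (z - a j)) holomorphic_on ball (a k) \<delta>"
  using assms by (intro holomorphic_intros) auto

text \<open>Subtracting its principal parts makes the trace of A entire with limit 0 at \<infinity>,
  hence zero. The claim compares the coefficients of 1 / z at \<infinity>.\<close>

lemma sum_indices_eq_sum_traces:
  fixes A :: "complex \<Rightarrow> complex^2^2"
  assumes A: "analytic_matrix_on A (UNIV - a ` {1..m})"
    and loc: "\<And>k. k \<in> {1..m} \<Longrightarrow> local_form_at m a k (E k) A"
    and inf: "local_form_at_infinity m a \<kappa> A"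
  shows "of_int (\<kappa> 1 + \<kappa> 2) = (\<Sum>k=1..m. trace (E k))"
proof -
  let ?F = "a ` {1..m}"
  obtain R Z where R: "R > 0" "\<And>j. j \<in> {1..m} \<Longrightarrow> cmod (a j) \<le> R"
    and Z: "\<And>i j. (\<lambda>u. Z u $ i $ j) holomorphic_on ball 0 (1 / R)"
      "\<And>u. u \<in> ball 0 (1 / R) \<Longrightarrow> invertible (Z u)"
      "fundamental_on A {z. R < cmod z} (\<lambda>z. diag_powers \<kappa> z ** Z (1 / z))"
    by (rule infinity_form[OF inf], rule that)
  obtain h h' where h1: "isCont h 0" and "isCont h' 0"
    and h2: "\<And>z. R < cmod z \<Longrightarrow> trace (A z) = of_int (\<kappa> 1 + \<kappa> 2) / z - h (1 / z) / z\<^sup>2"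
    and "\<And>z. R < cmod z \<Longrightarrow> A z $ 2 $ 1 = z powi (\<kappa> 2 - \<kappa> 1 - 2) * h' (1 / z)"
    by (rule coefficients_at_infinity[OF R(1) Z], assumption, rule that)
  define f where "f z = trace (A z) - (\<Sum>j=1..m. trace (E j) / (z - a j))" for z
  have Ah: "(\<lambda>z. A z $ i $ j) holomorphic_on - ?F" for i j
    using A by (simp add: analytic_matrix_on_def analytic_imp_holomorphic Compl_eq_Diff_UNIV)
  have fh: "f holomorphic_on - ?F"
    unfolding f_def[abs_def] trace_def sum_2 by (intro holomorphic_intros Ah) auto
  have "\<exists>\<delta> g. \<delta> > 0 \<and> g holomorphic_on ball b \<delta> \<and> (\<forall>z\<in>ball b \<delta> - {b}. g z = f z)" if b: "b \<in> ?F" for b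
  proof -
    obtain k where k: "k \<in> {1..m}" "b = a k" using b by blast
    obtain \<delta> h1 h2 where \<delta>: "\<delta> > 0" and h1: "h1 holomorphic_on ball (a k) \<delta>"
      and "h2 holomorphic_on ball (a k) \<delta>"
      and nj: "\<And>j. j \<in> {1..m} \<Longrightarrow> j \<noteq> k \<Longrightarrow> a j \<notin> ball (a k) \<delta>"
      and tr: "\<And>z. z \<in> ball (a k) \<delta> - {a k} \<Longrightarrow> trace (A z) = trace (E k) / (z - a k) + h1 z"
      and "\<And>z. z \<in> ball (a k) \<delta> - {a k} \<Longrightarrow> A z $ 2 $ 1 = h2 z / (z - a k)"
      by (rule coefficients_at_singularity[OF loc[OF k(1)]], rule that)
    show ?thesis
    proof (intro exI conjI)
      show "(\<lambda>z. h1 z - (\<Sum>j\<in>{1..m} - {k}. trace (E j) / (z - a j))) holomorphic_on ball b \<delta>"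
        unfolding k(2) by (intro holomorphic_on_diff h1 sum_simple_poles_regular nj)
      show "\<forall>z\<in>ball b \<delta> - {b}. h1 z - (\<Sum>j\<in>{1..m} - {k}. trace (E j) / (z - a j)) = f z"
        unfolding k(2) f_def using tr sum_simple_poles_split[OF k(1)] by simp
    qed (rule \<delta>)
  qed
  then obtain \<delta> g where "\<And>b. b \<in> ?F \<Longrightarrow> \<delta> b > 0 \<and> g b holomorphic_on ball b (\<delta> b) \<and> (\<forall>z\<in>ball b (\<delta> b) - {b}. g b z = f z)"
    by metis
  then have G: "(\<lambda>z. if z \<in> ?F then g z z else f z) holomorphic_on UNIV"
    by (intro entire_extension[where \<delta> = \<delta>] fh) auto
  have ev: "\<forall>\<^sub>F z in at_infinity. (if z \<in> ?F then g z z else f z) = f z \<and>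
      f z = of_int (\<kappa> 1 + \<kappa> 2) / z - h (1 / z) / z\<^sup>2 - (\<Sum>j=1..m. trace (E j) / (z - a j)) \<and> z \<noteq> 0"
    using eventually_at_infinity_gt[of R]
  proof eventually_elim
    case (elim z)
    have "z \<notin> ?F" "z \<noteq> 0" using elim R by (auto simp: not_le[symmetric])
    then show ?case using h2[OF elim] by (simp add: f_def)
  qed
  have inv: "((\<lambda>z. c / z) \<longlongrightarrow> 0) at_infinity" for c :: complex
    using tendsto_shifted_inverse_at_infinity[of c 0] by simp
  have lim_h: "((\<lambda>z. h (1 / z)) \<longlongrightarrow> h 0) at_infinity" by (rule tendsto_inverse_coordinate[OF h1])
  have "((\<lambda>z. of_int (\<kappa> 1 + \<kappa> 2) / z - h (1 / z) * (1 / z) * (1 / z) - (\<Sum>j=1..m. trace (E j) / (z - a j)))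
      \<longlongrightarrow> 0 - h 0 * 0 * 0 - (\<Sum>j=1..m. 0)) at_infinity"
    by (intro tendsto_intros inv lim_h tendsto_shifted_inverse_at_infinity)
  moreover have "\<forall>\<^sub>F z in at_infinity.
      of_int (\<kappa> 1 + \<kappa> 2) / z - h (1 / z) * (1 / z) * (1 / z) - (\<Sum>j=1..m. trace (E j) / (z - a j)) =
      (if z \<in> ?F then g z z else f z)"
    using ev
  proof eventually_elim
    case (elim z)
    have "h (1 / z) * (1 / z) * (1 / z) = h (1 / z) / z\<^sup>2" by (simp add: power2_eq_square)
    then show ?case using elim by metis
  qed
  ultimately have "((\<lambda>z. if z \<in> ?F then g z z else f z) \<longlongrightarrow> 0 - h 0 * 0 * 0 - (\<Sum>j=1..m. 0)) at_infinity"
    by (rule Lim_transform_eventually)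
  then have "((\<lambda>z. if z \<in> ?F then g z z else f z) \<longlongrightarrow> 0) at_infinity" by simp
  then have G0: "(if z \<in> ?F then g z z else f z) = 0" for z by (rule Liouville_weak_0[OF G])
  \<comment> \<open>The vanishing function f multiplied by z, so that its limit is the coefficient
    of 1 / z.\<close>
  have "((\<lambda>z. of_int (\<kappa> 1 + \<kappa> 2) - h (1 / z) * (1 / z) - (\<Sum>j=1..m. trace (E j) * (z / (z - a j))))
      \<longlongrightarrow> of_int (\<kappa> 1 + \<kappa> 2) - h 0 * 0 - (\<Sum>j=1..m. trace (E j) * 1)) at_infinity"
    by (intro tendsto_intros inv lim_h tendsto_quotient_at_infinity)
  moreover have "\<forall>\<^sub>F z in at_infinity.
      of_int (\<kappa> 1 + \<kappa> 2) - h (1 / z) * (1 / z) - (\<Sum>j=1..m. trace (E j) * (z / (z - a j))) = 0"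
    using ev
  proof eventually_elim
    case (elim z)
    then have "f z = 0" using G0[of z] by metis
    then have "z * (of_int (\<kappa> 1 + \<kappa> 2) / z - h (1 / z) / z\<^sup>2 - (\<Sum>j=1..m. trace (E j) / (z - a j))) = 0"
      using elim by simp
    then show ?case
      using elim by (simp add: right_diff_distrib sum_distrib_left power2_eq_square mult_ac)
  qed
  ultimately have "((\<lambda>z::complex. 0) \<longlongrightarrow> of_int (\<kappa> 1 + \<kappa> 2) - h 0 * 0 - (\<Sum>j=1..m. trace (E j) * 1)) at_infinity"
    by (rule Lim_transform_eventually)
  then have "0 = of_int (\<kappa> 1 + \<kappa> 2) - h 0 * 0 - (\<Sum>j=1..m. trace (E j) * 1)"
    using tendsto_unique[OF trivial_limit_at_infinity tendsto_const] by blast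
  then show ?thesis by simp
qed

text \<open>The product cancels the simple poles of A_21 and grows like z^m, whereas A_21 is bounded
  by a multiple of |z|^(\<kappa>_2 - \<kappa>_1 - 2) near \<infinity>. The hypothesis says exactly
  that the total exponent is negative.\<close>

lemma large_index_difference_imp_triangular:
  fixes A :: "complex \<Rightarrow> complex^2^2"
  assumes A: "analytic_matrix_on A (UNIV - a ` {1..m})"
    and loc: "\<And>k. k \<in> {1..m} \<Longrightarrow> local_form_at m a k (E k) A"
    and inf: "local_form_at_infinity m a \<kappa> A"
    and big: "\<kappa> 1 - \<kappa> 2 > int m - 2"
    and z: "z \<notin> a ` {1..m}"
  shows "A z $ 2 $ 1 = 0"
proof -
  let ?F = "a ` {1..m}"
  obtain R Z where R: "R > 0" "\<And>j. j \<in> {1..m} \<Longrightarrow> cmod (a j) \<le> R"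
    and Z: "\<And>i j. (\<lambda>u. Z u $ i $ j) holomorphic_on ball 0 (1 / R)"
      "\<And>u. u \<in> ball 0 (1 / R) \<Longrightarrow> invertible (Z u)"
      "fundamental_on A {z. R < cmod z} (\<lambda>z. diag_powers \<kappa> z ** Z (1 / z))"
    by (rule infinity_form[OF inf], rule that)
  obtain h' h where "isCont h' 0" and h1: "isCont h 0"
    and "\<And>z. R < cmod z \<Longrightarrow> trace (A z) = of_int (\<kappa> 1 + \<kappa> 2) / z - h' (1 / z) / z\<^sup>2"
    and h2: "\<And>z. R < cmod z \<Longrightarrow> A z $ 2 $ 1 = z powi (\<kappa> 2 - \<kappa> 1 - 2) * h (1 / z)"
    by (rule coefficients_at_infinity[OF R(1) Z], assumption, rule that)
  define f where "f z = A z $ 2 $ 1 * (\<Prod>j=1..m. z - a j)" for z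
  have Ah: "(\<lambda>z. A z $ i $ j) holomorphic_on - ?F" for i j
    using A by (simp add: analytic_matrix_on_def analytic_imp_holomorphic Compl_eq_Diff_UNIV)
  have fh: "f holomorphic_on - ?F"
    unfolding f_def[abs_def] by (intro holomorphic_intros Ah)
  have "\<exists>\<delta> g. \<delta> > 0 \<and> g holomorphic_on ball b \<delta> \<and> (\<forall>z\<in>ball b \<delta> - {b}. g z = f z)" if b: "b \<in> ?F" for b
  proof -
    obtain k where k: "k \<in> {1..m}" "b = a k" using b by blast
    obtain \<delta> h1 h2 where \<delta>: "\<delta> > 0" and "h1 holomorphic_on ball (a k) \<delta>"
      and h2: "h2 holomorphic_on ball (a k) \<delta>"
      and "\<And>j. j \<in> {1..m} \<Longrightarrow> j \<noteq> k \<Longrightarrow> a j \<notin> ball (a k) \<delta>"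
      and "\<And>z. z \<in> ball (a k) \<delta> - {a k} \<Longrightarrow> trace (A z) = trace (E k) / (z - a k) + h1 z"
      and e: "\<And>z. z \<in> ball (a k) \<delta> - {a k} \<Longrightarrow> A z $ 2 $ 1 = h2 z / (z - a k)"
      by (rule coefficients_at_singularity[OF loc[OF k(1)]], rule that)
    show ?thesis
    proof (intro exI conjI)
      show "(\<lambda>z. h2 z * (\<Prod>j\<in>{1..m} - {k}. z - a j)) holomorphic_on ball b \<delta>"
        unfolding k(2) by (intro holomorphic_intros h2)
      show "\<forall>z\<in>ball b \<delta> - {b}. h2 z * (\<Prod>j\<in>{1..m} - {k}. z - a j) = f z"
      proof
        fix z assume z: "z \<in> ball b \<delta> - {b}"
        have "(\<Prod>j=1..m. z - a j) = (z - a k) * (\<Prod>j\<in>{1..m} - {k}. z - a j)"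
          using k(1) by (simp add: prod.remove)
        then show "h2 z * (\<Prod>j\<in>{1..m} - {k}. z - a j) = f z"
          using e[of z] z unfolding k(2) f_def by simp
      qed
    qed (rule \<delta>)
  qed
  then obtain \<delta> g where "\<And>b. b \<in> ?F \<Longrightarrow> \<delta> b > 0 \<and> g b holomorphic_on ball b (\<delta> b) \<and> (\<forall>z\<in>ball b (\<delta> b) - {b}. g b z = f z)"
    by metis
  then have G: "(\<lambda>z. if z \<in> ?F then g z z else f z) holomorphic_on UNIV"
    by (intro entire_extension[where \<delta> = \<delta>] fh) auto
  define n where "n = \<kappa> 2 - \<kappa> 1 - 2 + int m"
  have "n < 0" using big by (simp add: n_def)
  have "((\<lambda>z. z powi n * h (1 / z) * (\<Prod>j=1..m. 1 - a j / z)) \<longlongrightarrow> 0 * h 0 * (\<Prod>j=1..m. 1 - 0)) at_infinity"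
    using tendsto_shifted_inverse_at_infinity[of _ 0]
    by (intro tendsto_intros tendsto_negative_power_at_infinity \<open>n < 0\<close> tendsto_inverse_coordinate h1) auto
  moreover have "\<forall>\<^sub>F z in at_infinity. z powi n * h (1 / z) * (\<Prod>j=1..m. 1 - a j / z) = (if z \<in> ?F then g z z else f z)"
    using eventually_at_infinity_gt[of R]
  proof eventually_elim
    case (elim z)
    have z0: "z \<noteq> 0" using elim R by auto
    have "(\<Prod>j=1..m. z - a j) = (\<Prod>j=1..m. z * (1 - a j / z))"
      using z0 by (intro prod.cong) (auto simp: field_simps)
    also have "\<dots> = z ^ m * (\<Prod>j=1..m. 1 - a j / z)" by (simp add: prod.distrib)
    finally have "f z = z powi (\<kappa> 2 - \<kappa> 1 - 2) * z powi (int m) * h (1 / z) * (\<Prod>j=1..m. 1 - a j / z)"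
      using h2[OF elim] by (simp add: f_def)
    moreover have "z powi (\<kappa> 2 - \<kappa> 1 - 2) * z powi (int m) = z powi n"
      using z0 power_int_add[of z "\<kappa> 2 - \<kappa> 1 - 2" "int m"] by (simp add: n_def)
    moreover have "z \<notin> ?F" using elim R by (auto simp: not_le[symmetric])
    ultimately show ?case by simp
  qed
  ultimately have "((\<lambda>z. if z \<in> ?F then g z z else f z) \<longlongrightarrow> 0) at_infinity"
    using Lim_transform_eventually by fastforce
  then have "(if z \<in> ?F then g z z else f z) = 0" by (rule Liouville_weak_0[OF G])
  then have "f z = 0" using z by simp
  moreover have "(\<Prod>j=1..m. z - a j) \<noteq> 0" using z by auto
  ultimately show ?thesis by (simp add: f_def)
qed

text \<open>The continuation P of p is entire and without zeros, and P_i behaves at \<infinity> like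
  z^(\<kappa>_i - n) times a function with a limit. Components with \<kappa>_i < n vanish by
  Liouville's theorem, and not both can. If the second one vanishes, the first has no zeros, and
  Liouville's theorem for its reciprocal excludes \<kappa>_1 > n.\<close>

lemma index_bounds:
  fixes A :: "complex \<Rightarrow> complex^2^2"
  assumes loc: "\<And>k. k \<in> {1..m} \<Longrightarrow> local_form_at m a k (E k) A"
    and inf: "local_form_at_infinity m a \<kappa> A"
    and le: "\<kappa> 2 \<le> \<kappa> 1"
    and E: "\<And>k. k \<in> {1..m} \<Longrightarrow> has_eigenvalues (E k) (\<epsilon> k) (\<epsilon>' k)"
      "\<And>k. k \<in> {1..m} \<Longrightarrow> non_resonant (E k)"
    and n: "of_int n = (\<Sum>k=1..m. \<epsilon> k)"
    and p: "solves_on A (\<lambda>z. \<Sum>k=1..m. \<epsilon> k / (z - a k)) (- a ` {1..m}) p"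
      "\<And>z. z \<notin> a ` {1..m} \<Longrightarrow> p z \<noteq> 0"
  shows "n \<le> \<kappa> 1"
    and "\<kappa> 2 < n \<Longrightarrow> z \<notin> a ` {1..m} \<Longrightarrow> p z $ 2 = 0"
    and "(\<And>z. z \<notin> a ` {1..m} \<Longrightarrow> p z $ 2 = 0) \<Longrightarrow> \<kappa> 1 = n"
proof -
  let ?F = "a ` {1..m}"
  define \<theta> where "\<theta> z = (\<Sum>k=1..m. \<epsilon> k / (z - a k))" for z
  obtain R Z where R: "R > 0" "\<And>j. j \<in> {1..m} \<Longrightarrow> cmod (a j) \<le> R"
    and Z: "\<And>i j. (\<lambda>u. Z u $ i $ j) holomorphic_on ball 0 (1 / R)"
      "\<And>u. u \<in> ball 0 (1 / R) \<Longrightarrow> invertible (Z u)"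
    and fund: "fundamental_on A {z. R < cmod z} (\<lambda>z. diag_powers \<kappa> z ** Z (1 / z))"
    by (rule infinity_form[OF inf], rule that)
  have p_hol: "(\<lambda>z. p z $ i) holomorphic_on - ?F" for i
    using p(1) by (auto simp: solves_on_def holomorphic_on_open finite_imp_closed open_Compl)
  have "\<exists>\<delta> g. \<delta> > 0 \<and> (\<forall>i. (\<lambda>z. g z $ i) holomorphic_on ball b \<delta>) \<and> (\<forall>z\<in>ball b \<delta> - {b}. g z = p z) \<and> g b \<noteq> 0"
    if b: "b \<in> ?F" for b
  proof -
    obtain k where k: "k \<in> {1..m}" "b = a k" using b by blast
    obtain \<delta> Z where \<delta>: "\<delta> > 0"
      and nj: "\<And>j. j \<in> {1..m} \<Longrightarrow> j \<noteq> k \<Longrightarrow> a j \<notin> ball (a k) \<delta>"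
      and Z: "\<And>i j. (\<lambda>z. Z z $ i $ j) holomorphic_on ball (a k) \<delta>"
        "\<And>z. z \<in> ball (a k) \<delta> \<Longrightarrow> invertible (Z z)"
        "\<And>z i j. z \<in> ball (a k) \<delta> - {a k} \<Longrightarrow>
         (z - a k) * (A z ** Z z) $ i $ j = (z - a k) * deriv (\<lambda>z. Z z $ i $ j) z + (Z z ** E k) $ i $ j"
      by (rule local_form_equation[OF loc[OF k(1)]], rule that)
    have sub: "ball (a k) \<delta> - {a k} \<subseteq> - ?F" using nj by fastforce
    have sol: "solves_on A \<theta> (ball (a k) \<delta> - {a k}) p"
      unfolding \<theta>_def[abs_def] by (rule solves_on_subset[OF p(1) sub])
    have reg: "(\<lambda>z. \<Sum>j\<in>{1..m} - {k}. \<epsilon> j / (z - a j)) holomorphic_on ball (a k) \<delta>"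
      by (rule sum_simple_poles_regular) (rule nj)
    have \<theta>': "\<theta> z = \<epsilon> k / (z - a k) + (\<Sum>j\<in>{1..m} - {k}. \<epsilon> j / (z - a j))" for z
      unfolding \<theta>_def by (rule sum_simple_poles_split[OF k(1)])
    have z0: "a k + of_real (\<delta> / 2) \<in> ball (a k) \<delta> - {a k}" using \<delta> by (simp add: dist_norm)
    then have pz0: "p (a k + of_real (\<delta> / 2)) \<noteq> 0" using p(2) sub by blast
    obtain P where P: "\<And>i. (\<lambda>z. P z $ i) holomorphic_on ball (a k) \<delta>"
      "\<And>z. z \<in> ball (a k) \<delta> - {a k} \<Longrightarrow> P z = p z" "P (a k) \<noteq> 0"
      by (rule regular_extension[OF \<delta> Z E(1)[OF k(1)] E(2)[OF k(1)] sol \<theta>' reg z0 pz0],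
          assumption, assumption, rule that)
    then show ?thesis unfolding k(2) using \<delta> P by blast
  qed
  then obtain \<delta> g where g: "\<And>b. b \<in> ?F \<Longrightarrow> \<delta> b > 0 \<and> (\<forall>i. (\<lambda>z. g b z $ i) holomorphic_on ball b (\<delta> b)) \<and>
      (\<forall>z\<in>ball b (\<delta> b) - {b}. g b z = p z) \<and> g b b \<noteq> 0"
    by metis
  define P where "P z = (if z \<in> ?F then g z z else p z)" for z
  have P_hol: "(\<lambda>z. P z $ i) holomorphic_on UNIV" for i
  proof -
    have "(\<lambda>z. if z \<in> ?F then (\<lambda>b z. g b z $ i) z z else p z $ i) holomorphic_on UNIV"
      using g by (intro entire_extension[where \<delta> = \<delta>] p_hol) auto
    moreover have "(\<lambda>z. P z $ i) = (\<lambda>z. if z \<in> ?F then (\<lambda>b z. g b z $ i) z z else p z $ i)"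
      by (auto simp: P_def)
    ultimately show ?thesis by simp
  qed
  have P_nz: "P z \<noteq> 0" for z using g p(2) by (auto simp: P_def)
  have Pp: "P z = p z" if "z \<notin> ?F" for z using that by (simp add: P_def)
  have far: "z \<notin> ?F" "z \<noteq> 0" if "R < cmod z" for z using R that by force+
  \<comment> \<open>Near \<infinity> the function z powi n * v z is a branch of \<Prod> (z -
    a_k)^\<epsilon>_k. The principal logarithm is usable because |a_k / z| < 1 there.\<close>
  define v where "v z = exp (\<Sum>k=1..m. \<epsilon> k * Ln (1 - a k / z))" for z
  have v: "(v has_field_derivative (\<theta> z - of_int n / z) * v z) (at z)" if z: "R < cmod z" for z
  proof -
    have "((\<lambda>z. \<epsilon> k * Ln (1 - a k / z)) has_field_derivative \<epsilon> k / (z - a k) - \<epsilon> k / z) (at z)"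
      if k: "k \<in> {1..m}" for k
    proof -
      have "cmod (a k / z) < 1" using R(2)[OF k] z R(1) by (simp add: norm_divide divide_simps)
      then have "Re (a k / z) < 1" using complex_Re_le_cmod[of "a k / z"] by linarith
      then have np: "1 - a k / z \<notin> \<real>\<^sub>\<le>\<^sub>0" by (auto simp: complex_nonpos_Reals_iff)
      have zz: "z \<noteq> 0" "z - a k \<noteq> 0" using far[OF z] k by auto
      have "((\<lambda>z. 1 - a k / z) has_field_derivative a k / z\<^sup>2) (at z)"
        using zz by (auto intro!: derivative_eq_intros simp: power2_eq_square)
      then have "((\<lambda>z. \<epsilon> k * Ln (1 - a k / z)) has_field_derivative
          \<epsilon> k * (inverse (1 - a k / z) * (a k / z\<^sup>2))) (at z)"
        by (intro DERIV_cmult DERIV_chain2[where f = Ln and g = "\<lambda>z. 1 - a k / z"]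
            has_field_derivative_Ln np)
      moreover have "\<epsilon> k * (inverse (1 - a k / z) * (a k / z\<^sup>2)) = \<epsilon> k / (z - a k) - \<epsilon> k / z"
        using zz by (simp add: divide_simps power2_eq_square) (simp add: algebra_simps)
      ultimately show ?thesis by simp
    qed
    then have "((\<lambda>z. \<Sum>k=1..m. \<epsilon> k * Ln (1 - a k / z)) has_field_derivative
        (\<Sum>k=1..m. \<epsilon> k / (z - a k) - \<epsilon> k / z)) (at z)"
      by (rule DERIV_sum)
    moreover have "(\<Sum>k=1..m. \<epsilon> k / (z - a k) - \<epsilon> k / z) = \<theta> z - of_int n / z"
      by (simp add: \<theta>_def sum_subtractf n sum_divide_distrib)
    ultimately have "((\<lambda>z. \<Sum>k=1..m. \<epsilon> k * Ln (1 - a k / z)) has_field_derivative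
        \<theta> z - of_int n / z) (at z)" by (rule DERIV_cong)
    from DERIV_fun_exp[OF this] show ?thesis
      unfolding v_def[abs_def] by (simp only: mult.commute)
  qed
  \<comment> \<open>Undoing the twist turns p into a solution of the system itself, hence into the
    fundamental matrix at \<infinity> applied to a constant vector c.\<close>
  have sol: "solves_on A (\<lambda>_. 0) {z. R < cmod z} (\<lambda>z. (z powi n * v z) *s p z)"
  proof -
    have "((\<lambda>z. z powi n * v z) has_field_derivative \<theta> z * (z powi n * v z)) (at z)"
      if "z \<in> {z. R < cmod z}" for z
    proof -
      have zz: "R < cmod z" "z \<noteq> 0" using that far(2) by auto
      have "((\<lambda>z. z powi n) has_field_derivative of_int n / z * z powi n) (at z)"
        using zz by (auto intro!: derivative_eq_intros simp: power_int_diff)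
      from DERIV_mult[OF this v[OF zz(1)]] show ?thesis by (rule DERIV_cong) (simp add: algebra_simps)
    qed
    moreover have "solves_on A \<theta> {z. R < cmod z} p"
      unfolding \<theta>_def[abs_def] by (rule solves_on_subset[OF p(1)]) (use far in blast)
    ultimately have "solves_on A (\<lambda>z. \<theta> z - \<theta> z) {z. R < cmod z} (\<lambda>z. (z powi n * v z) *s p z)"
      by (intro solves_on_twist)
    then show ?thesis by simp
  qed
  have "{z. R < cmod z} = - cball 0 R" by auto
  then have con: "open {z. R < cmod z}" "connected {z. R < cmod z}"
    using connected_complement_bounded_convex[of "cball (0::complex) R"] by auto
  obtain c where "\<forall>z\<in>{z. R < cmod z}. (z powi n * v z) *s p z = (diag_powers \<kappa> z ** Z (1 / z)) *v c"
    using solves_on_fundamental[OF fund sol con] by (elim exE) (rule that)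
  then have c: "(z powi n * v z) *s p z = (diag_powers \<kappa> z ** Z (1 / z)) *v c" if "R < cmod z" for z
    using that by simp
  \<comment> \<open>Up to the factor v, which tends to 1, the component p_i is z powi (\<kappa> i -
    n) times w i (1 / z).\<close>
  define w where "w i u = (Z u *v c) $ i" for i u
  have vnz: "v z \<noteq> 0" for z by (simp add: v_def)
  have p_eq: "p z $ i = z powi (\<kappa> i - n) * (w i (1 / z) / v z)" if z: "R < cmod z" for z i
  proof -
    have "z powi n * v z * p z $ i = z powi \<kappa> i * w i (1 / z)"
      using arg_cong[OF c[OF z], of "\<lambda>x. x $ i"]
      unfolding vector_smult_component matrix_vector_mult_2 diag_powers_mult w_def by (simp add: algebra_simps)
    then show ?thesis using far[OF z] vnz[of z] by (simp add: power_int_diff field_simps)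
  qed
  have "((\<lambda>z. \<Sum>k=1..m. \<epsilon> k * Ln (1 - a k / z)) \<longlongrightarrow> (\<Sum>k=1..m. \<epsilon> k * Ln (1 - 0))) at_infinity"
    using tendsto_shifted_inverse_at_infinity[of _ 0] by (intro tendsto_intros) auto
  then have v_lim: "(v \<longlongrightarrow> 1) at_infinity" unfolding v_def[abs_def] using tendsto_exp by fastforce
  have "isCont (w i) 0" for i
  proof -
    have "continuous_on (ball 0 (1 / R)) (w i)"
      unfolding w_def[abs_def] matrix_vector_mult_2
      by (intro continuous_intros holomorphic_on_imp_continuous_on Z(1))
    then show ?thesis using R(1) by (simp add: continuous_on_eq_continuous_at)
  qed
  then have w_lim: "((\<lambda>z. w i (1 / z)) \<longlongrightarrow> w i 0) at_infinity" for i
    by (rule tendsto_inverse_coordinate)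
  have quot: "((\<lambda>z. w i (1 / z) / v z) \<longlongrightarrow> w i 0) at_infinity" for i
    using tendsto_divide[OF w_lim v_lim] by simp
  have eq_ev: "\<forall>\<^sub>F z in at_infinity. z powi (\<kappa> i - n) * (w i (1 / z) / v z) = P z $ i" for i
    using eventually_at_infinity_gt[of R] by eventually_elim (use p_eq Pp far(1) in auto)
  have small: "P z $ i = 0" if "\<kappa> i < n" for i z
  proof -
    have "((\<lambda>z. z powi (\<kappa> i - n) * (w i (1 / z) / v z)) \<longlongrightarrow> 0 * w i 0) at_infinity"
      using that by (intro tendsto_mult tendsto_negative_power_at_infinity quot) auto
    then have "((\<lambda>z. P z $ i) \<longlongrightarrow> 0) at_infinity" using Lim_transform_eventually[OF _ eq_ev] by fastforce
    then show ?thesis by (rule Liouville_weak_0[OF P_hol])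
  qed
  show first: "n \<le> \<kappa> 1"
  proof (rule ccontr)
    assume "\<not> n \<le> \<kappa> 1"
    then have "P 0 = 0" using small[of 1 0] small[of 2 0] le by (simp add: vec_eq_iff forall_2)
    then show False using P_nz by blast
  qed
  show "p z $ 2 = 0" if "\<kappa> 2 < n" "z \<notin> ?F" using small[OF that(1), of z] Pp[OF that(2)] by simp
  show "\<kappa> 1 = n" if p2: "\<And>z. z \<notin> ?F \<Longrightarrow> p z $ 2 = 0"
  proof (rule ccontr)
    assume "\<kappa> 1 \<noteq> n"
    then have lt: "n - \<kappa> 1 < 0" using first by simp
    have w2: "\<forall>\<^sub>F z in at_infinity. w 2 (1 / z) = 0"
      using eventually_at_infinity_gt[of R]
    proof eventually_elim
      case (elim z)
      then show ?case using p_eq[OF elim, of 2] p2[OF far(1)[OF elim]] far(2)[OF elim] vnz[of z] by simp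
    qed
    have "((\<lambda>z::complex. 0) \<longlongrightarrow> w 2 0) at_infinity" by (rule Lim_transform_eventually[OF w_lim w2])
    then have "0 = w 2 0" using tendsto_unique[OF trivial_limit_at_infinity tendsto_const] by blast
    then have w20: "w 2 0 = 0" by simp
    have "c \<noteq> 0"
    proof
      assume "c = 0"
      then have "p (of_real (R + 1)) $ i = 0" for i using p_eq[of "of_real (R + 1)" i] R(1) by (simp add: w_def)
      then have "p (of_real (R + 1)) = 0" by (simp add: vec_eq_iff)
      then show False using p(2) far(1)[of "of_real (R + 1)"] R(1) by auto
    qed
    \<comment> \<open>The limit vector Z 0 *v c is nonzero, and its second component vanishes
      together with that of p.\<close>
    have "w 1 0 \<noteq> 0"
    proof
      assume "w 1 0 = 0"
      then have "Z 0 *v c = Z 0 *v 0" using w20 by (simp add: w_def vec_eq_iff forall_2)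
      moreover have "invertible (Z 0)" using Z(2) R(1) by simp
      ultimately show False using invertible_vector_cancel \<open>c \<noteq> 0\<close> by blast
    qed
    have P2: "P z $ 2 = 0" for z
    proof -
      have "((\<lambda>z. P z $ 2) \<longlongrightarrow> 0) at_infinity"
        by (rule tendsto_eventually)
           (use eventually_at_infinity_gt[of R] in \<open>eventually_elim, use Pp p2 far(1) in auto\<close>)
      then show ?thesis by (rule Liouville_weak_0[OF P_hol])
    qed
    have P1: "P z $ 1 \<noteq> 0" for z using P_nz[of z] P2[of z] by (auto simp: vec_eq_iff forall_2)
    \<comment> \<open>The reciprocal of the zero-free component P_1 tends to 0, so as an entire
      function it would have to vanish identically.\<close>
    have "((\<lambda>z. z powi (n - \<kappa> 1) * inverse (w 1 (1 / z) / v z)) \<longlongrightarrow> 0 * inverse (w 1 0)) at_infinity"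
      by (intro tendsto_mult tendsto_inverse tendsto_negative_power_at_infinity lt quot \<open>w 1 0 \<noteq> 0\<close>)
    moreover have "\<forall>\<^sub>F z in at_infinity. z powi (n - \<kappa> 1) * inverse (w 1 (1 / z) / v z) = inverse (P z $ 1)"
      using eq_ev[of 1]
    proof eventually_elim
      case (elim z)
      have "z powi (n - \<kappa> 1) = inverse (z powi (\<kappa> 1 - n))" by (simp add: power_int_minus[symmetric])
      then show ?case unfolding elim[symmetric] by (simp only: inverse_mult_distrib)
    qed
    ultimately have "((\<lambda>z. inverse (P z $ 1)) \<longlongrightarrow> 0) at_infinity"
      using Lim_transform_eventually by fastforce
    moreover have "(\<lambda>z. inverse (P z $ 1)) holomorphic_on UNIV" using P1 by (intro holomorphic_intros P_hol)
    ultimately have "inverse (P 0 $ 1) = 0" using Liouville_weak_0[of "\<lambda>z. inverse (P z $ 1)"] by blast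
    then show False using P1 by simp
  qed
qed

subsection \<open>Invariant lines and the main result\<close>

lemma similarity_eq:
  assumes "invertible P" "B = matrix_inv P ** A ** P"
  shows "P ** B = A ** P"
proof -
  have "P ** matrix_inv P = mat 1"
    using someI_ex[OF assms(1)[unfolded invertible_def]] unfolding matrix_inv_def by blast
  then show ?thesis by (simp add: assms(2) matrix_mul_assoc)
qed

lemma similarity_vector:
  fixes A B P :: "complex^2^2"
  assumes "P ** B = A ** P" "B *v x = c *s x"
  shows "A *v (P *v x) = c *s (P *v x)"
proof -
  have "A *v (P *v x) = P *v (B *v x)"
    using assms(1) by (simp add: matrix_vector_mul_assoc)
  then show ?thesis by (simp add: assms(2) vector_scalar_commute)
qed

lemma similarity_vector_inverse:
  fixes A B P :: "complex^2^2"
  assumes "invertible P" "P ** B = A ** P" "A *v (P *v x) = c *s (P *v x)"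
  shows "B *v x = c *s x"
proof (rule invertible_vector_cancel[OF assms(1)])
  show "P *v (B *v x) = P *v (c *s x)"
    using assms(2,3) by (simp add: matrix_vector_mul_assoc vector_scalar_commute)
qed

lemma invertible_vector_preimage:
  fixes P :: "complex^'n^'n"
  assumes "invertible P" "d \<noteq> 0"
  obtains x where "P *v x = d" "x \<noteq> 0"
proof -
  obtain Q where "P ** Q = mat 1" using assms(1) by (auto simp: invertible_def)
  then have "P *v (Q *v d) = d" by (simp add: matrix_vector_mul_assoc)
  moreover from this assms(2) have "Q *v d \<noteq> 0" by auto
  ultimately show thesis by (rule that)
qed

lemma line_invariant_subspace:
  fixes d :: "complex^2"
  assumes "d \<noteq> 0" "\<And>k. k \<in> {1..m} \<Longrightarrow> \<exists>c. M k *v d = c *s d"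
  shows "nontrivial_invariant_subspace m M (range (\<lambda>c. c *s d))"
  unfolding nontrivial_invariant_subspace_def
proof (intro conjI ballI)
  let ?V = "range (\<lambda>c. c *s d)"
  show "vec.subspace ?V"
    unfolding vec.subspace_def
  proof (intro conjI ballI allI)
    show "0 \<in> ?V" by (rule range_eqI[of _ _ 0]) simp
    fix x y assume "x \<in> ?V" "y \<in> ?V"
    then obtain a b where "x = a *s d" "y = b *s d" by blast
    then have "x + y = (a + b) *s d" by (simp add: vector_sadd_rdistrib)
    then show "x + y \<in> ?V" by blast
  next
    fix c x assume "x \<in> ?V"
    then obtain a where "x = a *s d" by blast
    then have "c *s x = (c * a) *s d" by (simp add: vector_smult_assoc)
    then show "c *s x \<in> ?V" by blast
  qed
  have "1 *s d \<in> ?V" by blast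
  then have "d \<in> ?V" by simp
  then show "?V \<noteq> {0}" using assms(1) by blast
  show "?V \<noteq> UNIV"
  proof
    assume "?V = UNIV"
    then have "vector [1, 0] \<in> ?V" "vector [0, 1] \<in> ?V" by auto
    then obtain a b where "vector [1, 0] = a *s d" "vector [0, 1] = b *s d" by blast
    then have "a * d $ 1 = 1" "a * d $ 2 = 0" "b * d $ 1 = 0" "b * d $ 2 = 1"
      by (metis vector_2 vector_smult_component)+
    then show False by auto
  qed
  fix k v assume k: "k \<in> {1..m}" and "v \<in> ?V"
  then obtain a where v: "v = a *s d" by blast
  obtain c where "M k *v d = c *s d" using assms(2)[OF k] by blast
  then have "M k *v v = (a * c) *s d" by (simp add: v vector_scalar_commute vector_smult_assoc)
  then show "M k *v v \<in> ?V" by blast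
qed

lemma unique_invariant_line:
  fixes d e :: "complex^2"
  assumes one: "one_invariant_subspace m M"
    and d: "d \<noteq> 0" "\<And>k. k \<in> {1..m} \<Longrightarrow> \<exists>c. M k *v d = c *s d"
    and e: "e \<noteq> 0" "\<And>k. k \<in> {1..m} \<Longrightarrow> \<exists>c. M k *v e = c *s e"
  shows "\<exists>c. c \<noteq> 0 \<and> e = c *s d"
proof -
  have "range (\<lambda>c. c *s e) = range (\<lambda>c. c *s d)"
    using one line_invariant_subspace[where M = M and m = m, OF d]
      line_invariant_subspace[where M = M and m = m, OF e]
    unfolding one_invariant_subspace_def by blast
  moreover have "1 *s e \<in> range (\<lambda>c. c *s e)" by blast
  ultimately obtain c where "e = c *s d" by auto
  then show ?thesis using e(1) by (intro exI[of _ c]) auto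
qed

text \<open>For m = 0 every line is invariant. Part (ii) therefore concerns only m \<ge> 1, where
  the marked curve is available.\<close>

lemma empty_tuple_reducible:
  fixes M :: "nat \<Rightarrow> complex^2^2"
  shows "\<not> irreducible_tuple 0 M" "\<not> one_invariant_subspace 0 M"
proof -
  have v: "vector [1, 0] \<noteq> (0 :: complex^2)" "vector [0, 1] \<noteq> (0 :: complex^2)"
    by (simp_all add: vec_eq_iff forall_2)
  show "\<not> irreducible_tuple 0 M"
    using line_invariant_subspace[OF v(1), of 0 M] unfolding irreducible_tuple_def by auto
  show "\<not> one_invariant_subspace 0 M"
  proof
    assume "one_invariant_subspace 0 M"
    from unique_invariant_line[OF this v(1) _ v(2)] obtain c :: complex
      where "vector [0, 1] = c *s (vector [1, 0] :: complex^2)" by auto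
    then have "(vector [0, 1] :: complex^2) $ 2 = (c *s (vector [1, 0] :: complex^2)) $ 2" by simp
    then show False by simp
  qed
qed

lemma shifted_marked_curve:
  assumes m: "1 \<le> m" and \<gamma>: "smooth_simple_closed_curve \<gamma>" "positively_oriented \<gamma>"
    and t: "points_in_order m \<gamma> t a"
  shows "marked_curve m (\<lambda>s. \<gamma> (t 1 + s)) (\<lambda>k. t k - t 1)"
    and "path_image (\<lambda>s. \<gamma> (t 1 + s)) = path_image \<gamma>"
    and "subarc m (\<lambda>s. \<gamma> (t 1 + s)) (\<lambda>k. t k - t 1) k = subarc m \<gamma> t k"
proof -
  define \<gamma>' where "\<gamma>' s = \<gamma> (t 1 + s)" for s
  have per: "\<gamma> (s + 1) = \<gamma> s" for s using \<gamma>(1) by (simp add: smooth_simple_closed_curve_def)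
  have inj: "inj_on \<gamma> {0..<1}" using \<gamma>(1) by (simp add: smooth_simple_closed_curve_def)
  note eq_iff = periodic_injective_eq_iff[of \<gamma>, OF per inj]
  have cont: "continuous_on UNIV \<gamma>"
    using \<gamma>(1) C1_differentiable_imp_continuous_on unfolding smooth_simple_closed_curve_def by blast
  then have path: "path \<gamma>" by (auto simp: path_def intro: continuous_on_subset)
  have closed: "pathfinish \<gamma> = pathstart \<gamma>" using per[of 0] by (simp add: pathfinish_def pathstart_def)
  \<comment> \<open>\<open>shiftpath\<close> takes its offset from {0..1}; by periodicity the
    fractional part of t 1 gives the same shift.\<close>
  define c where "c = frac (t 1)"
  have c: "c \<in> {0..1}" using frac_lt_1[of "t 1"] frac_ge_0[of "t 1"] by (simp add: c_def)
  have shift: "\<gamma>' = shiftpath c \<gamma>"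
  proof
    fix s
    have "\<gamma> (c + s) = \<gamma> (t 1 + s)" unfolding eq_iff by (simp add: c_def frac_def)
    moreover have "\<gamma> (c + s - 1) = \<gamma> (c + s)" using per[of "c + s - 1"] by simp
    ultimately show "\<gamma>' s = shiftpath c \<gamma> s" by (simp add: shiftpath_def \<gamma>'_def)
  qed
  have pim: "path_image \<gamma>' = path_image \<gamma>" unfolding shift by (rule path_image_shiftpath[OF c closed])
  then show "path_image (\<lambda>s. \<gamma> (t 1 + s)) = path_image \<gamma>" by (simp add: \<gamma>'_def[abs_def])
  have img: "(\<lambda>s. \<gamma> (t 1 + s)) ` {x - t 1<..<y - t 1} = \<gamma> ` {x<..<y}" for x y
  proof -
    have "(\<lambda>s. t 1 + s) ` {x - t 1<..<y - t 1} = {x<..<y}"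
    proof (intro equalityI subsetI)
      fix s assume "s \<in> {x<..<y}"
      then have "s = t 1 + (s - t 1)" "s - t 1 \<in> {x - t 1<..<y - t 1}" by auto
      then show "s \<in> (\<lambda>s. t 1 + s) ` {x - t 1<..<y - t 1}" by (rule image_eqI)
    qed auto
    then show ?thesis by (metis image_image)
  qed
  show "subarc m (\<lambda>s. \<gamma> (t 1 + s)) (\<lambda>k. t k - t 1) k = subarc m \<gamma> t k"
    unfolding subarc_def using img[of "t k" "t (k + 1)"] img[of "t k" "t 1 + 1"] by simp
  have order: "t j < t k \<and> t k < t j + 1" if "1 \<le> j" "j < k" "k \<le> m" for j k
    using t that unfolding points_in_order_def by auto
  have "marked_curve m \<gamma>' (\<lambda>k. t k - t 1)"
  proof
    show "continuous_on UNIV \<gamma>'"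
      unfolding \<gamma>'_def by (intro continuous_on_compose2[OF cont] continuous_intros) auto
    show "\<gamma>' (s + 1) = \<gamma>' s" for s using per[of "t 1 + s"] by (simp add: \<gamma>'_def add.assoc)
    show "inj_on \<gamma>' {0..<1}"
    proof (rule inj_onI)
      fix x y assume xy: "x \<in> {0..<1}" "y \<in> {0..<1}" "\<gamma>' x = \<gamma>' y"
      then have "x - y \<in> \<int>" unfolding \<gamma>'_def eq_iff by simp
      moreover have "\<bar>x - y\<bar> < 1" using xy by auto
      ultimately show "x = y" using Ints_eq_abs_less1[of "x - y" 0] by simp
    qed
    show "winding_number \<gamma>' z = 1" if "z \<in> inside (path_image \<gamma>')" for z
    proof -
      have z: "z \<in> inside (path_image \<gamma>)" using that pim by simp
      then have "z \<notin> path_image \<gamma>" using inside_no_overlap by blast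
      then show ?thesis
        unfolding shift using winding_number_shiftpath[OF path _ closed c] \<gamma>(2) z
        by (simp add: positively_oriented_def)
    qed
    show "t k - t 1 < 1" if "1 \<le> k" "k \<le> m" for k
      using order[of 1 k] that by (cases "k = 1") auto
  qed (use m order in auto)
  then show "marked_curve m (\<lambda>s. \<gamma> (t 1 + s)) (\<lambda>k. t k - t 1)" by (simp add: \<gamma>'_def[abs_def])
qed

text \<open>This handles m = 0, where there is no marked point to cut at: the plane is simply
  connected and lifts to X as a whole, so the system has a global fundamental matrix.\<close>

lemma twisted_solution_on_plane:
  fixes X :: "'a::real_normed_vector set" and A :: "complex \<Rightarrow> complex^2^2" and v :: "complex^2"
  assumes cov: "covering_space X \<rho> (punctured_sphere 0 a)"
    and Y: "solution_on A (finite_part X \<rho>) (affine_coord \<circ> \<rho>) Y"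
    and v: "v \<noteq> 0"
  obtains p where "solves_on A (\<lambda>_. 0) UNIV p" "\<And>z. p z \<noteq> 0"
proof -
  have S: "punctured_sphere 0 a = sphere 0 1" by (simp add: punctured_sphere_def)
  have "simply_connected (UNIV :: complex set)" by (simp add: convex_imp_simply_connected)
  moreover have "locally path_connected (UNIV :: complex set)" by (simp add: open_imp_locally_path_connected)
  moreover have "to_sphere \<in> UNIV \<rightarrow> punctured_sphere 0 a" unfolding S using to_sphere_in_sphere by blast
  ultimately obtain s where s: "continuous_on UNIV s" "s \<in> UNIV \<rightarrow> X" "\<And>z. \<rho> (s z) = to_sphere z"
    using covering_space_lift[OF cov _ _ continuous_on_to_sphere] by (metis UNIV_I)
  have fund: "fundamental_on A UNIV (\<lambda>z. Y (s z))"
    by (rule fundamental_on_section[OF cov _ open_UNIV s(1) _ Y]) (use s S in auto)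
  show thesis
  proof
    show "solves_on A (\<lambda>_. 0) UNIV (\<lambda>z. Y (s z) *v v)" by (rule fundamental_on_solves[OF fund])
    have "invertible (Y (s z))" for z using fund by (simp add: fundamental_on_def)
    then show "Y (s z) *v v \<noteq> 0" for z
      using invertible_vector_cancel[of "Y (s z)" v 0] v by auto
  qed
qed

text \<open>The results on the normalised curve, restated for the given one and for the matrices N
  of the solution Y. In the second part the line of d is produced before its exponents are known, so
  these are quantified afterwards.\<close>

lemma monodromy_consequences:
  fixes X :: "'a::real_normed_vector set" and A :: "complex \<Rightarrow> complex^2^2"
  assumes m: "1 \<le> m" and \<gamma>: "smooth_simple_closed_curve \<gamma>" "positively_oriented \<gamma>"
    and t: "points_in_order m \<gamma> t a"
    and cov: "covering_space X \<rho> (punctured_sphere m a)"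
    and z0: "z0 \<in> X" "\<rho> z0 \<in> to_sphere ` inside (path_image \<gamma>)"
    and \<sigma>: "standard_deck_transformations m \<gamma> t X \<rho> z0 \<sigma>"
    and Y: "solution_on A (finite_part X \<rho>) (affine_coord \<circ> \<rho>) Y"
    and N: "\<forall>k\<in>{1..m}. \<forall>x\<in>finite_part X \<rho>. Y x = Y (\<sigma> k x) ** N k"
  shows "v \<noteq> 0 \<Longrightarrow> (\<And>k. k \<in> {1..m} \<Longrightarrow> N k *v v = exp (- 2 * pi * \<i> * \<epsilon> k) *s v) \<Longrightarrow>
      of_int n = (\<Sum>k=1..m. \<epsilon> k) \<Longrightarrow>
      \<exists>p. solves_on A (\<lambda>z. \<Sum>k=1..m. \<epsilon> k / (z - a k)) (- a ` {1..m}) p \<and>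
          (\<forall>z. z \<notin> a ` {1..m} \<longrightarrow> p z \<noteq> 0)"
    and "(\<And>z. z \<notin> a ` {1..m} \<Longrightarrow> A z $ 2 $ 1 = 0) \<Longrightarrow>
      \<exists>d. d \<noteq> 0 \<and> (\<forall>k\<in>{1..m}. \<exists>c. N k *v d = c *s d) \<and>
        (\<forall>\<epsilon> n. (\<forall>k\<in>{1..m}. N k *v d = exp (- 2 * pi * \<i> * \<epsilon> k) *s d) \<longrightarrow>
          of_int n = (\<Sum>k=1..m. \<epsilon> k) \<longrightarrow>
          (\<exists>p. solves_on A (\<lambda>z. \<Sum>k=1..m. \<epsilon> k / (z - a k)) (- a ` {1..m}) p \<and>
            (\<forall>z. z \<notin> a ` {1..m} \<longrightarrow> p z \<noteq> 0 \<and> p z $ 2 = 0)))"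
proof -
  define \<gamma>' where "\<gamma>' = (\<lambda>s. \<gamma> (t 1 + s))"
  define t' where "t' = (\<lambda>k. t k - t 1)"
  note shifted = shifted_marked_curve[OF m \<gamma> t, folded \<gamma>'_def t'_def]
  interpret marked_curve m \<gamma>' t' by (rule shifted(1))
  have a: "a k = \<gamma>' (t' k)" if "k \<in> {1..m}" for k
    using t that by (simp add: points_in_order_def \<gamma>'_def t'_def)
  have aimg: "a ` {1..m} = (\<lambda>k. \<gamma>' (t' k)) ` {1..m}" using a by (intro image_cong) auto
  have \<sigma>': "standard_deck_transformations m \<gamma>' t' X \<rho> z0 \<sigma>"
    using \<sigma> unfolding standard_deck_transformations_def encircling_path_def shifted(2,3) .
  have z0': "\<rho> z0 \<in> to_sphere ` inside (path_image \<gamma>')" using z0(2) shifted(2) by simp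
  obtain \<Phi> where \<Phi>: "\<And>k. k \<in> {1..m} \<Longrightarrow> fundamental_on A (arc_complement k) (\<Phi> k)"
    "\<And>i j z. \<lbrakk>i \<in> {1..m}; j \<in> {1..m}; z \<in> inside (path_image \<gamma>')\<rbrakk> \<Longrightarrow> \<Phi> i z = \<Phi> j z"
    "\<And>k z. \<lbrakk>k \<in> {1..m}; z \<in> outside (path_image \<gamma>')\<rbrakk> \<Longrightarrow> \<Phi> k z = \<Phi> (cyclic_pred m k) z ** N k"
    by (rule single_valued_branches[OF cov refl a z0(1) z0' \<sigma>' Y N[rule_format]], assumption, assumption, assumption, rule that)
  have cover: "\<exists>j\<in>{1..m}. z \<in> arc_complement j" if "z \<notin> a ` {1..m}" for z
    using arc_complement_cover that unfolding aimg by blast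
  have twisted: "\<exists>p. solves_on A (\<lambda>z. \<Sum>k=1..m. \<epsilon> k / (z - a k)) (- a ` {1..m}) p \<and>
      (\<forall>j\<in>{1..m}. \<forall>z\<in>arc_complement j. \<exists>c. c \<noteq> 0 \<and> p z = c *s (\<Phi> j z *v v))"
    if v: "\<And>k. k \<in> {1..m} \<Longrightarrow> N k *v v = exp (- 2 * pi * \<i> * \<epsilon> k) *s v"
      and n: "of_int n = (\<Sum>k=1..m. \<epsilon> k)" for v \<epsilon> n
  proof -
    obtain p where "solves_on A (\<lambda>z. \<Sum>k=1..m. \<epsilon> k / (z - a k)) (- a ` {1..m}) p"
      "\<And>j z. j \<in> {1..m} \<Longrightarrow> z \<in> arc_complement j \<Longrightarrow> \<exists>c. c \<noteq> 0 \<and> p z = c *s (\<Phi> j z *v v)"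
      by (rule twisted_single_valued_solution[OF a \<Phi> v n]; (assumption | (rule that; assumption)))
    then show ?thesis by blast
  qed
  have nonzero: "\<Phi> j z *v v \<noteq> 0" if "j \<in> {1..m}" "z \<in> arc_complement j" "v \<noteq> 0" for j z v
    using \<Phi>(1)[OF that(1)] that(2,3) invertible_vector_cancel[of "\<Phi> j z" v 0]
    by (auto simp: fundamental_on_def)
  {
    assume "v \<noteq> 0" "\<And>k. k \<in> {1..m} \<Longrightarrow> N k *v v = exp (- 2 * pi * \<i> * \<epsilon> k) *s v"
      "of_int n = (\<Sum>k=1..m. \<epsilon> k)"
    then obtain p where p: "solves_on A (\<lambda>z. \<Sum>k=1..m. \<epsilon> k / (z - a k)) (- a ` {1..m}) p"
      "\<And>j z. j \<in> {1..m} \<Longrightarrow> z \<in> arc_complement j \<Longrightarrow> \<exists>c. c \<noteq> 0 \<and> p z = c *s (\<Phi> j z *v v)"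
      using twisted[of v \<epsilon> n] by blast
    have "p z \<noteq> 0" if z: "z \<notin> a ` {1..m}" for z
    proof -
      obtain j where j: "j \<in> {1..m}" "z \<in> arc_complement j" using cover[OF z] by blast
      then show ?thesis using p(2)[OF j] nonzero[OF j \<open>v \<noteq> 0\<close>] by auto
    qed
    then show "\<exists>p. solves_on A (\<lambda>z. \<Sum>k=1..m. \<epsilon> k / (z - a k)) (- a ` {1..m}) p \<and>
          (\<forall>z. z \<notin> a ` {1..m} \<longrightarrow> p z \<noteq> 0)"
      using p(1) by blast
  }
  assume A: "\<And>z. z \<notin> a ` {1..m} \<Longrightarrow> A z $ 2 $ 1 = 0"
  have A': "A z $ 2 $ 1 = 0" if "j \<in> {1..m}" "z \<in> arc_complement j" for j z
    using A[of z] arc_complement_cover that unfolding aimg by blast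
  obtain d where d: "d \<noteq> 0" "\<And>k. k \<in> {1..m} \<Longrightarrow> \<exists>c. N k *v d = c *s d"
    "\<And>j z. j \<in> {1..m} \<Longrightarrow> z \<in> arc_complement j \<Longrightarrow> (\<Phi> j z *v d) $ 2 = 0"
    by (rule invariant_line_of_triangular_system[OF A' \<Phi>]; (assumption | (rule that; assumption)))
  have "\<exists>p. solves_on A (\<lambda>z. \<Sum>k=1..m. \<epsilon> k / (z - a k)) (- a ` {1..m}) p \<and>
            (\<forall>z. z \<notin> a ` {1..m} \<longrightarrow> p z \<noteq> 0 \<and> p z $ 2 = 0)"
    if e: "\<forall>k\<in>{1..m}. N k *v d = exp (- 2 * pi * \<i> * \<epsilon> k) *s d" and n: "of_int n = (\<Sum>k=1..m. \<epsilon> k)" for \<epsilon> n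
  proof -
    obtain p where p: "solves_on A (\<lambda>z. \<Sum>k=1..m. \<epsilon> k / (z - a k)) (- a ` {1..m}) p"
      "\<And>j z. j \<in> {1..m} \<Longrightarrow> z \<in> arc_complement j \<Longrightarrow> \<exists>c. c \<noteq> 0 \<and> p z = c *s (\<Phi> j z *v d)"
      using twisted[of d \<epsilon> n] e n by blast
    have "p z \<noteq> 0 \<and> p z $ 2 = 0" if z: "z \<notin> a ` {1..m}" for z
    proof -
      obtain j where j: "j \<in> {1..m}" "z \<in> arc_complement j" using cover[OF z] by blast
      then show ?thesis using p(2)[OF j] nonzero[OF j d(1)] d(3)[OF j] by auto
    qed
    then show ?thesis using p(1) by blast
  qed
  then show "\<exists>d. d \<noteq> 0 \<and> (\<forall>k\<in>{1..m}. \<exists>c. N k *v d = c *s d) \<and>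
        (\<forall>\<epsilon> n. (\<forall>k\<in>{1..m}. N k *v d = exp (- 2 * pi * \<i> * \<epsilon> k) *s d) \<longrightarrow>
          of_int n = (\<Sum>k=1..m. \<epsilon> k) \<longrightarrow>
          (\<exists>p. solves_on A (\<lambda>z. \<Sum>k=1..m. \<epsilon> k / (z - a k)) (- a ` {1..m}) p \<and>
            (\<forall>z. z \<notin> a ` {1..m} \<longrightarrow> p z \<noteq> 0 \<and> p z $ 2 = 0)))"
    using d(1,2) by blast
qed

lemma triangular_eigenvector:
  fixes T :: "complex^2^2"
  assumes "T $ 2 $ 1 = 0"
  shows "T *v vector [1, 0] = T $ 1 $ 1 *s vector [1, 0]"
  using assms by (simp add: vec_eq_iff forall_2 matrix_vector_mult_2)

theorem corollary6p3:
  fixes m :: nat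
    and a :: "nat \<Rightarrow> complex"
    and \<gamma> :: "real \<Rightarrow> complex"
    and t :: "nat \<Rightarrow> real"
    and X :: "'a::real_normed_vector set"
    and \<rho> :: "'a \<Rightarrow> complex \<times> real"
    and z0 :: 'a
    and \<sigma> :: "nat \<Rightarrow> 'a \<Rightarrow> 'a"
    and M E :: "nat \<Rightarrow> complex^2^2"
    and A :: "complex \<Rightarrow> complex^2^2"
    and \<kappa> :: "2 \<Rightarrow> int"
  assumes "smooth_simple_closed_curve \<gamma>"
    and "positively_oriented \<gamma>"
    and "points_in_order m \<gamma> t a"
    and "universal_covering X \<rho> (punctured_sphere m a)"
    and "z0 \<in> X"
    and "\<rho> z0 \<in> to_sphere ` inside (path_image \<gamma>)"
    and "standard_deck_transformations m \<gamma> t X \<rho> z0 \<sigma>"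
    and "admissible_data m M E"
    and "standard_form m a X \<rho> \<sigma> M E \<kappa> A"
    and "\<kappa> 1 \<ge> \<kappa> 2"
  shows "(\<forall>n1 n2.
            (diagonalizable_tuple m M \<and> diagonal_exponent_sums m M E n1 n2) \<or>
            (one_invariant_subspace m M \<and> triangular_exponent_sums m M E n1 n2 \<and> n1 \<ge> n2)
            \<longrightarrow> \<kappa> 1 = n1 \<and> \<kappa> 2 = n2)
       \<and> (irreducible_tuple m M \<or>
            (one_invariant_subspace m M \<and>
               (\<exists>n1 n2. triangular_exponent_sums m M E n1 n2 \<and> n1 < n2))
            \<longrightarrow> \<kappa> 1 - \<kappa> 2 \<le> int m - 2 \<and>
                of_int (\<kappa> 1 + \<kappa> 2) = (\<Sum>k=1..m. trace (E k)))"
proof -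
  let ?F = "a ` {1..m}"
  have cov: "covering_space X \<rho> (punctured_sphere m a)"
    using assms(4) by (simp add: universal_covering_def)
  have A: "analytic_matrix_on A (UNIV - ?F)" and mono: "has_monodromy m X \<rho> \<sigma> A M"
    and loc: "\<And>k. k \<in> {1..m} \<Longrightarrow> local_form_at m a k (E k) A"
    and inf: "local_form_at_infinity m a \<kappa> A"
    using assms(9) by (auto simp: standard_form_def)
  have nonres: "\<And>k. k \<in> {1..m} \<Longrightarrow> non_resonant (E k)"
    using assms(8) by (auto simp: admissible_data_def)
  obtain Y N where Y: "solution_on A (finite_part X \<rho>) (affine_coord \<circ> \<rho>) Y"
    and N: "\<forall>k\<in>{1..m}. \<forall>x\<in>finite_part X \<rho>. Y x = Y (\<sigma> k x) ** N k"
    and NM: "equivalent_tuples m N M"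
    using mono unfolding has_monodromy_def by blast
  \<comment> \<open>P carries common eigenvectors of the prescribed tuple M to those of the actual
    monodromy matrices N, with the same eigenvalues.\<close>
  obtain P where P: "invertible P" "\<And>k. k \<in> {1..m} \<Longrightarrow> P ** M k = N k ** P"
    using NM similarity_eq unfolding equivalent_tuples_def by blast
  note cons = monodromy_consequences[OF _ assms(1-3) cov assms(5-7) Y N]
  have trace: "of_int (\<kappa> 1 + \<kappa> 2) = (\<Sum>k=1..m. trace (E k))"
    by (rule sum_indices_eq_sum_traces[OF A loc inf])
  \<comment> \<open>In triangular form the first basis vector is a common eigenvector with exponents
    \<epsilon>1; the traces bring in \<epsilon>2 and express the sum of the indices by n1 and
    n2.\<close>
  have triangular: "\<exists>v \<epsilon>1 \<epsilon>2. v \<noteq> 0 \<and>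
      (\<forall>k\<in>{1..m}. has_eigenvalues (E k) (\<epsilon>1 k) (\<epsilon>2 k) \<and> M k *v v = exp (- 2 * pi * \<i> * \<epsilon>1 k) *s v) \<and>
      of_int n1 = (\<Sum>k=1..m. \<epsilon>1 k) \<and> \<kappa> 1 + \<kappa> 2 = n1 + n2"
    if tri: "triangular_exponent_sums m M E n1 n2" for n1 n2
  proof -
    obtain T \<epsilon>1 \<epsilon>2 where T: "equivalent_tuples m M T" "upper_triangular_tuple m T"
      and e: "\<And>k. k \<in> {1..m} \<Longrightarrow> has_eigenvalues (E k) (\<epsilon>1 k) (\<epsilon>2 k)"
        "\<And>k. k \<in> {1..m} \<Longrightarrow> T k $ 1 $ 1 = exp (- 2 * pi * \<i> * \<epsilon>1 k)"
      and n: "of_int n1 = (\<Sum>k=1..m. \<epsilon>1 k)" "of_int n2 = (\<Sum>k=1..m. \<epsilon>2 k)"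
      using tri unfolding triangular_exponent_sums_def exponent_sums_def by blast
    obtain Q where Q: "invertible Q" "\<And>k. k \<in> {1..m} \<Longrightarrow> Q ** T k = M k ** Q"
      using T(1) similarity_eq unfolding equivalent_tuples_def by blast
    define v where "v = Q *v vector [1, 0]"
    have "(vector [1, 0] :: complex^2) \<noteq> 0" by (simp add: vec_eq_iff forall_2)
    then have "v \<noteq> 0" using invertible_vector_cancel[OF Q(1), of "vector [1, 0]" 0] by (auto simp: v_def)
    moreover have "M k *v v = exp (- 2 * pi * \<i> * \<epsilon>1 k) *s v" if k: "k \<in> {1..m}" for k
    proof -
      have "T k *v vector [1, 0] = exp (- 2 * pi * \<i> * \<epsilon>1 k) *s vector [1, 0]"
        using triangular_eigenvector[of "T k"] T(2) e(2)[OF k] k by (simp add: upper_triangular_tuple_def)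
      then show ?thesis unfolding v_def by (rule similarity_vector[OF Q(2)[OF k]])
    qed
    moreover have "trace (E k) = \<epsilon>1 k + \<epsilon>2 k" if "k \<in> {1..m}" for k
      using eigenvalues_trace_det(1)[OF e(1)[OF that]] by (simp add: trace_def sum_2)
    then have "complex_of_int (\<kappa> 1 + \<kappa> 2) = of_int (n1 + n2)"
      using trace n by (simp add: sum.distrib)
    then have "\<kappa> 1 + \<kappa> 2 = n1 + n2" by (simp only: of_int_eq_iff)
    ultimately show ?thesis using e(1) n(1) by blast
  qed
  have case1: "\<kappa> 1 = n1 \<and> \<kappa> 2 = n2"
    if tri: "triangular_exponent_sums m M E n1 n2" and le: "n2 \<le> n1" for n1 n2
  proof -
    obtain v \<epsilon>1 \<epsilon>2 where v: "v \<noteq> 0"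
      and e: "\<And>k. k \<in> {1..m} \<Longrightarrow> has_eigenvalues (E k) (\<epsilon>1 k) (\<epsilon>2 k)"
      and Mv: "\<And>k. k \<in> {1..m} \<Longrightarrow> M k *v v = exp (- 2 * pi * \<i> * \<epsilon>1 k) *s v"
      and n: "of_int n1 = (\<Sum>k=1..m. \<epsilon>1 k)" and sum: "\<kappa> 1 + \<kappa> 2 = n1 + n2"
      using triangular[OF tri] by blast
    have "\<exists>p. solves_on A (\<lambda>z. \<Sum>k=1..m. \<epsilon>1 k / (z - a k)) (- ?F) p \<and> (\<forall>z. z \<notin> ?F \<longrightarrow> p z \<noteq> 0)"
    proof (cases "m = 0")
      case True
      obtain p where "solves_on A (\<lambda>_. 0) UNIV p" "\<And>z. p z \<noteq> 0"
        using twisted_solution_on_plane[of X \<rho> a A Y v] cov Y v True by blast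
      then show ?thesis using True by auto
    next
      case False
      then have m: "1 \<le> m" by simp
      have "P *v v \<noteq> 0" using v invertible_vector_cancel[OF P(1), of v 0] by auto
      then show ?thesis
        by (rule cons(1)[OF m]) (use similarity_vector[OF P(2) Mv] n in auto)
    qed
    then obtain p where p: "solves_on A (\<lambda>z. \<Sum>k=1..m. \<epsilon>1 k / (z - a k)) (- ?F) p"
      "\<And>z. z \<notin> ?F \<Longrightarrow> p z \<noteq> 0" by blast
    note bounds = index_bounds[OF loc inf assms(10) e nonres n p]
    have "n1 \<le> \<kappa> 1" using bounds(1) by blast
    \<comment> \<open>The assumption is meant to be refuted: it pushes \<kappa> 2 below n1, so the
      second component of p vanishes and the equality case gives \<kappa> 1 = n1.\<close>
    moreover have "\<kappa> 1 = n1" if "n1 < \<kappa> 1"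
    proof -
      have "\<kappa> 2 < n1" using that sum le by linarith
      then show ?thesis using bounds(2,3) by blast
    qed
    ultimately show ?thesis using sum by linarith
  qed
  have case2: "\<kappa> 1 - \<kappa> 2 \<le> int m - 2"
    if irr: "irreducible_tuple m M \<or> (one_invariant_subspace m M \<and>
               (\<exists>n1 n2. triangular_exponent_sums m M E n1 n2 \<and> n1 < n2))"
  proof (rule ccontr)
    assume "\<not> \<kappa> 1 - \<kappa> 2 \<le> int m - 2"
    then have A21: "\<And>z. z \<notin> ?F \<Longrightarrow> A z $ 2 $ 1 = 0"
      using large_index_difference_imp_triangular[OF A loc inf] by simp
    have m: "1 \<le> m"
    proof (rule ccontr)
      assume "\<not> 1 \<le> m"
      then have "m = 0" by simp
      then show False using irr empty_tuple_reducible[of M] by blast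
    qed
    obtain d where d: "d \<noteq> 0" "\<forall>k\<in>{1..m}. \<exists>c. N k *v d = c *s d"
      and dp: "\<And>\<epsilon> n. (\<forall>k\<in>{1..m}. N k *v d = exp (- 2 * pi * \<i> * \<epsilon> k) *s d) \<Longrightarrow>
          of_int n = (\<Sum>k=1..m. \<epsilon> k) \<Longrightarrow>
          \<exists>p. solves_on A (\<lambda>z. \<Sum>k=1..m. \<epsilon> k / (z - a k)) (- ?F) p \<and>
            (\<forall>z. z \<notin> ?F \<longrightarrow> p z \<noteq> 0 \<and> p z $ 2 = 0)"
      using cons(2)[OF m A21] by blast
    \<comment> \<open>The line found for N is carried back to an invariant line of M.\<close>
    obtain e where e: "P *v e = d" "e \<noteq> 0" using invertible_vector_preimage[OF P(1) d(1)] by blast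
    have Me: "\<exists>c. M k *v e = c *s e" if k: "k \<in> {1..m}" for k
    proof -
      obtain c where "N k *v (P *v e) = c *s (P *v e)" using d(2) k e(1) by blast
      then show ?thesis using similarity_vector_inverse[OF P(1) P(2)[OF k]] by blast
    qed
    have "\<not> irreducible_tuple m M"
      using line_invariant_subspace[where M = M and m = m, OF e(2) Me] unfolding irreducible_tuple_def by blast
    then obtain n1 n2 where one: "one_invariant_subspace m M"
      and tri: "triangular_exponent_sums m M E n1 n2" and lt: "n1 < n2"
      using irr by blast
    obtain v \<epsilon>1 \<epsilon>2 where v: "v \<noteq> 0"
      and ev: "\<And>k. k \<in> {1..m} \<Longrightarrow> has_eigenvalues (E k) (\<epsilon>1 k) (\<epsilon>2 k)"
      and Mv: "\<And>k. k \<in> {1..m} \<Longrightarrow> M k *v v = exp (- 2 * pi * \<i> * \<epsilon>1 k) *s v"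
      and n: "of_int n1 = (\<Sum>k=1..m. \<epsilon>1 k)" and sum: "\<kappa> 1 + \<kappa> 2 = n1 + n2"
      using triangular[OF tri] by blast
    have Mv': "\<And>k. k \<in> {1..m} \<Longrightarrow> \<exists>c. M k *v v = c *s v" using Mv by blast
    \<comment> \<open>As there is only one invariant line, e lies on that of the triangular form;
      hence d has the exponents \<epsilon>1.\<close>
    obtain c where c: "c \<noteq> 0" "e = c *s v"
      using unique_invariant_line[OF one v Mv' e(2) Me] by blast
    have "N k *v d = exp (- 2 * pi * \<i> * \<epsilon>1 k) *s d" if k: "k \<in> {1..m}" for k
    proof -
      have "M k *v e = exp (- 2 * pi * \<i> * \<epsilon>1 k) *s e"
        unfolding c(2) using Mv[OF k] by (simp add: vector_scalar_commute vector_smult_assoc mult.commute)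
      then show ?thesis using similarity_vector[OF P(2)[OF k]] e(1) by blast
    qed
    then have "\<forall>k\<in>{1..m}. N k *v d = exp (- 2 * pi * \<i> * \<epsilon>1 k) *s d" by blast
    from dp[OF this n] obtain p
      where p: "solves_on A (\<lambda>z. \<Sum>k=1..m. \<epsilon>1 k / (z - a k)) (- ?F) p"
      and pz: "\<forall>z. z \<notin> ?F \<longrightarrow> p z \<noteq> 0 \<and> p z $ 2 = 0"
      by (elim exE conjE)
    have p1: "\<And>z. z \<notin> ?F \<Longrightarrow> p z \<noteq> 0" and p2: "\<And>z. z \<notin> ?F \<Longrightarrow> p z $ 2 = 0"
      using pz by blast+
    have "\<kappa> 1 = n1" using index_bounds(3)[OF loc inf assms(10) ev nonres n p p1 p2] by blast
    then show False using sum lt assms(10) by linarith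
  qed
  \<comment> \<open>A diagonal form is in particular triangular, so the diagonalizable case is an
    instance of \<open>case1\<close>.\<close>
  have diag: "triangular_exponent_sums m M E n1 n2 \<and> n2 \<le> n1"
    if "diagonal_exponent_sums m M E n1 n2" for n1 n2
    using that unfolding diagonal_exponent_sums_def triangular_exponent_sums_def
      diagonal_tuple_def upper_triangular_tuple_def by fastforce
  show ?thesis using case1 case2 trace diag by blast
qed

end
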